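(* Let $\ell\geq3$. The spectrum of the Laplacian operator on $\mathrm{Sp}(\ell)$, endowed with the bi-invariant Riemannian metric $g=-\gamma\kappa$ with $\gamma>0$, is $$\mathrm{Spec}(\mathrm{Sp}(\ell))=\{\lambda_\nu:\nu=(\nu_1,\dots,\nu_\ell)\in\mathbb N^\ell\},$$ where $$\lambda_\nu=\frac{1}{4(\ell+1)\gamma}\left[\sum_{k=1}^{\ell}\left(\sum_{j=k}^\ell\nu_j\right)^2-\frac{\ell(\ell+1)(2\ell+1)}{6}\right].$$
   Context: $\mathbb N=\{1,2,3,\dots\}$. $\mathrm{Sp}(\ell)$ is the compact symplectic group of rank $\ell$ (root system $C_\ell$). $\kappa(X,Y)=\mathrm{Tr}(\mathrm{ad}(X)\mathrm{ad}(Y))$ is the Killing form of the Lie algebra of the group $G$; the Laplacian is $\mathcal L_G=-\sum_{j}X_j^2$, where $\{X_j\}$ is a $g$-orthonormal basis of left-invariant vector fields on $G$; $\mathrm{Spec}(G)$ is the set of eigenvalues of $\mathcal L_G$ (without multiplicity). *)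

theory Defs
  imports "HOL-Analysis.Analysis"
begin

section \<open>Smooth functions on subsets of a normed space\<close>

primrec Ck_on :: "nat \<Rightarrow> 'a::real_normed_vector set \<Rightarrow> ('a \<Rightarrow> 'b::real_normed_vector) \<Rightarrow> bool"
  where
    "Ck_on 0 U f \<longleftrightarrow> continuous_on U f"
  | "Ck_on (Suc k) U f \<longleftrightarrow>
       (\<forall>x\<in>U. f differentiable (at x)) \<and>
       (\<forall>v. Ck_on k U (\<lambda>x. frechet_derivative f (at x) v))"

text \<open>A function on an embedded submanifold \<open>S\<close> is smooth iff it locally extends to a smooth
  function on an open subset of the ambient space. Values of \<open>f\<close> outside \<open>S\<close> are irrelevant.\<close>

definition smooth_on :: "'a::real_normed_vector set \<Rightarrow> ('a \<Rightarrow> 'b::real_normed_vector) \<Rightarrow> bool"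
  where "smooth_on S f \<longleftrightarrow>
    (\<forall>x\<in>S. \<exists>U F. open U \<and> x \<in> U \<and> (\<forall>k. Ck_on k U F) \<and> (\<forall>y\<in>U \<inter> S. F y = f y))"

section \<open>Matrix Lie groups and their Lie algebras\<close>

definition mexp :: "complex^'n^'n \<Rightarrow> complex^'n^'n"
  where "mexp A = (\<Sum>k. (1 / fact k) *\<^sub>R (((**) A ^^ k) (mat 1)))"

text \<open>The Lie algebra of a closed subgroup \<open>G\<close> of the general linear group, realised as the real
  vector space of initial velocities of its one-parameter subgroups.\<close>

definition lie_algebra :: "(complex^'n^'n) set \<Rightarrow> (complex^'n^'n) set"
  where "lie_algebra G = {X. \<forall>t::real. mexp (t *\<^sub>R X) \<in> G}"

definition ad :: "complex^'n^'n \<Rightarrow> complex^'n^'n \<Rightarrow> complex^'n^'n"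
  where "ad X Y = X ** Y - Y ** X"

definition basis_of :: "'a::real_vector set \<Rightarrow> 'a set \<Rightarrow> bool"
  where "basis_of V B \<longleftrightarrow> independent B \<and> span B = V"

text \<open>Trace of an endomorphism \<open>T\<close> of a finite-dimensional real vector space \<open>V\<close>: the sum of the
  diagonal entries of its matrix in some basis (the value does not depend on the basis).\<close>

definition trace_on :: "'a::real_vector set \<Rightarrow> ('a \<Rightarrow> 'a) \<Rightarrow> real"
  where "trace_on V T =
    (let B = (SOME B. basis_of V B) in \<Sum>b\<in>B. representation B (T b) b)"

definition killing_form :: "(complex^'n^'n) set \<Rightarrow> complex^'n^'n \<Rightarrow> complex^'n^'n \<Rightarrow> real"
  where "killing_form G X Y = trace_on (lie_algebra G) (ad X \<circ> ad Y)"

section \<open>Laplacian and spectrum of a left-invariant metric\<close>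

text \<open>The derivation given by the left-invariant vector field with value \<open>X\<close> at the identity,
  whose flow is right multiplication by \<open>mexp (t *\<^sub>R X)\<close>. For \<open>x\<close> in \<open>G\<close> and \<open>X\<close> in its Lie
  algebra, it only depends on the values of \<open>f\<close> on \<open>G\<close>.\<close>

definition left_inv_deriv ::
    "complex^'n^'n \<Rightarrow> (complex^'n^'n \<Rightarrow> complex) \<Rightarrow> complex^'n^'n \<Rightarrow> complex"
  where "left_inv_deriv X f x = vector_derivative (\<lambda>t. f (x ** mexp (t *\<^sub>R X))) (at 0)"

text \<open>A left-invariant metric is given by its inner product \<open>g\<close> on the Lie algebra (it is
  bi-invariant when \<open>g\<close> is moreover invariant under the adjoint action, as for multiples of the
  Killing form); a family of left-invariant vector fields is orthonormal iff it is so at the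
  identity.\<close>

definition orthonormal_basis_of ::
    "('a::real_vector \<Rightarrow> 'a \<Rightarrow> real) \<Rightarrow> 'a set \<Rightarrow> 'a set \<Rightarrow> bool"
  where "orthonormal_basis_of g V B \<longleftrightarrow>
    basis_of V B \<and> (\<forall>X\<in>B. \<forall>Y\<in>B. g X Y = (if X = Y then 1 else 0))"

text \<open>The value does not depend on the chosen orthonormal basis.\<close>

definition laplacian ::
    "(complex^'n^'n) set \<Rightarrow> (complex^'n^'n \<Rightarrow> complex^'n^'n \<Rightarrow> real) \<Rightarrow>
     (complex^'n^'n \<Rightarrow> complex) \<Rightarrow> complex^'n^'n \<Rightarrow> complex"
  where "laplacian G g f x =
    (let B = (SOME B. orthonormal_basis_of g (lie_algebra G) B)
     in - (\<Sum>X\<in>B. left_inv_deriv X (left_inv_deriv X f) x))"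

text \<open>Eigenvalues of the Laplacian on complex-valued smooth functions, a priori complex.\<close>

definition Spec ::
    "(complex^'n^'n) set \<Rightarrow> (complex^'n^'n \<Rightarrow> complex^'n^'n \<Rightarrow> real) \<Rightarrow> complex set"
  where "Spec G g = {\<mu>. \<exists>f. smooth_on G f \<and> (\<exists>x\<in>G. f x \<noteq> 0) \<and>
                           (\<forall>x\<in>G. laplacian G g f x = \<mu> * f x)}"

section \<open>The compact symplectic group\<close>

definition conj_transpose :: "complex^'n^'m \<Rightarrow> complex^'m^'n"
  where "conj_transpose A = (\<chi> i j. cnj (A $ j $ i))"

definition symp_J :: "complex^('l::finite + 'l)^('l + 'l)"
  where "symp_J = (\<chi> i j. case (i, j) of
      (Inl a, Inr b) \<Rightarrow> if a = b then 1 else 0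
    | (Inr a, Inl b) \<Rightarrow> if a = b then -1 else 0
    | _ \<Rightarrow> 0)"

text \<open>With \<open>\<ell> = CARD('l)\<close>, this is \<open>Sp(\<ell>)\<close> as the group of unitary matrices of size \<open>2\<ell>\<close> that
  preserve the standard complex symplectic form.\<close>

definition Sp :: "(complex^('l::finite + 'l)^('l + 'l)) set"
  where "Sp = {A. conj_transpose A ** A = mat 1 \<and> transpose A ** symp_J ** A = symp_J}"

definition lambda_nu :: "nat \<Rightarrow> real \<Rightarrow> (nat \<Rightarrow> nat) \<Rightarrow> real"
  where "lambda_nu l \<gamma> \<nu> =
    1 / (4 * (real l + 1) * \<gamma>) *
      ((\<Sum>k=1..l. (\<Sum>j=k..l. real (\<nu> j))\<^sup>2) - real l * (real l + 1) * (2 * real l + 1) / 6)"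

end

(* Left-invariant derivations act on the polynomials in the matrix entries, and there the Laplacian is,
   up to a constant, the Casimir operator of sp(2l, C), written through symplectic matrix units. The
   Casimir operator is central, and on a vector of weight w killed by the raising operators it is the
   scalar |w + rho|^2 - |rho|^2 (up to a constant). Such a weight is dominant by the usual sl2 argument,
   and climbing up the finitely many weights of bounded degree shows that every polynomial is
   annihilated by a product of factors (Casimir - c) with c such a scalar. Hence Casimir - m is
   surjective on polynomials whenever m is not one of these scalars. Conversely products of powers of
   leading principal minors are highest weight vectors with arbitrary dominant weight.

   No further eigenvalue occurs among smooth functions: if L f = m f with m not of this form, approximate
   the conjugate of f by a polynomial p (Stone-Weierstrass) and write p = (Casimir - m) q. By Green's
   formula f p is a divergence, so its mean over the group vanishes, whereas the mean of |f|^2 is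
   positive unless f = 0. Haar measure is not needed for this: von Neumann's averages of finitely many
   translates, which are nearly constant, replace it. *)

theory Submission
  imports Defs
begin

section \<open>Polynomial functions of matrix entries\<close>

text \<open>Neither Peter-Weyl nor complete reducibility enters: a polynomial only has to be
  annihilated by a product of commuting factors (Casimir - c), and then Casimir - m can be inverted
  on it whenever m is none of the c. Polynomials are functions on all matrices, holomorphic in the
  entries, so that single matrix units, which lie outside the compact Lie algebra, can act. Nothing
  is lost on the group, where the conjugate of x is J x J^{-1}. Constants: the Killing form is
  -(2l+2) times the Euclidean inner product, so the metric is K = gamma (2l+2) times the latter, and
  minus the sum of squares of a g-orthonormal basis is Casimir / (4K) = Casimir / (8(l+1) gamma).
  Summed over all index pairs, the Casimir operator has the eigenvalues 2(|w+rho|^2 - |rho|^2). Here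
  rho has the coordinates 1, ..., l, whence l(l+1)(2l+1)/6; the numbers nu_j - 1 are the exponents
  of the leading minors, and the inner sums of nu are the coordinates of w + rho.\<close>

inductive polyfun :: "(complex^'n^'n \<Rightarrow> complex) \<Rightarrow> bool" where
  polyfun_const: "polyfun (\<lambda>x. c)"
| polyfun_var: "polyfun (\<lambda>x. x $ i $ j)"
| polyfun_add: "polyfun p \<Longrightarrow> polyfun q \<Longrightarrow> polyfun (\<lambda>x. p x + q x)"
| polyfun_mult: "polyfun p \<Longrightarrow> polyfun q \<Longrightarrow> polyfun (\<lambda>x. p x * q x)"

lemma polyfun_uminus: "polyfun p \<Longrightarrow> polyfun (\<lambda>x. - p x)"
  using polyfun_mult[OF polyfun_const[of "-1"]] by fastforce

lemma polyfun_diff: "polyfun p \<Longrightarrow> polyfun q \<Longrightarrow> polyfun (\<lambda>x. p x - q x)"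
  using polyfun_add[of p, OF _ polyfun_uminus] by fastforce

lemma polyfun_sum: "(\<And>i. i \<in> I \<Longrightarrow> polyfun (f i)) \<Longrightarrow> polyfun (\<lambda>x. \<Sum>i\<in>I. f i x)"
proof (induction I rule: infinite_finite_induct)
  case (insert i I)
  then show ?case using polyfun_add[of "f i" "\<lambda>x. \<Sum>i\<in>I. f i x"] by simp
qed (simp_all add: polyfun_const)

lemma polyfun_prod: "(\<And>i. i \<in> I \<Longrightarrow> polyfun (f i)) \<Longrightarrow> polyfun (\<lambda>x. \<Prod>i\<in>I. f i x)"
proof (induction I rule: infinite_finite_induct)
  case (insert i I)
  then show ?case using polyfun_mult[of "f i" "\<lambda>x. \<Prod>i\<in>I. f i x"] by simp
qed (simp_all add: polyfun_const)

lemma has_derivative_entry: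
  "((\<lambda>x::complex^'n^'n. x $ i $ j) has_derivative (\<lambda>v. v $ i $ j)) F"
  by (intro bounded_linear_imp_has_derivative bounded_linear_compose[OF bounded_linear_vec_nth]
      bounded_linear_vec_nth)

text \<open>The second clause allows the direction to vary polynomially with the point. It is what
  lets the invariant vector fields, with direction \<open>x ** X\<close> at \<open>x\<close>,
  preserve polynomials.\<close>

lemma polyfun_has_derivative:
  assumes "polyfun p"
  shows "\<exists>p'. (\<forall>x. (p has_derivative p' x) (at x)) \<and>
    (\<forall>h. (\<forall>i j. polyfun (\<lambda>x. h x $ i $ j)) \<longrightarrow> polyfun (\<lambda>x. p' x (h x)))"
  using assms
proof induction
  case (polyfun_const c)
  show ?case by (rule exI[of _ "\<lambda>x h. 0"]) (simp add: polyfun.polyfun_const)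
next
  case (polyfun_var i j)
  show ?case by (rule exI[of _ "\<lambda>x v. v $ i $ j"]) (simp add: has_derivative_entry)
next
  case (polyfun_add p q)
  then obtain p' q' where "\<forall>x. (p has_derivative p' x) (at x)"
    "\<forall>h. (\<forall>i j. polyfun (\<lambda>x. h x $ i $ j)) \<longrightarrow> polyfun (\<lambda>x. p' x (h x))"
    "\<forall>x. (q has_derivative q' x) (at x)"
    "\<forall>h. (\<forall>i j. polyfun (\<lambda>x. h x $ i $ j)) \<longrightarrow> polyfun (\<lambda>x. q' x (h x))" by blast
  then show ?case
    by (intro exI[of _ "\<lambda>x v. p' x v + q' x v"]) (simp add: has_derivative_add polyfun.polyfun_add)
next
  case (polyfun_mult p q)
  then obtain p' q' where "\<forall>x. (p has_derivative p' x) (at x)"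
    "\<forall>h. (\<forall>i j. polyfun (\<lambda>x. h x $ i $ j)) \<longrightarrow> polyfun (\<lambda>x. p' x (h x))"
    "\<forall>x. (q has_derivative q' x) (at x)"
    "\<forall>h. (\<forall>i j. polyfun (\<lambda>x. h x $ i $ j)) \<longrightarrow> polyfun (\<lambda>x. q' x (h x))" by blast
  then show ?case using polyfun_mult.hyps
    by (intro exI[of _ "\<lambda>x v. p x * q' x v + p' x v * q x"])
      (simp add: has_derivative_mult polyfun.polyfun_add polyfun.polyfun_mult)
qed

lemma polyfun_differentiable: "polyfun p \<Longrightarrow> p differentiable (at x)"
  using polyfun_has_derivative unfolding differentiable_def by blast

lemma polyfun_frechet:
  assumes "polyfun p" "\<And>i j. polyfun (\<lambda>x. h x $ i $ j)"
  shows "polyfun (\<lambda>x. frechet_derivative p (at x) (h x))"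
proof -
  obtain p' where p': "\<forall>x. (p has_derivative p' x) (at x)"
    "\<forall>h. (\<forall>i j. polyfun (\<lambda>x. h x $ i $ j)) \<longrightarrow> polyfun (\<lambda>x. p' x (h x))"
    using polyfun_has_derivative[OF assms(1)] by blast
  then have "frechet_derivative p (at x) = p' x" for x
    by (metis frechet_derivative_at)
  then show ?thesis using p'(2) assms(2) by simp
qed

lemma polyfun_matrix_mult_entry: "polyfun (\<lambda>x. (x ** X) $ i $ j)"
  unfolding matrix_matrix_mult_def
  by (simp, intro polyfun_sum polyfun_mult polyfun_var polyfun_const)

section \<open>The ring of polynomial functions\<close>

typedef ('n::finite) cpol = "{p :: complex^'n^'n \<Rightarrow> complex. polyfun p}"
  morphisms pev Abs_cpol
  by (auto intro: polyfun_const)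

setup_lifting type_definition_cpol

lemma polyfun_pev: "polyfun (pev p)"
  using pev by auto

text \<open>With a ring structure, operator identities become ring rewriting. Equality means
  equality on the whole matrix space, which is stronger than equality on the group.\<close>

instantiation cpol :: (finite) comm_ring_1
begin
lift_definition zero_cpol :: "'a cpol" is "\<lambda>x. 0" by (rule polyfun_const)
lift_definition one_cpol :: "'a cpol" is "\<lambda>x. 1" by (rule polyfun_const)
lift_definition plus_cpol :: "'a cpol \<Rightarrow> 'a cpol \<Rightarrow> 'a cpol" is "\<lambda>p q x. p x + q x"
  by (rule polyfun_add)
lift_definition minus_cpol :: "'a cpol \<Rightarrow> 'a cpol \<Rightarrow> 'a cpol" is "\<lambda>p q x. p x - q x"
  by (rule polyfun_diff)
lift_definition uminus_cpol :: "'a cpol \<Rightarrow> 'a cpol" is "\<lambda>p x. - p x"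
  by (rule polyfun_uminus)
lift_definition times_cpol :: "'a cpol \<Rightarrow> 'a cpol \<Rightarrow> 'a cpol" is "\<lambda>p q x. p x * q x"
  by (rule polyfun_mult)
instance
  by standard (transfer; force simp: fun_eq_iff algebra_simps)+
end

lift_definition Const :: "complex \<Rightarrow> ('n::finite) cpol" is "\<lambda>c x. c" by (rule polyfun_const)
lift_definition Entry :: "'n::finite \<Rightarrow> 'n \<Rightarrow> 'n cpol" is "\<lambda>i j x. x $ i $ j" by (rule polyfun_var)
text \<open>The left-invariant field with value \<open>X\<close> at the identity. It is defined for
  every complex matrix \<open>X\<close>, so the complexified Lie algebra acts as well.\<close>

lift_definition Der :: "complex^'n^'n \<Rightarrow> ('n::finite) cpol \<Rightarrow> 'n cpol"
  is "\<lambda>X p x. frechet_derivative p (at x) (x ** X)"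
  by (intro polyfun_frechet polyfun_matrix_mult_entry)

lemma pev_simps [simp]: "pev 0 x = 0" "pev 1 x = 1" "pev (p + q) x = pev p x + pev q x"
  "pev (p - q) x = pev p x - pev q x" "pev (- p) x = - pev p x"
  "pev (p * q) x = pev p x * pev q x" "pev (Const c) x = c" "pev (Entry i j) x = x $ i $ j"
  by (transfer; simp)+

lemma pev_sum [simp]: "pev (sum f A) x = (\<Sum>i\<in>A. pev (f i) x)"
  by (induction A rule: infinite_finite_induct) auto

lemma pev_prod [simp]: "pev (prod f A) x = (\<Prod>i\<in>A. pev (f i) x)"
  by (induction A rule: infinite_finite_induct) auto

lemma pev_power [simp]: "pev (p ^ n) x = pev p x ^ n"
  by (induction n) auto

lemma pev_eqI: "(\<And>x. pev p x = pev q x) \<Longrightarrow> p = q"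
  by (simp add: pev_inject[symmetric] fun_eq_iff)

lemma Const_simps [simp]: "Const 0 = 0" "Const 1 = 1" "Const (a + b) = Const a + Const b" "Const (a * b) = Const a * Const b"
  "Const (- a) = - Const a" "Const (a - b) = Const a - Const b"
  by (rule pev_eqI; simp)+

lemma Const_sum: "Const (sum f A) = (\<Sum>i\<in>A. Const (f i))"
  by (rule pev_eqI) simp

lemma Const_numeral [simp]: "Const (numeral n) = numeral n"
proof -
  have "Const (of_nat k) = of_nat k" for k by (induction k) auto
  from this[of "numeral n"] show ?thesis by simp
qed

lemma Const_cancel: "a \<noteq> 0 \<Longrightarrow> Const a * p = Const a * q \<longleftrightarrow> p = q"
  by (metis Const_simps(2,4) left_inverse mult.assoc mult_1)

lemma cpol_induct [case_names const var add mult]: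
  assumes "\<And>c. P (Const c)" "\<And>i j. P (Entry i j)" "\<And>p q. P p \<Longrightarrow> P q \<Longrightarrow> P (p + q)"
    "\<And>p q. P p \<Longrightarrow> P q \<Longrightarrow> P (p * q)"
  shows "P p"
proof -
  have "polyfun f \<Longrightarrow> P (Abs_cpol f)" for f
  proof (induction rule: polyfun.induct)
    case (polyfun_const c) then show ?case using assms(1)[of c] by (simp add: Const_def)
  next
    case (polyfun_var i j) then show ?case using assms(2)[of i j] by (simp add: Entry_def)
  next
    case (polyfun_add p q) then show ?case
      using assms(3)[OF polyfun_add.IH] by (simp add: plus_cpol_def Abs_cpol_inverse)
  next
    case (polyfun_mult p q) then show ?case
      using assms(4)[OF polyfun_mult.IH] by (simp add: times_cpol_def Abs_cpol_inverse)
  qed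
  from this[OF polyfun_pev, of p] show ?thesis by (simp add: pev_inverse)
qed

lemma pev_has_derivative:
  "(pev p has_derivative frechet_derivative (pev p) (at x)) (at x)"
  using polyfun_differentiable[OF polyfun_pev] frechet_derivative_works by blast

lemma pev_Der: "pev (Der X p) x = frechet_derivative (pev p) (at x) (x ** X)"
  by transfer simp

lemma pev_DerI: "(pev p has_derivative f') (at x) \<Longrightarrow> pev (Der X p) x = f' (x ** X)"
  using frechet_derivative_at pev_Der by metis

section \<open>Derivations of the polynomial ring\<close>

definition derivation :: "(('n::finite) cpol \<Rightarrow> 'n cpol) \<Rightarrow> bool" where
  "derivation D \<longleftrightarrow> (\<forall>p q. D (p + q) = D p + D q) \<and> (\<forall>p q. D (p * q) = D p * q + p * D q) \<and>
    (\<forall>c. D (Const c) = 0)"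

lemma derivationD:
  assumes "derivation D"
  shows "D (p + q) = D p + D q" "D (p * q) = D p * q + p * D q" "D (Const c) = 0"
    "D 0 = 0" "D 1 = 0" "D (Const c * p) = Const c * D p" "D (- p) = - D p" "D (p - q) = D p - D q"
proof -
  show *: "D (p + q) = D p + D q" "D (p * q) = D p * q + p * D q" "D (Const c) = 0" for p q c
    using assms by (auto simp: derivation_def)
  show "D 0 = 0" "D 1 = 0" using *(3)[of 0] *(3)[of 1] by auto
  show **: "D (Const c * p) = Const c * D p" for c p by (simp add: *)
  show ***: "D (- p) = - D p" for p using **[of "-1" p] by simp
  show "D (p - q) = D p - D q" using *(1)[of p "- q"] *** by simp
qed

lemma derivation_sum_arg: "derivation D \<Longrightarrow> D (sum f A) = (\<Sum>i\<in>A. D (f i))"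
  by (induction A rule: infinite_finite_induct) (auto simp: derivationD)

text \<open>The entries and the constants generate the ring. Expansions and commutators of invariant
  fields are therefore checked on single entries only.\<close>

lemma derivation_eqI:
  assumes "derivation D" "derivation D'" "\<And>i j. D (Entry i j) = D' (Entry i j)"
  shows "D = D'"
proof
  fix p show "D p = D' p"
    by (induction p rule: cpol_induct) (use assms in \<open>auto simp: derivation_def\<close>)
qed

lemma derivation_Der: "derivation (Der X)"
  unfolding derivation_def
proof (intro conjI allI; rule pev_eqI)
  fix p q :: "'a cpol" and x c
  have *: "pev (p + q) = (\<lambda>x. pev p x + pev q x)" "pev (p * q) = (\<lambda>x. pev p x * pev q x)"
    "pev (Const c :: 'a cpol) = (\<lambda>x. c)" by auto
  show "pev (Der X (p + q)) x = pev (Der X p + Der X q) x"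
    using pev_DerI[OF has_derivative_add[OF pev_has_derivative[of p x] pev_has_derivative[of q x], folded *]]
    by (simp add: pev_Der)
  show "pev (Der X (p * q)) x = pev (Der X p * q + p * Der X q) x"
    using pev_DerI[OF has_derivative_mult[OF pev_has_derivative[of p x] pev_has_derivative[of q x], folded *]]
    by (simp add: pev_Der)
  show "pev (Der X (Const c)) x = pev 0 x"
    using pev_DerI[OF has_derivative_const[of c "at x", folded *]] by simp
qed

lemma Der_Entry: "Der X (Entry i j) = (\<Sum>k\<in>UNIV. Const (X $ k $ j) * Entry i k)"
proof (rule pev_eqI)
  fix x
  have "pev (Entry i j) = (\<lambda>x. x $ i $ j)" by auto
  then show "pev (Der X (Entry i j)) x = pev (\<Sum>k\<in>UNIV. Const (X $ k $ j) * Entry i k) x"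
    by (subst pev_DerI[where x = x and f' = "\<lambda>v. v $ i $ j"])
      (auto simp: has_derivative_entry matrix_matrix_mult_def mult.commute)
qed

lemma derivation_commutator:
  assumes "derivation D" "derivation E"
  shows "derivation (\<lambda>p. D (E p) - E (D p))"
  unfolding derivation_def by (auto simp: derivationD[OF assms(1)] derivationD[OF assms(2)] algebra_simps)

lemma derivation_scale: "derivation D \<Longrightarrow> derivation (\<lambda>p. Const c * D p)"
  unfolding derivation_def by (auto simp: algebra_simps)

lemma derivation_add: "derivation D \<Longrightarrow> derivation E \<Longrightarrow> derivation (\<lambda>p. D p + E p)"
  unfolding derivation_def by (auto simp: algebra_simps)

lemma derivation_zero: "derivation (\<lambda>p. 0)"
  unfolding derivation_def by auto

lemma derivation_sum: "(\<And>i. i \<in> I \<Longrightarrow> derivation (D i)) \<Longrightarrow> derivation (\<lambda>p. \<Sum>i\<in>I. D i p)"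
proof (induction I rule: infinite_finite_induct)
  case (insert i I)
  then show ?case using derivation_add[of "D i" "\<lambda>p. \<Sum>i\<in>I. D i p"] by simp
qed (simp_all add: derivation_zero)

definition munit :: "'n \<Rightarrow> 'n \<Rightarrow> complex^('n::finite)^'n" where
  "munit a b = (\<chi> i j. if i = a \<and> j = b then 1 else 0)"

lemma Der_munit_Entry: "Der (munit a b) (Entry i j) = (if j = b then Entry i a else 0)"
  unfolding Der_Entry munit_def by (auto simp: if_distrib[of Const] if_distrib[of "\<lambda>x. x * _"] sum.delta cong: if_cong)

text \<open>Both sides are derivations that agree on entries. This yields complex linearity in
  \<open>X\<close>, although the derivative behind \<open>Der\<close> is a priori only real
  linear.\<close>

lemma Der_expand: "Der X p = (\<Sum>a\<in>UNIV. \<Sum>b\<in>UNIV. Const (X $ a $ b) * Der (munit a b) p)"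
proof -
  have "Der X = (\<lambda>p. \<Sum>a\<in>UNIV. \<Sum>b\<in>UNIV. Const (X $ a $ b) * Der (munit a b) p)"
  proof (rule derivation_eqI)
    show "derivation (\<lambda>p. \<Sum>a\<in>UNIV. \<Sum>b\<in>UNIV. Const (X $ a $ b) * Der (munit a b) p)"
      by (intro derivation_sum derivation_scale derivation_Der)
    show "Der X (Entry i j) = (\<Sum>a\<in>UNIV. \<Sum>b\<in>UNIV. Const (X $ a $ b) * Der (munit a b) (Entry i j))" for i j
      unfolding Der_munit_Entry by (simp add: Der_Entry if_distrib[of "\<lambda>x. _ * x"] sum.delta cong: if_cong)
  qed (rule derivation_Der)
  then show ?thesis by metis
qed

section \<open>The symplectic Casimir operator\<close>

definition clinear :: "(('n::finite) cpol \<Rightarrow> 'n cpol) \<Rightarrow> bool" where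
  "clinear T \<longleftrightarrow> (\<forall>p q. T (p + q) = T p + T q) \<and> (\<forall>c p. T (Const c * p) = Const c * T p)"

lemma clinearD:
  assumes "clinear T"
  shows "T (p + q) = T p + T q" "T (Const c * p) = Const c * T p" "T 0 = 0" "T (- p) = - T p" "T (p - q) = T p - T q"
proof -
  show *: "T (p + q) = T p + T q" "T (Const c * p) = Const c * T p" for p q c
    using assms by (auto simp: clinear_def)
  show "T 0 = 0" using *(2)[of 0] by simp
  show **: "T (- p) = - T p" for p using *(2)[of "-1" p] by simp
  show "T (p - q) = T p - T q" using *(1)[of p "- q"] ** by simp
qed

lemma clinear_derivation: "derivation D \<Longrightarrow> clinear D"
  by (simp add: clinear_def derivationD)

lemma clinear_comp: "clinear S \<Longrightarrow> clinear T \<Longrightarrow> clinear (\<lambda>p. S (T p))"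
  by (simp add: clinear_def)

lemma clinear_sum: "(\<And>i. i \<in> I \<Longrightarrow> clinear (T i)) \<Longrightarrow> clinear (\<lambda>p. \<Sum>i\<in>I. T i p)"
  by (simp add: clinear_def sum.distrib sum_distrib_left)

text \<open>The polynomial in \<open>T\<close> with root list \<open>ss\<close>, applied to
  \<open>p\<close>.\<close>

definition shifts :: "(('n::finite) cpol \<Rightarrow> 'n cpol) \<Rightarrow> complex list \<Rightarrow> 'n cpol \<Rightarrow> 'n cpol" where
  "shifts T ss p = foldr (\<lambda>s u. T u - Const s * u) ss p"

lemma shifts_simps [simp]: "shifts T [] p = p" "shifts T (s # ss) p = T (shifts T ss p) - Const s * shifts T ss p"
  "shifts T (xs @ ys) p = shifts T xs (shifts T ys p)"
  by (simp_all add: shifts_def)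

lemma clinear_shifts: "clinear T \<Longrightarrow> clinear (shifts T ss)"
  by (induction ss) (simp_all add: clinear_def distrib_left right_diff_distrib mult.left_commute)

lemma shifts_commute:
  assumes "clinear S" "\<And>p. S (T p) = T (S p)"
  shows "S (shifts T ss p) = shifts T ss (S p)"
  by (induction ss) (auto simp: clinearD[OF assms(1)] assms(2))

lemma shifts_swap: "clinear T \<Longrightarrow> shifts T xs (shifts T ys p) = shifts T ys (shifts T xs p)"
  by (rule shifts_commute[OF clinear_shifts], simp, rule shifts_commute[symmetric]) auto

lemma shifts_eigen:
  assumes "clinear T" "T p = Const z * p"
  shows "shifts T ss p = Const (\<Prod>s\<leftarrow>ss. z - s) * p"
  by (induction ss) (simp_all add: clinearD[OF assms(1)] assms(2) left_diff_distrib mult.left_commute mult.assoc)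

text \<open>Induction on the number of factors: (T - s) p needs one factor less, so (T - \<mu>) q =
  (T - s) p for some \<open>q\<close>. Then (T - \<mu>)(q - p) = (\<mu> - s) p, and \<mu> - s can be
  divided out.\<close>

lemma shifts_surj:
  assumes T: "clinear T" and "\<mu> \<notin> set ss" "shifts T ss p = 0"
  shows "\<exists>q. T q - Const \<mu> * q = p"
  using assms(2,3)
proof (induction ss arbitrary: p rule: rev_induct)
  case Nil
  then show ?case by (intro exI[of _ 0]) (simp add: clinearD[OF T])
next
  case (snoc s ss)
  then obtain q where q: "T q - Const \<mu> * q = T p - Const s * p" by auto
  let ?k = "1 / (\<mu> - s)"
  have "T (Const ?k * (q - p)) - Const \<mu> * (Const ?k * (q - p)) = Const ?k * ((T q - Const \<mu> * q) - (T p - Const \<mu> * p))"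
    unfolding clinearD[OF T] by (simp only: right_diff_distrib mult.left_commute) simp
  also have "\<dots> = Const ?k * (Const (\<mu> - s) * p)" unfolding q by (simp add: left_diff_distrib)
  also have "\<dots> = Const (?k * (\<mu> - s)) * p" by (simp only: Const_simps mult.assoc)
  also have "\<dots> = p" using snoc.prems by simp
  finally show ?case by blast
qed

text \<open>Concatenating the lists works because polynomials in the same operator commute.\<close>

lemma shifts_common:
  assumes T: "clinear T" and "finite I" "\<And>i. i \<in> I \<Longrightarrow> \<exists>ss. set ss \<subseteq> R \<and> shifts T ss (p i) = 0"
  shows "\<exists>ss. set ss \<subseteq> R \<and> (\<forall>i\<in>I. shifts T ss (p i) = 0)"
  using assms(2,3)
proof (induction I)
  case empty
  then show ?case by (intro exI[of _ "[]"]) auto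
next
  case (insert i I)
  then obtain ss ts where "set ss \<subseteq> R" "\<forall>i\<in>I. shifts T ss (p i) = 0" "set ts \<subseteq> R" "shifts T ts (p i) = 0"
    by fastforce
  moreover from this have "\<forall>j\<in>I. shifts T ts (shifts T ss (p j)) = 0" "shifts T ts (shifts T ss (p i)) = 0"
    using shifts_swap[OF T, of ts ss "p i"] by (auto simp: clinearD[OF clinear_shifts[OF T]])
  ultimately show ?case
    by (intro exI[of _ "ts @ ss"]) auto
qed

section \<open>The degree filtration\<close>

definition monomial :: "('n \<times> 'n) list \<Rightarrow> ('n::finite) cpol" where
  "monomial L = prod_list (map (\<lambda>(i, j). Entry i j) L)"

lemma monomial_simps [simp]: "monomial [] = 1" "monomial ((i, j) # L) = Entry i j * monomial L" "monomial (L @ M) = monomial L * monomial M"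
  by (simp_all add: monomial_def)

text \<open>The span of the monomials with at most \<open>d\<close> factors. It serves as a large
  invariant space on which weights are bounded, so no representation has to be decomposed.\<close>

inductive deg_le :: "nat \<Rightarrow> ('n::finite) cpol \<Rightarrow> bool" for d where
  deg_le_zero: "deg_le d 0"
| deg_le_monomial: "length L \<le> d \<Longrightarrow> deg_le d (monomial L)"
| deg_le_add: "deg_le d p \<Longrightarrow> deg_le d q \<Longrightarrow> deg_le d (p + q)"
| deg_le_scale: "deg_le d p \<Longrightarrow> deg_le d (Const c * p)"

lemma deg_le_sum: "(\<And>i. i \<in> I \<Longrightarrow> deg_le d (f i)) \<Longrightarrow> deg_le d (sum f I)"
  by (induction I rule: infinite_finite_induct) (auto intro: deg_le.intros)

lemma deg_le_diff: "deg_le d p \<Longrightarrow> deg_le d q \<Longrightarrow> deg_le d (p - q)"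
  using deg_le_add[OF _ deg_le_scale[of d q "-1"], of p] by simp

lemma deg_le_mono: "deg_le d p \<Longrightarrow> d \<le> e \<Longrightarrow> deg_le e p"
  by (induction rule: deg_le.induct) (auto intro: deg_le.intros)

lemma deg_le_mult_monomial: "deg_le d p \<Longrightarrow> deg_le (d + length L) (monomial L * p)"
proof (induction rule: deg_le.induct)
  case (deg_le_monomial M)
  then show ?case using deg_le.deg_le_monomial[of "L @ M" "d + length L"] by simp
next
  case (deg_le_scale p c)
  then show ?case using deg_le.deg_le_scale by (metis mult.left_commute)
qed (auto intro: deg_le.intros simp: distrib_left)

lemma deg_le_mult: "deg_le d p \<Longrightarrow> deg_le e q \<Longrightarrow> deg_le (d + e) (p * q)"
proof (induction rule: deg_le.induct)
  case (deg_le_monomial L)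
  show ?case by (rule deg_le_mono[OF deg_le_mult_monomial[OF deg_le_monomial(2)]]) (use deg_le_monomial in auto)
next
  case (deg_le_scale p c)
  then show ?case using deg_le.deg_le_scale by (metis mult.assoc)
qed (auto intro: deg_le.intros simp: distrib_right)

lemma deg_le_Entry: "deg_le (Suc 0) (Entry i j)"
  using deg_le_monomial[of "[(i, j)]" "Suc 0"] by simp

lemma deg_le_exists: "\<exists>d. deg_le d p"
proof (induction p rule: cpol_induct)
  case (const c)
  show ?case using deg_le_scale[OF deg_le_monomial[of "[]" 0], of c] by auto
next
  case (add p q)
  then obtain d e where "deg_le d p" "deg_le e q" by blast
  then have "deg_le (max d e) (p + q)" by (auto intro!: deg_le_add intro: deg_le_mono)
  then show ?case ..
qed (use deg_le_Entry deg_le_mult in blast)+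

text \<open>An invariant field sends an entry to a linear combination of entries, so by the product
  rule it replaces one factor at a time.\<close>

lemma deg_le_Der_monomial: "deg_le (length L) (Der X (monomial L))"
proof (induction L)
  case Nil
  then show ?case by (simp add: derivationD[OF derivation_Der] deg_le_zero)
next
  case (Cons ij L)
  obtain i j where ij: "ij = (i, j)" by force
  have "deg_le (Suc 0) (Der X (Entry i j))"
    unfolding Der_Entry by (intro deg_le_sum deg_le_scale deg_le_Entry)
  moreover have "deg_le (length L) (monomial L)" by (simp add: deg_le_monomial)
  ultimately have "deg_le (Suc (length L)) (Der X (Entry i j) * monomial L + Entry i j * Der X (monomial L))"
    using deg_le_mult[of "Suc 0" _ "length L"] Cons deg_le_Entry by (intro deg_le_add) fastforce+
  then show ?case by (simp add: derivationD[OF derivation_Der] ij)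
qed

lemma deg_le_Der: "deg_le d p \<Longrightarrow> deg_le d (Der X p)"
  by (induction rule: deg_le.induct)
    (auto simp: derivationD[OF derivation_Der] intro: deg_le.intros deg_le_mono[OF deg_le_Der_monomial])

section \<open>Symplectic matrix units and the Casimir operator\<close>

fun bar :: "'l + 'l \<Rightarrow> 'l + 'l" where
  "bar (Inl i) = Inr i"
| "bar (Inr i) = Inl i"

text \<open>\<open>symp_J\<close> has the entry \<open>sg p\<close> at position
  \<open>(p, bar p)\<close> and zeros elsewhere.\<close>

fun sg :: "'l + 'l \<Rightarrow> complex" where
  "sg (Inl i) = 1"
| "sg (Inr i) = - 1"

lemma bar_bar [simp]: "bar (bar a) = a"
  by (cases a) auto

lemma bar_neq [simp]: "bar a \<noteq> a" "a \<noteq> bar a"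
  by (cases a; simp)+

lemma bar_eq_iff [simp]: "bar a = bar b \<longleftrightarrow> a = b"
  by (metis bar_bar)

lemma bij_bar: "bij bar"
  by (rule bij_betw_byWitness[of _ bar]) auto

lemma sg_simps [simp]: "sg (bar a) = - sg a" "sg a * sg a = 1" "sg a * (sg a * z) = z"
  by (cases a; simp)+

text \<open>Twice the projection of a matrix unit to sp(2l, C). Each element recurs up to sign as
  \<open>sp_der (bar b) (bar a)\<close>, and for the long roots, \<open>b = bar a\<close>, it is
  twice a matrix unit. These multiplicities explain the factors 2 below.\<close>

definition sp_der :: "'l + 'l \<Rightarrow> 'l + 'l \<Rightarrow> ('l::finite + 'l) cpol \<Rightarrow> ('l + 'l) cpol" where
  "sp_der a b p = Der (munit a b) p - Const (sg a * sg b) * Der (munit (bar b) (bar a)) p"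

lemma derivation_sp_der: "derivation (sp_der a b)"
proof -
  have "derivation (\<lambda>p. Der (munit a b) p + Const (- (sg a * sg b)) * Der (munit (bar b) (bar a)) p)"
    by (intro derivation_add derivation_scale derivation_Der)
  also have "(\<lambda>p. Der (munit a b) p + Const (- (sg a * sg b)) * Der (munit (bar b) (bar a)) p) = sp_der a b"
    by (auto simp: sp_der_def)
  finally show ?thesis .
qed

lemmas sp_der_simps = derivationD[OF derivation_sp_der]
lemmas clinear_sp_der = clinear_derivation[OF derivation_sp_der]

lemma sp_der_Entry: "sp_der a b (Entry i j) = (if j = b then Entry i a else 0) - (if j = bar a then Const (sg a * sg b) * Entry i (bar b) else 0)"
  by (simp add: sp_der_def Der_munit_Entry)

lemma deg_le_sp_der: "deg_le d p \<Longrightarrow> deg_le d (sp_der a b p)"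
  unfolding sp_der_def by (intro deg_le_diff deg_le_scale deg_le_Der)

lemma derivation_if: "derivation D \<Longrightarrow> derivation (\<lambda>p. if P then D p else 0)"
  by (cases P) (auto simp: derivation_zero)

lemma derivation_diff: "derivation D \<Longrightarrow> derivation E \<Longrightarrow> derivation (\<lambda>p. D p - E p)"
  using derivation_add[OF _ derivation_scale[of E "-1"], of D] by simp

lemma sg_Const [simp]: "Const (sg a) * Const (sg a) = 1" "Const (sg a) * (Const (sg a) * p) = p"
  by (simp_all flip: Const_simps(4) mult.assoc)

lemma munit_commutator:
  "Der (munit a b) (Der (munit c d) p) - Der (munit c d) (Der (munit a b) p) =
    (if b = c then Der (munit a d) p else 0) - (if d = a then Der (munit c b) p else 0)"
proof -
  have "(\<lambda>p. Der (munit a b) (Der (munit c d) p) - Der (munit c d) (Der (munit a b) p)) =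
    (\<lambda>p. (if b = c then Der (munit a d) p else 0) - (if d = a then Der (munit c b) p else 0))"
    (is "?l = ?r")
  proof (rule derivation_eqI)
    show "derivation ?l" by (intro derivation_commutator derivation_Der)
    show "derivation ?r" by (intro derivation_diff derivation_if derivation_Der)
    show "?l (Entry i j) = ?r (Entry i j)" for i j
      by (cases "j = d"; cases "j = b") (auto simp: Der_munit_Entry derivationD[OF derivation_Der])
  qed
  from fun_cong[OF this, of p] show ?thesis .
qed

text \<open>Expansion gives four gl commutators, hence eight terms. Each index equality that keeps a
  term alive also collapses the product of signs, so the terms join in pairs to single
  \<open>sp_der\<close>.\<close>

lemma sp_der_commutator:
  "sp_der a b (sp_der c d p) - sp_der c d (sp_der a b p) =
    (if b = c then sp_der a d p else 0) - (if d = a then sp_der c b p else 0) -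
    Const (sg a * sg b) * ((if c = bar a then sp_der (bar b) d p else 0) - (if d = bar b then sp_der c (bar a) p else 0))"
proof -
  define s t where "s = sg a * sg b" and "t = sg c * sg d"
  let ?e = "\<lambda>a b. Der (munit a b)"
  let ?k = "\<lambda>a b c d. ?e a b (?e c d p) - ?e c d (?e a b p)"
  have sp_der: "sp_der a b q = ?e a b q - Const s * ?e (bar b) (bar a) q" "sp_der c d q = ?e c d q - Const t * ?e (bar d) (bar c) q" for q
    by (simp_all add: sp_der_def s_def t_def)
  have eq0: "sp_der a b (sp_der c d p) - sp_der c d (sp_der a b p) =
     ?k a b c d - Const t * ?k a b (bar d) (bar c) - Const s * ?k (bar b) (bar a) c d
      + Const (s * t) * ?k (bar b) (bar a) (bar d) (bar c)"
    unfolding sp_der derivationD[OF derivation_Der] right_diff_distrib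
    by (simp add: algebra_simps)
  have eq: "sp_der a b (sp_der c d p) - sp_der c d (sp_der a b p) =
    ((if b = c then ?e a d p else 0) - Const (s * t) * (if bar c = bar b then ?e (bar d) (bar a) p else 0))
    - ((if d = a then ?e c b p else 0) - Const (s * t) * (if bar a = bar d then ?e (bar b) (bar c) p else 0))
    - (Const s * (if bar a = c then ?e (bar b) d p else 0) - Const t * (if bar c = a then ?e (bar d) b p else 0))
    + (Const s * (if d = bar b then ?e c (bar a) p else 0) - Const t * (if b = bar d then ?e a (bar c) p else 0))"
  proof -
    have alg: "x1 - x2 - Const t * (y1 - y2) - Const s * (z1 - z2) + Const (s * t) * (w1 - w2) =
      (x1 - Const (s * t) * w2) - (x2 - Const (s * t) * w1) - (Const s * z1 - Const t * y2) + (Const s * z2 - Const t * y1)"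
      for x1 x2 y1 y2 z1 z2 w1 w2 :: "('a + 'a) cpol"
      by (simp add: algebra_simps)
    show ?thesis unfolding eq0 munit_commutator by (rule alg)
  qed
  have e1: "(if b = c then ?e a d p else 0) - Const (s * t) * (if bar c = bar b then ?e (bar d) (bar a) p else 0)
      = (if b = c then sp_der a d p else 0)"
  proof (cases "b = c")
    case True
    have "s * t = sg a * sg d" unfolding s_def t_def True by (cases c) auto
    with True show ?thesis unfolding sp_der_def by (simp only: if_True refl)
  qed auto
  have e2: "(if d = a then ?e c b p else 0) - Const (s * t) * (if bar a = bar d then ?e (bar b) (bar c) p else 0)
      = (if d = a then sp_der c b p else 0)"
  proof (cases "d = a")
    case True
    have "s * t = sg c * sg b" unfolding s_def t_def True by (cases a) auto
    with True show ?thesis unfolding sp_der_def by (simp only: if_True refl)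
  qed auto
  have e3: "Const s * (if bar a = c then ?e (bar b) d p else 0) - Const t * (if bar c = a then ?e (bar d) b p else 0)
      = Const s * (if c = bar a then sp_der (bar b) d p else 0)"
  proof (cases "c = bar a")
    case True
    have "t = s * (sg (bar b) * sg d)" unfolding s_def t_def True by (cases b) auto
    then have "(Const t :: ('a + 'a) cpol) = Const s * Const (sg (bar b) * sg d)" by (simp only: Const_simps)
    then show ?thesis unfolding sp_der_def True by (simp only: if_True refl bar_bar right_diff_distrib mult.assoc)
  qed auto
  have e4: "Const s * (if d = bar b then ?e c (bar a) p else 0) - Const t * (if b = bar d then ?e a (bar c) p else 0)
      = Const s * (if d = bar b then sp_der c (bar a) p else 0)"
  proof (cases "d = bar b")
    case True
    have "t = s * (sg c * sg (bar a))" unfolding s_def t_def True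
      by (simp add: mult.assoc mult.left_commute[of _ "sg c"])
    then have "(Const t :: ('a + 'a) cpol) = Const s * Const (sg c * sg (bar a))" by (simp only: Const_simps)
    then show ?thesis unfolding sp_der_def True by (simp only: if_True refl bar_bar right_diff_distrib mult.assoc)
  qed auto
  have e5: "x - y - Const s * u + Const s * v = x - y - Const s * (u - v)" for x y u v :: "('a + 'a) cpol"
    by (simp add: right_diff_distrib)
  have "sp_der a b (sp_der c d p) - sp_der c d (sp_der a b p) = (if b = c then sp_der a d p else 0) - (if d = a then sp_der c b p else 0) -
    Const s * (if c = bar a then sp_der (bar b) d p else 0) + Const s * (if d = bar b then sp_der c (bar a) p else 0)"
    by (rule trans[OF eq]) (simp only: e1 e2 e3 e4)
  then show ?thesis by (simp only: e5 flip: s_def)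
qed

text \<open>The sum runs over all index pairs instead of a basis, with \<open>sp_der b a\<close> in
  the role of the dual of \<open>sp_der a b\<close>; the redundancy keeps the index calculus
  uniform.\<close>

definition casimir :: "('l::finite + 'l) cpol \<Rightarrow> ('l + 'l) cpol" where
  "casimir p = (\<Sum>a\<in>UNIV. \<Sum>b\<in>UNIV. sp_der a b (sp_der b a p))"

lemma clinear_casimir: "clinear casimir"
  unfolding casimir_def by (intro clinear_sum) (rule clinear_comp[OF clinear_sp_der clinear_sp_der])

lemma sum_sum_delta:
  fixes f :: "'a::finite \<Rightarrow> 'b::finite \<Rightarrow> 'c::comm_monoid_add"
  shows "(\<Sum>a\<in>UNIV. \<Sum>b\<in>UNIV. if d = a then f a b else 0) = (\<Sum>b\<in>UNIV. f d b)"
    "(\<Sum>a\<in>UNIV. \<Sum>b\<in>UNIV. if a = d then f a b else 0) = (\<Sum>b\<in>UNIV. f d b)"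
    "(\<Sum>a\<in>UNIV. \<Sum>b\<in>UNIV. if c = b then f a b else 0) = (\<Sum>a\<in>UNIV. f a c)"
    "(\<Sum>a\<in>UNIV. \<Sum>b\<in>UNIV. if b = c then f a b else 0) = (\<Sum>a\<in>UNIV. f a c)"
proof -
  have "(\<Sum>a\<in>UNIV. \<Sum>b\<in>UNIV. if d = a then f a b else 0) = (\<Sum>a\<in>UNIV. if d = a then \<Sum>b\<in>UNIV. f a b else 0)"
    by (intro sum.cong refl) auto
  then show "(\<Sum>a\<in>UNIV. \<Sum>b\<in>UNIV. if d = a then f a b else 0) = (\<Sum>b\<in>UNIV. f d b)"
    by simp
  then show "(\<Sum>a\<in>UNIV. \<Sum>b\<in>UNIV. if a = d then f a b else 0) = (\<Sum>b\<in>UNIV. f d b)"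
    by (simp add: eq_commute[of _ d])
qed simp_all

text \<open>Commuting \<open>sp_der c d\<close> past both factors leaves eight families of terms,
  each with one fixed index. After summation over the other index they cancel in pairs.\<close>

lemma casimir_commute: "sp_der c d (casimir p) = casimir (sp_der c d p)"
proof -
  define s where "s = sg c * sg d"
  have comm: "sp_der c d (sp_der a b q) = sp_der a b (sp_der c d q) + ((if d = a then sp_der c b q else 0) - (if b = c then sp_der a d q else 0) -
    Const s * ((if a = bar c then sp_der (bar d) b q else 0) - (if b = bar d then sp_der a (bar c) q else 0)))" for a b q
    using sp_der_commutator[of c d a b q] by (simp add: s_def algebra_simps)
  have sp_der_if: "sp_der a b (if P then q else 0) = (if P then sp_der a b q else 0)" for a b P q
    by (simp add: sp_der_simps)
  let ?S = "\<lambda>f. \<Sum>a\<in>UNIV. \<Sum>b\<in>UNIV. f a b"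
  have "sp_der c d (sp_der a b (sp_der b a p)) = sp_der a b (sp_der b a (sp_der c d p)) +
     ((if d = a then sp_der c b (sp_der b a p) else 0) - (if b = c then sp_der a d (sp_der b a p) else 0) -
       (Const s * (if a = bar c then sp_der (bar d) b (sp_der b a p) else 0) - Const s * (if b = bar d then sp_der a (bar c) (sp_der b a p) else 0)))
     + ((if d = b then sp_der a b (sp_der c a p) else 0) - (if a = c then sp_der a b (sp_der b d p) else 0) -
    (Const s * (if b = bar c then sp_der a b (sp_der (bar d) a p) else 0) - Const s * (if a = bar d then sp_der a b (sp_der b (bar c) p) else 0)))"
    for a b
  proof -
    have "sp_der a b (sp_der c d (sp_der b a p)) = sp_der a b (sp_der b a (sp_der c d p)) +
      ((if d = b then sp_der a b (sp_der c a p) else 0) - (if a = c then sp_der a b (sp_der b d p) else 0) -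
      (Const s * (if b = bar c then sp_der a b (sp_der (bar d) a p) else 0) - Const s * (if a = bar d then sp_der a b (sp_der b (bar c) p) else 0)))"
      unfolding comm[of b a p] by (simp only: sp_der_simps(1,6,8) right_diff_distrib sp_der_if)
    then show ?thesis unfolding comm[of a b "sp_der b a p"] right_diff_distrib by (simp only: ac_simps)
  qed
  then have "sp_der c d (casimir p) = ?S (\<lambda>a b. sp_der a b (sp_der b a (sp_der c d p)) +
     ((if d = a then sp_der c b (sp_der b a p) else 0) - (if b = c then sp_der a d (sp_der b a p) else 0) -
       (Const s * (if a = bar c then sp_der (bar d) b (sp_der b a p) else 0) - Const s * (if b = bar d then sp_der a (bar c) (sp_der b a p) else 0)))
     + ((if d = b then sp_der a b (sp_der c a p) else 0) - (if a = c then sp_der a b (sp_der b d p) else 0) -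
    (Const s * (if b = bar c then sp_der a b (sp_der (bar d) a p) else 0) - Const s * (if a = bar d then sp_der a b (sp_der b (bar c) p) else 0))))"
    unfolding casimir_def derivation_sum_arg[OF derivation_sp_der] by presburger
  also have "\<dots> = casimir (sp_der c d p)"
    unfolding casimir_def sum.distrib sum_subtractf sum_distrib_left[symmetric] sum_sum_delta
    by (simp add: sp_der_simps)
  finally show ?thesis .
qed

lemma deg_le_casimir: "deg_le d p \<Longrightarrow> deg_le d (casimir p)"
  unfolding casimir_def by (intro deg_le_sum deg_le_sp_der)

lemma deg_le_shifts_casimir: "deg_le d p \<Longrightarrow> deg_le d (shifts casimir ss p)"
  by (induction ss) (auto intro: deg_le_diff deg_le_casimir deg_le_scale)

section \<open>Weights\<close>

lemma Const_of_bool [simp]: "Const (of_bool P) = of_bool P"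
  by (cases P) auto

text \<open>Weights are integer functions on all 2l indices rather than l coordinates, so that short
  and long roots obey the same formulas. The zero polynomial has every weight; the antisymmetry
  under \<open>bar\<close> holds only for nonzero ones.\<close>

definition weight :: "('l + 'l \<Rightarrow> int) \<Rightarrow> ('l::finite + 'l) cpol \<Rightarrow> bool" where
  "weight \<omega> p \<longleftrightarrow> (\<forall>a. sp_der a a p = Const (of_int (\<omega> a)) * p)"

lemma weight_sp_der:
  assumes "weight \<omega> p"
  shows "weight (\<lambda>c. \<omega> c + (of_bool (c = a) - of_bool (c = b) - of_bool (c = bar a) + of_bool (c = bar b))) (sp_der a b p)"
  unfolding weight_def
proof
  fix c
  have [simp]: "a = bar c \<longleftrightarrow> c = bar a" "b = bar c \<longleftrightarrow> c = bar b" by auto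
  have "sp_der c c (sp_der a b p) = sp_der a b (sp_der c c p) + (of_bool (c = a) * sp_der a b p - of_bool (c = b) * sp_der a b p -
      (of_bool (c = bar a) * sp_der a b p - of_bool (c = bar b) * sp_der a b p))"
    using sp_der_commutator[of c c a b p] by (auto simp: algebra_simps)
  moreover have "sp_der a b (sp_der c c p) = Const (of_int (\<omega> c)) * sp_der a b p"
    using assms by (simp add: weight_def sp_der_simps)
  ultimately show "sp_der c c (sp_der a b p) = Const (of_int (\<omega> c + (of_bool (c = a) - of_bool (c = b) - of_bool (c = bar a) + of_bool (c = bar b)))) * sp_der a b p"
    by (simp add: algebra_simps)
qed

lemma weight_shifts_casimir: "weight \<omega> p \<Longrightarrow> weight \<omega> (shifts casimir ss p)"
  unfolding weight_def
proof
  fix a assume *: "\<forall>a. sp_der a a p = Const (of_int (\<omega> a)) * p"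
  have "sp_der a a (shifts casimir ss p) = shifts casimir ss (sp_der a a p)"
    by (rule shifts_commute[OF clinear_sp_der]) (rule casimir_commute)
  then show "sp_der a a (shifts casimir ss p) = Const (of_int (\<omega> a)) * shifts casimir ss p"
    using * by (simp add: clinearD[OF clinear_shifts[OF clinear_casimir]])
qed

lemma weight_bar:
  assumes "weight \<omega> p" "p \<noteq> 0"
  shows "\<omega> (bar a) = - \<omega> a"
proof -
  have "sp_der (bar a) (bar a) p = - sp_der a a p" by (simp add: sp_der_def)
  then have "Const (of_int (\<omega> (bar a))) * p = Const (of_int (- \<omega> a)) * p" using assms(1) by (simp add: weight_def)
  then have "Const (of_int (\<omega> (bar a)) - of_int (- \<omega> a)) * p = 0" by (simp add: distrib_right)
  then have "of_int (\<omega> (bar a)) - of_int (- \<omega> a) = (0::complex)"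
    using Const_cancel[of _ p 0] assms(2) by fastforce
  then show ?thesis by (simp only: eq_iff_diff_eq_0[symmetric] of_int_eq_iff)
qed

text \<open>An entry is a weight vector whose weight depends on its column only, since invariant
  fields act by right multiplication; weights add under products.\<close>

lemma weight_monomial: "\<exists>\<omega>. weight \<omega> (monomial L) \<and> (\<forall>a. \<bar>\<omega> a\<bar> \<le> int (length L))"
proof (induction L)
  case Nil
  show ?case by (rule exI[of _ "\<lambda>_. 0"]) (simp add: weight_def sp_der_simps)
next
  case (Cons ij L)
  obtain i j where ij: "ij = (i, j)" by force
  obtain \<omega> where \<omega>: "weight \<omega> (monomial L)" "\<forall>a. \<bar>\<omega> a\<bar> \<le> int (length L)" using Cons by blast
  let ?\<omega> = "\<lambda>a. \<omega> a + (of_bool (j = a) - of_bool (j = bar a))"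
  have "sp_der a a (Entry i j) = (of_bool (j = a) - of_bool (j = bar a)) * Entry i j" for a
    by (auto simp: sp_der_Entry)
  note eig = this \<omega>(1)[unfolded weight_def, rule_format]
  then have "weight ?\<omega> (monomial (ij # L))"
    by (simp add: weight_def sp_der_simps ij eig algebra_simps)
  moreover have "\<bar>?\<omega> a\<bar> \<le> int (length (ij # L))" for a
    using \<omega>(2)[rule_format, of a] by (auto simp: of_bool_def)
  ultimately show ?case by blast
qed

text \<open>True for each monomial because its weight is one of the listed integers, and preserved
  by linear combinations. It bounds the weight of any weight vector without splitting it into weight
  components.\<close>

lemma deg_le_weight_annihilated: "deg_le d p \<Longrightarrow> shifts (sp_der a a) (map of_int [- int d..int d]) p = 0"
proof (induction rule: deg_le.induct)
  case (deg_le_monomial L)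
  obtain \<omega> where \<omega>: "weight \<omega> (monomial L)" "\<forall>a. \<bar>\<omega> a\<bar> \<le> int (length L)" using weight_monomial by blast
  then have "sp_der a a (monomial L) = Const (of_int (\<omega> a)) * monomial L" by (simp add: weight_def)
  then have "shifts (sp_der a a) (map of_int [- int d..int d]) (monomial L) =
    Const (\<Prod>s\<leftarrow>map of_int [- int d..int d]. of_int (\<omega> a) - s) * monomial L"
    by (rule shifts_eigen[OF clinear_sp_der])
  moreover have "(\<Prod>s\<leftarrow>map of_int [- int d..int d]. of_int (\<omega> a) - s) = (0::complex)"
    using \<omega>(2)[rule_format, of a] deg_le_monomial by (auto simp: prod_list_zero_iff intro!: image_eqI[of _ _ "\<omega> a"])
  ultimately show ?case by simp
qed (simp_all add: clinearD[OF clinear_shifts[OF clinear_sp_der]])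

lemma weight_bounded:
  assumes "weight \<omega> p" "deg_le d p" "p \<noteq> 0"
  shows "\<bar>\<omega> a\<bar> \<le> int d"
proof -
  have "sp_der a a p = Const (of_int (\<omega> a)) * p" using assms(1) by (simp add: weight_def)
  from shifts_eigen[OF clinear_sp_der this]
  have "Const (\<Prod>s\<leftarrow>map of_int [- int d..int d]. of_int (\<omega> a) - s) * p = 0"
    using deg_le_weight_annihilated[OF assms(2), of a] by metis
  then have "(\<Prod>s\<leftarrow>map of_int [- int d..int d]. of_int (\<omega> a) - s) = (0::complex)"
    using Const_cancel[of _ p 0] assms(3) by fastforce
  then have "of_int (\<omega> a) \<in> (of_int ` {- int d..int d} :: complex set)"
    by (auto simp: prod_list_zero_iff)
  then show ?thesis by auto
qed


section \<open>Positive roots, highest weights and dominance\<close>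

locale height =
  fixes h :: "'l::finite \<Rightarrow> int"
  assumes bij_h: "bij_betw h UNIV {1..int CARD('l)}"
begin

text \<open>\<open>eta\<close> orders the indices and thereby selects the positive roots: the raising operators are
  \<open>sp_der a b\<close> with \<open>eta b < eta a\<close>. Restricted to the first summand it is also half the sum of the
  positive roots.\<close>

definition eta :: "'l + 'l \<Rightarrow> int" where
  "eta a = (case a of Inl i \<Rightarrow> h i | Inr i \<Rightarrow> - h i)"

lemma eta_simps [simp]: "eta (Inl i) = h i" "eta (Inr i) = - h i" "eta (bar a) = - eta a"
  by (simp_all add: eta_def) (cases a; simp)

lemma h_range: "1 \<le> h i" "h i \<le> int CARD('l)"
  using bij_betw_apply[OF bij_h, of i] by auto

lemma bij_eta: "bij_betw eta UNIV ({- int CARD('l)..int CARD('l)} - {0})"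
  unfolding bij_betw_def
proof
  show "inj eta"
  proof (rule injI)
    fix a b assume e: "eta a = eta b"
    have inj: "h i = h j \<Longrightarrow> i = j" for i j
      using bij_h by (auto simp: bij_betw_def inj_def)
    have ne: "h i \<noteq> - h j" "- h i \<noteq> h j" for i j
      using h_range(1)[of i] h_range(1)[of j] by linarith+
    show "a = b"
      using e inj ne by (cases a; cases b) simp_all
  qed
  show "range eta = {- int CARD('l)..int CARD('l)} - {0}"
  proof (intro equalityI subsetI)
    fix t assume "t \<in> range eta"
    then obtain a where "t = eta a" by auto
    then show "t \<in> {- int CARD('l)..int CARD('l)} - {0}"
    proof (cases a)
      case (Inl i)
      then show ?thesis using \<open>t = eta a\<close> h_range[of i] by simp
    next
      case (Inr i)
      then show ?thesis using \<open>t = eta a\<close> h_range[of i] by simp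
    qed
  next
    fix t assume t: "t \<in> {- int CARD('l)..int CARD('l)} - {0}"
    then have "\<bar>t\<bar> \<in> {1..int CARD('l)}" by auto
    then have "\<bar>t\<bar> \<in> range h" using bij_h by (simp add: bij_betw_def)
    then obtain i where "h i = \<bar>t\<bar>" by (metis imageE)
    then have "t = eta (if t > 0 then Inl i else Inr i)" by (simp split: if_split)
    then show "t \<in> range eta" by blast
  qed
qed

lemma eta_eq_iff: "eta a = eta b \<longleftrightarrow> a = b"
  using bij_eta by (auto simp: bij_betw_def inj_def)

text \<open>The values of \<open>eta\<close> are -l, ..., l without 0. Counting those below and
  above one of them gives twice the value, and the missing 0 costs the sign. This is how rho enters
  the Casimir eigenvalue.\<close>

lemma eta_rank:
  "(\<Sum>b\<in>UNIV. of_bool (eta b < eta a) - of_bool (eta a < eta b)) = 2 * eta a - sgn (eta a)"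
proof -
  let ?l = "int CARD('l)" and ?e = "eta a"
  let ?f = "\<lambda>t. of_bool (t < ?e) - of_bool (?e < t) :: int"
  have e: "?e \<in> {- ?l..?l} - {0}" using bij_betw_apply[OF bij_eta, of a] by simp
  have "(\<Sum>b\<in>UNIV. ?f (eta b)) = sum ?f ({- ?l..?l} - {0})"
    by (rule sum.reindex_bij_betw[OF bij_eta])
  also have "\<dots> = sum ?f {- ?l..?l} - ?f 0"
    by (subst sum_diff1) auto
  also have "sum ?f {- ?l..?l} = int (card {- ?l..<?e}) - int (card {?e<..?l})"
  proof -
    have "{- ?l..?l} \<inter> {t. t < ?e} = {- ?l..<?e}" "{- ?l..?l} \<inter> {t. ?e < t} = {?e<..?l}"
      using e by auto
    then show ?thesis by (simp add: sum_subtractf of_bool_def sum.If_cases)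
  qed
  also have "\<dots> - ?f 0 = 2 * ?e - sgn ?e" using e by (auto simp: sgn_if)
  finally show ?thesis .
qed

text \<open>For a weight that is antisymmetric under \<open>bar\<close> this is 2(|\<omega> + rho|^2
  - |rho|^2), because every coordinate is met at an index and at its partner.\<close>

definition cas_val :: "('l + 'l \<Rightarrow> int) \<Rightarrow> int" where
  "cas_val \<omega> = (\<Sum>a\<in>UNIV. \<omega> a ^ 2 + 2 * eta a * \<omega> a)"

definition highest :: "('l + 'l) cpol \<Rightarrow> bool" where
  "highest v \<longleftrightarrow> (\<forall>a b. eta b < eta a \<longrightarrow> sp_der a b v = 0)"

text \<open>By \<open>eta_rank\<close> the differences \<open>\<omega> a - \<omega> b\<close> over
  positive roots sum to 2 eta a - sgn (eta a) times \<open>\<omega> a\<close> per index. The extra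
  share of the long roots \<open>b = bar a\<close> restores exactly the sign term.\<close>

lemma cas_val_sum:
  assumes "\<And>a. \<omega> (bar a) = - \<omega> a"
  shows "(\<Sum>a\<in>UNIV. \<Sum>b\<in>UNIV. if a = b then \<omega> a ^ 2 else
    of_bool (eta b < eta a) * ((1 + of_bool (b = bar a)) * (\<omega> a - \<omega> b))) = cas_val \<omega>"
proof -
  let ?S = "\<lambda>f. \<Sum>a\<in>UNIV. \<Sum>b\<in>UNIV. f a b"
  have e1: "?S (\<lambda>a b. if a = b then \<omega> a ^ 2 else
      of_bool (eta b < eta a) * ((1 + of_bool (b = bar a)) * (\<omega> a - \<omega> b)))
    = ?S (\<lambda>a b. (if a = b then \<omega> a ^ 2 else 0) + (of_bool (eta b < eta a) * \<omega> a - of_bool (eta b < eta a) * \<omega> b)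
       + (if b = bar a then of_bool (0 < eta a) * (2 * \<omega> a) else 0))"
    by (intro sum.cong refl) (auto simp: assms algebra_simps)
  have e2: "?S (\<lambda>a b. of_bool (eta b < eta a) * \<omega> b) = ?S (\<lambda>a b. of_bool (eta a < eta b) * \<omega> a)"
    by (rule sum.swap)
  have e3: "?S (\<lambda>a b. of_bool (eta b < eta a) * \<omega> a) - ?S (\<lambda>a b. of_bool (eta a < eta b) * \<omega> a) =
     (\<Sum>a\<in>UNIV. (2 * eta a - sgn (eta a)) * \<omega> a)"
    unfolding eta_rank[symmetric] sum_distrib_right sum_subtractf left_diff_distrib ..
  have "(\<Sum>a\<in>UNIV. of_bool (0 < eta a) * \<omega> a) = (\<Sum>a\<in>UNIV. of_bool (0 < eta (bar a)) * \<omega> (bar a))"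
    by (rule sum.reindex_bij_betw[OF bij_bar, symmetric])
  then have "(\<Sum>a\<in>UNIV. of_bool (0 < eta a) * \<omega> a) = (\<Sum>a\<in>UNIV. - of_bool (eta a < 0) * \<omega> a)"
    by (simp only: assms eta_simps) simp
  moreover have "(\<Sum>a\<in>UNIV. of_bool (0 < eta a) * (2 * \<omega> a)) =
    (\<Sum>a\<in>UNIV. of_bool (0 < eta a) * \<omega> a) + (\<Sum>a\<in>UNIV. of_bool (0 < eta a) * \<omega> a)"
    unfolding sum.distrib[symmetric] by (intro sum.cong refl) simp
  moreover have "(\<Sum>a\<in>UNIV. of_bool (0 < eta a) * \<omega> a) + (\<Sum>a\<in>UNIV. - of_bool (eta a < 0) * \<omega> a) =
    (\<Sum>a\<in>UNIV. sgn (eta a) * \<omega> a)"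
    unfolding sum.distrib[symmetric] by (intro sum.cong refl) (auto simp: sgn_if)
  ultimately have e4: "(\<Sum>a\<in>UNIV. of_bool (0 < eta a) * (2 * \<omega> a)) = (\<Sum>a\<in>UNIV. sgn (eta a) * \<omega> a)"
    by simp
  have e5: "?S (\<lambda>a b. if a = b then \<omega> a ^ 2 else 0) = (\<Sum>a\<in>UNIV. \<omega> a ^ 2)"
    "?S (\<lambda>a b. if b = bar a then of_bool (0 < eta a) * (2 * \<omega> a) else 0) = (\<Sum>a\<in>UNIV. of_bool (0 < eta a) * (2 * \<omega> a))"
    by (simp_all only: sum.delta sum.delta' finite_UNIV if_True finite UNIV_I)
  show ?thesis
    unfolding e1 unfolding sum.distrib sum_subtractf e5 unfolding e4 e2 e3
    unfolding cas_val_def sum.distrib[symmetric] by (intro sum.cong refl) (simp add: algebra_simps)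
qed

text \<open>The commutator of opposite root vectors is a coroot; its extra factor 2 for
  \<open>b = bar a\<close> comes from the doubled matrix unit.\<close>

lemma sp_der_commutator_opposite:
  assumes "weight \<omega> q" "a \<noteq> b" "\<omega> (bar a) = - \<omega> a" "\<omega> (bar b) = - \<omega> b"
  shows "sp_der a b (sp_der b a q) = sp_der b a (sp_der a b q) + Const (of_int ((1 + of_bool (b = bar a)) * (\<omega> a - \<omega> b))) * q"
proof (cases "b = bar a")
  case True
  then show ?thesis using sp_der_commutator[of a b b a q] assms unfolding weight_def
    by (simp add: algebra_simps)
next
  case False
  then have "a \<noteq> bar b" by auto
  with False show ?thesis using sp_der_commutator[of a b b a q] assms unfolding weight_def
    by (simp add: algebra_simps)
qed

text \<open>Raising operators are moved to the right, where they kill \<open>v\<close>. What remains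
  are the squares of the diagonal operators and one coroot for every pair with
  \<open>eta b < eta a\<close>.\<close>

lemma casimir_highest:
  assumes "weight \<omega> v" "highest v" "\<And>a. \<omega> (bar a) = - \<omega> a"
  shows "casimir v = Const (of_int (cas_val \<omega>)) * v"
proof -
  have "sp_der a b (sp_der b a v) = Const (of_int (if a = b then \<omega> a ^ 2 else
    of_bool (eta b < eta a) * ((1 + of_bool (b = bar a)) * (\<omega> a - \<omega> b)))) * v" for a b
  proof (cases "eta a" "eta b" rule: linorder_cases)
    case less
    then show ?thesis using assms(2) by (auto simp: highest_def sp_der_simps)
  next
    case equal
    then have "a = b" by (simp add: eta_eq_iff)
    then show ?thesis using assms(1) by (simp add: weight_def sp_der_simps power2_eq_square mult.assoc)
  next
    case greater
    then have "a \<noteq> b" by auto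
    then have "sp_der a b (sp_der b a v) = sp_der b a (sp_der a b v) + Const (of_int ((1 + of_bool (b = bar a)) * (\<omega> a - \<omega> b))) * v"
      using sp_der_commutator_opposite[OF assms(1)] assms(3) by blast
    moreover have "sp_der a b v = 0" using greater assms(2) by (auto simp: highest_def)
    ultimately show ?thesis using greater \<open>a \<noteq> b\<close> by (simp add: sp_der_simps)
  qed
  then have "casimir v = Const (of_int (\<Sum>a\<in>UNIV. \<Sum>b\<in>UNIV. if a = b then \<omega> a ^ 2 else
    of_bool (eta b < eta a) * ((1 + of_bool (b = bar a)) * (\<omega> a - \<omega> b)))) * v"
    unfolding casimir_def of_int_sum Const_sum sum_distrib_right by presburger
  then show ?thesis using cas_val_sum[of \<omega>, OF assms(3)] by simp
qed

text \<open>The case \<open>b = bar a\<close> says that \<open>\<omega> a\<close> is nonnegative for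
  positive \<open>eta a\<close>. So this is dominance for the root system C_l: nonnegative
  coordinates that increase weakly with \<open>h\<close>.\<close>

definition dominant :: "('l + 'l \<Rightarrow> int) \<Rightarrow> bool" where
  "dominant \<omega> \<longleftrightarrow> (\<forall>a. \<omega> (bar a) = - \<omega> a) \<and> (\<forall>a b. eta b < eta a \<longrightarrow> \<omega> b \<le> \<omega> a)"

text \<open>If \<open>\<omega> a < \<omega> b\<close>, the sl2 relations show that the powers of the lowering operator \<open>sp_der b a\<close>
  never annihilate \<open>v\<close>, although the weights in bounded degree are bounded.\<close>

lemma highest_dominant:
  assumes "weight \<omega> v" "highest v" "deg_le d v" "v \<noteq> 0"
  shows "dominant \<omega>"
  unfolding dominant_def
proof (intro conjI allI impI)
  show bar: "\<omega> (bar a) = - \<omega> a" for a by (rule weight_bar[OF assms(1,4)])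
  fix a b assume ab: "eta b < eta a"
  then have [simp]: "a \<noteq> b" "b \<noteq> a" by auto
  have [simp]: "a = bar b \<longleftrightarrow> b = bar a" "bar a = b \<longleftrightarrow> b = bar a" "bar b = a \<longleftrightarrow> b = bar a" by auto
  \<comment> \<open>One lowering step moves coordinate \<open>a\<close> by \<open>t\<close>; the
    same number is the factor in the commutator with the raising operator.\<close>
  define t :: int where "t = 1 + of_bool (b = bar a)"
  have t: "t > 0" by (simp add: t_def)
  define D where "D = \<omega> a - \<omega> b"
  define f where "f n = (sp_der b a ^^ n) v" for n
  have f_Suc: "f (Suc n) = sp_der b a (f n)" for n by (simp add: f_def)
  have wtf: "\<exists>\<omega>'. weight \<omega>' (f n) \<and> \<omega>' a = \<omega> a - t * int n \<and> \<omega>' b = \<omega> b + t * int n \<and>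
     \<omega>' (bar a) = - \<omega>' a \<and> \<omega>' (bar b) = - \<omega>' b" for n
  proof (induction n)
    case 0
    then show ?case using assms(1) bar by (auto simp: f_def)
  next
    case (Suc n)
    then obtain \<omega>' where \<omega>': "weight \<omega>' (f n)" "\<omega>' a = \<omega> a - t * int n" "\<omega>' b = \<omega> b + t * int n"
      "\<omega>' (bar a) = - \<omega>' a" "\<omega>' (bar b) = - \<omega>' b" by blast
    define \<omega>'' where "\<omega>'' = (\<lambda>c. \<omega>' c + (of_bool (c = b) - of_bool (c = a) - of_bool (c = bar b) + of_bool (c = bar a)))"
    have "weight \<omega>'' (f (Suc n))"
      unfolding f_Suc \<omega>''_def by (rule weight_sp_der[OF \<omega>'(1)])
    moreover have "\<omega>'' a = \<omega> a - t * int (Suc n)" "\<omega>'' b = \<omega> b + t * int (Suc n)"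
      by (simp_all add: \<omega>''_def \<omega>'(2,3) t_def algebra_simps)
    moreover have "\<omega>'' (bar a) = - \<omega>'' a" "\<omega>'' (bar b) = - \<omega>'' b"
      by (simp_all add: \<omega>''_def \<omega>'(4,5))
    ultimately show ?case by blast
  qed
  have deg_le_f: "deg_le d (f n)" for n
    by (induction n) (auto simp: f_def assms(3) intro: deg_le_sp_der)
  show "\<omega> b \<le> \<omega> a"
  proof (rule ccontr)
    assume "\<not> \<omega> b \<le> \<omega> a"
    then have D: "D < 0" by (simp add: D_def)
    \<comment> \<open>After k steps the difference of the two coordinates is D - 2 t k, and the sum
      of t (D - 2 t k) over k = 0, ..., n equals t (n + 1)(D - t n). For negative \<open>D\<close>
      it never vanishes.\<close>
    have e: "sp_der a b (f (Suc n)) = Const (of_int (t * int (Suc n) * (D - t * int n))) * f n" for n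
    proof (induction n)
      case 0
      have "sp_der a b v = 0" using assms(2) ab by (simp add: highest_def)
      then show ?case using sp_der_commutator_opposite[OF assms(1), of a b] bar
        by (simp add: f_def sp_der_simps D_def t_def)
    next
      case (Suc n)
      obtain \<omega>' where \<omega>': "weight \<omega>' (f (Suc n))" "\<omega>' a = \<omega> a - t * int (Suc n)" "\<omega>' b = \<omega> b + t * int (Suc n)"
        "\<omega>' (bar a) = - \<omega>' a" "\<omega>' (bar b) = - \<omega>' b" using wtf by blast
      have "sp_der a b (f (Suc (Suc n))) = sp_der b a (sp_der a b (f (Suc n))) + Const (of_int (t * (\<omega>' a - \<omega>' b))) * f (Suc n)"
        using sp_der_commutator_opposite[OF \<omega>'(1), of a b] \<omega>'(4,5) unfolding f_Suc[of "Suc n"] t_def by simp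
      also have "\<dots> = Const (of_int (t * int (Suc n) * (D - t * int n) + t * (\<omega>' a - \<omega>' b))) * f (Suc n)"
        unfolding Suc sp_der_simps(6) f_Suc[symmetric] by (simp only: of_int_add Const_simps distrib_right)
      also have "t * int (Suc n) * (D - t * int n) + t * (\<omega>' a - \<omega>' b) = t * int (Suc (Suc n)) * (D - t * int (Suc n))"
        unfolding \<omega>' D_def by (simp add: algebra_simps)
      finally show ?case .
    qed
    have nz: "f n \<noteq> 0" for n
    proof (induction n)
      case 0 then show ?case using assms(4) by (simp add: f_def)
    next
      case (Suc n)
      have "D - t * int n < 0" using D t by (smt (verit) mult_nonneg_nonneg of_nat_0_le_iff)
      then have "t * int (Suc n) * (D - t * int n) \<noteq> 0" using t by simp
      then have "Const (of_int (t * int (Suc n) * (D - t * int n))) * f n \<noteq> 0"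
        using Const_cancel[of "of_int (t * int (Suc n) * (D - t * int n))" "f n" 0] Suc
        by (simp only: of_int_eq_0_iff mult_zero_right not_False_eq_True)
      then show ?case using e[of n] by (auto simp: sp_der_simps)
    qed
    \<comment> \<open>So many steps push coordinate \<open>a\<close> below -d, against the weight
      bound in degree \<open>d\<close>.\<close>
    define n where "n = nat (int d + \<bar>\<omega> a\<bar> + 1)"
    obtain \<omega>' where "weight \<omega>' (f n)" "\<omega>' a = \<omega> a - t * int n" using wtf by blast
    then have "\<bar>\<omega> a - t * int n\<bar> \<le> int d" using weight_bounded[OF _ deg_le_f nz] by metis
    moreover have "t * int n \<ge> int n" using t by (simp add: mult_le_cancel_right1)
    moreover have "int n = int d + \<bar>\<omega> a\<bar> + 1" by (simp add: n_def)
    ultimately show False by linarith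
  qed
qed

text \<open>\<open>ht\<close> pairs a weight with \<open>eta\<close>. A raising operator increases
  it by 2(eta a - eta b), while \<open>N\<close> bounds it for nonzero weight vectors of degree at
  most \<open>d\<close>. Induction on the gap \<open>N - ht \<omega>\<close> therefore covers all
  raised polynomials at once.\<close>

lemma casimir_annihilated_weight:
  fixes p :: "('l + 'l) cpol"
  assumes "weight \<omega> p" "deg_le d p"
  shows "\<exists>ss. set ss \<subseteq> {of_int (cas_val \<omega>) |\<omega>. dominant \<omega>} \<and> shifts casimir ss p = 0"
proof -
  define N where "N = int d * (\<Sum>a\<in>UNIV. \<bar>eta a\<bar>)"
  define ht where "ht \<omega> = (\<Sum>a\<in>UNIV. \<omega> a * eta a)" for \<omega>
  let ?R = "{of_int (cas_val \<omega>) |\<omega>. dominant \<omega>} :: complex set"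
  have ht_le: "ht \<omega> \<le> N" if q: "weight \<omega> q" "deg_le d q" "q \<noteq> 0" for \<omega> q
  proof -
    have "\<omega> a * eta a \<le> int d * \<bar>eta a\<bar>" for a
    proof -
      have "\<omega> a * eta a \<le> \<bar>\<omega> a\<bar> * \<bar>eta a\<bar>" by (metis abs_ge_self abs_mult)
      also have "\<dots> \<le> int d * \<bar>eta a\<bar>"
        using weight_bounded[OF q] by (intro mult_right_mono) auto
      finally show ?thesis .
    qed
    then show ?thesis unfolding ht_def N_def sum_distrib_left by (intro sum_mono)
  qed
  have "\<exists>ss. set ss \<subseteq> ?R \<and> shifts casimir ss p = 0" if "weight \<omega> p" "deg_le d p" "nat (N - ht \<omega>) = n" for n \<omega> p
    using that
  proof (induction n arbitrary: \<omega> p rule: less_induct)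
    case (less n)
    show ?case
    proof (cases "p = 0")
      case True
      then show ?thesis by (intro exI[of _ "[]"]) auto
    next
      case False
      let ?I = "{(a, b). eta b < eta a}"
      have "\<exists>ss. set ss \<subseteq> ?R \<and> shifts casimir ss (case i of (a, b) \<Rightarrow> sp_der a b p) = 0" if i: "i \<in> ?I" for i
      proof -
        obtain a b where ab: "i = (a, b)" "eta b < eta a" using i by auto
        let ?\<omega> = "\<lambda>c. \<omega> c + (of_bool (c = a) - of_bool (c = b) - of_bool (c = bar a) + of_bool (c = bar b))"
        have "ht ?\<omega> = ht \<omega> + 2 * (eta a - eta b)"
          unfolding ht_def by (simp add: distrib_right left_diff_distrib sum.distrib sum_subtractf of_bool_def
              if_distrib[of "\<lambda>x. x * _"] cong: if_cong)
        note ht = this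
        show ?thesis
        proof (cases "sp_der a b p = 0")
          case True
          then show ?thesis using ab(1) by (intro exI[of _ "[]"]) simp
        next
          case False
          then have "ht ?\<omega> \<le> N" by (rule ht_le[OF weight_sp_der[OF less.prems(1)] deg_le_sp_der[OF less.prems(2)]])
          moreover have "nat (N - H) < n" if "H \<le> N" "H = ht \<omega> + 2 * (eta a - eta b)" for H
          proof -
            have "nat (N - H) < nat (N - ht \<omega>)"
              using that ab(2) by (intro nat_mono_iff[THEN iffD2]) presburger+
            then show ?thesis using less.prems(3) by simp
          qed
          ultimately have "nat (N - ht ?\<omega>) < n" using ht by blast
          then show ?thesis using less.IH[OF _ weight_sp_der[OF less.prems(1)] deg_le_sp_der[OF less.prems(2)] refl] ab(1)
            by simp
        qed
      qed
      then obtain ss where ss: "set ss \<subseteq> ?R" "\<forall>i\<in>?I. shifts casimir ss (case i of (a, b) \<Rightarrow> sp_der a b p) = 0"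
        using shifts_common[OF clinear_casimir, of ?I ?R "\<lambda>i. case i of (a, b) \<Rightarrow> sp_der a b p"] by auto
      \<comment> \<open>The Casimir factors commute with the raising operators, so those annihilate
        \<open>v\<close>. Either \<open>v\<close> is zero or it is a highest weight vector, which
        one further factor kills.\<close>
      define v where "v = shifts casimir ss p"
      have "highest v"
        unfolding highest_def v_def using ss(2)
        by (simp add: shifts_commute[of "sp_der a b" casimir for a b, OF clinear_sp_der casimir_commute])
      moreover have "weight \<omega> v" unfolding v_def by (rule weight_shifts_casimir[OF less.prems(1)])
      moreover have "deg_le d v" unfolding v_def by (rule deg_le_shifts_casimir[OF less.prems(2)])
      ultimately have "v = 0 \<or> dominant \<omega> \<and> casimir v = Const (of_int (cas_val \<omega>)) * v"
        using highest_dominant casimir_highest weight_bar by blast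
      then show ?thesis
      proof
        assume "v = 0" then show ?thesis using ss(1) unfolding v_def by blast
      next
        assume "dominant \<omega> \<and> casimir v = Const (of_int (cas_val \<omega>)) * v"
        then show ?thesis using ss(1) unfolding v_def
          by (intro exI[of _ "of_int (cas_val \<omega>) # ss"]) auto
      qed
    qed
  qed
  from this[OF assms refl] show ?thesis .
qed

lemma casimir_annihilated:
  fixes p :: "('l + 'l) cpol"
  shows "\<exists>ss. set ss \<subseteq> {of_int (cas_val \<omega>) |\<omega>. dominant \<omega>} \<and> shifts casimir ss p = 0"
proof -
  let ?R = "{of_int (cas_val \<omega>) |\<omega>. dominant \<omega>} :: complex set"
  obtain d where "deg_le d p" using deg_le_exists by blast
  then show ?thesis
  proof (induction rule: deg_le.induct)
    case deg_le_zero
    show ?case by (intro exI[of _ "[]"]) auto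
  next
    case (deg_le_monomial L)
    obtain \<omega> where "weight \<omega> (monomial L)" using weight_monomial by blast
    then show ?case using casimir_annihilated_weight deg_le.deg_le_monomial[OF deg_le_monomial] by blast
  next
    case (deg_le_add p q)
    then have "\<exists>ss. set ss \<subseteq> ?R \<and> (\<forall>r\<in>{p, q}. shifts casimir ss r = 0)"
      by (intro shifts_common[OF clinear_casimir]) auto
    then show ?case by (auto simp: clinearD[OF clinear_shifts[OF clinear_casimir]])
  next
    case (deg_le_scale p c)
    then show ?case by (auto simp: clinearD[OF clinear_shifts[OF clinear_casimir]])
  qed
qed

lemma casimir_surj:
  fixes p :: "('l + 'l) cpol"
  assumes "\<And>\<omega>. dominant \<omega> \<Longrightarrow> \<mu> \<noteq> of_int (cas_val \<omega>)"
  shows "\<exists>q. casimir q - Const \<mu> * q = p"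
proof -
  obtain ss where "set ss \<subseteq> {of_int (cas_val \<omega>) |\<omega>. dominant \<omega>}" "shifts casimir ss p = 0"
    using casimir_annihilated by blast
  then show ?thesis using assms by (intro shifts_surj[OF clinear_casimir, of \<mu> ss]) auto
qed

end

section \<open>Highest weight vectors from leading minors\<close>

text \<open>The straight line through \<open>x\<close> with velocity \<open>x ** X\<close> replaces
  the one-parameter flow: a determinant is affine in each column, so its values along this line are
  explicit.\<close>

lemma Der_flow_eigen:
  assumes "\<And>t::real. pev p (x + t *\<^sub>R (x ** X)) = (1 + complex_of_real t * m) * pev p x"
  shows "pev (Der X p) x = m * pev p x"
proof -
  let ?D = "frechet_derivative (pev p) (at x)"
  have "((\<lambda>t::real. x + t *\<^sub>R (x ** X)) has_derivative (\<lambda>t. t *\<^sub>R (x ** X))) (at 0)"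
    by (auto intro!: derivative_eq_intros)
  moreover have "(pev p has_derivative ?D) (at (x + 0 *\<^sub>R (x ** X)))"
    using pev_has_derivative[of p x] by simp
  ultimately have "((\<lambda>t::real. pev p (x + t *\<^sub>R (x ** X))) has_derivative (\<lambda>t. ?D (t *\<^sub>R (x ** X)))) (at 0)"
    by (rule has_derivative_compose)
  moreover have "((\<lambda>t::real. (1 + complex_of_real t * m) * pev p x) has_derivative (\<lambda>t. complex_of_real t * m * pev p x)) (at 0)"
    by (auto intro!: derivative_eq_intros)
  ultimately have "(\<lambda>t. ?D (t *\<^sub>R (x ** X))) = (\<lambda>t. complex_of_real t * m * pev p x)"
    unfolding assms by (rule has_derivative_unique)
  from fun_cong[OF this, of 1] show ?thesis by (simp add: pev_Der)
qed

lemma derivation_eigen_mult: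
  assumes "derivation D" "D p = Const a * p" "D q = Const b * q"
  shows "D (p * q) = Const (a + b) * (p * q)"
  by (simp add: derivationD[OF assms(1)] assms(2,3) algebra_simps)

lemma derivation_eigen_power:
  assumes "derivation D" "D p = Const a * p"
  shows "D (p ^ n) = Const (of_nat n * a) * p ^ n"
proof (induction n)
  case 0
  then show ?case by (simp add: derivationD[OF assms(1)])
next
  case (Suc n)
  from derivation_eigen_mult[OF assms this] show ?case by (simp add: algebra_simps)
qed

lemma derivation_eigen_prod:
  assumes "derivation D" "\<And>i. i \<in> I \<Longrightarrow> D (p i) = Const (a i) * p i"
  shows "D (prod p I) = Const (sum a I) * prod p I"
  using assms(2)
proof (induction I rule: infinite_finite_induct)
  case (insert i I)
  then have "D (p i) = Const (a i) * p i" "D (prod p I) = Const (sum a I) * prod p I" by auto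
  from derivation_eigen_mult[OF assms(1) this] insert.hyps show ?case by simp
qed (simp_all add: derivationD[OF assms(1)])

lemma polyfun_det:
  assumes "\<And>i j. polyfun (\<lambda>x. M x $ i $ j)"
  shows "polyfun (\<lambda>x. det (M x))"
  unfolding det_def by (intro polyfun_sum polyfun_mult polyfun_const polyfun_prod assms)

lemma matrix_mult_munit: "(x ** munit a b) $ i $ j = (if j = b then x $ i $ a else 0)"
  unfolding matrix_matrix_mult_def munit_def
  by (auto simp: if_distrib[of "\<lambda>y. _ * y"] sum.delta cong: if_cong)

context height
begin

text \<open>Completing the corner by an identity block makes the minor a determinant of full size.\<close>

definition corner :: "int \<Rightarrow> complex^('l + 'l)^('l + 'l) \<Rightarrow> complex^('l + 'l)^('l + 'l)" where
  "corner k x = (\<chi> i j. if k \<le> eta i \<and> k \<le> eta j then x $ i $ j else of_bool (i = j))"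

text \<open>For 1 \<le> k \<le> l this is a minor of size l + 1 - k on unbarred indices; its weight
  is a fundamental weight.\<close>

definition leading_minor :: "int \<Rightarrow> ('l + 'l) cpol" where
  "leading_minor k = Abs_cpol (\<lambda>x. det (corner k x))"

lemma pev_leading_minor: "pev (leading_minor k) x = det (corner k x)"
proof -
  have "polyfun (\<lambda>x. corner k x $ i $ j)" for i j
  proof (cases "k \<le> eta i \<and> k \<le> eta j")
    case True
    then show ?thesis by (simp add: corner_def polyfun_var)
  next
    case False
    then have "(\<lambda>x. corner k x $ i $ j) = (\<lambda>x. of_bool (i = j))" by (auto simp: corner_def)
    then show ?thesis by (simp add: polyfun_const)
  qed
  then show ?thesis unfolding leading_minor_def by (subst Abs_cpol_inverse) (auto intro: polyfun_det)
qed

lemma leading_minor_one: "pev (leading_minor k) (mat 1) = 1"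
proof -
  have "corner k (mat 1) = mat 1" unfolding corner_def mat_def vec_eq_iff by simp
  then show ?thesis by (simp add: pev_leading_minor)
qed

text \<open>Moving along \<open>munit a b\<close> adds a multiple of column \<open>a\<close> to
  column \<open>b\<close>. If \<open>b\<close> belongs to the corner, so does the higher index
  \<open>a\<close>, and the determinant is unchanged; otherwise the corner itself is
  unchanged.\<close>

lemma Der_leading_minor_raise:
  assumes "eta b < eta a"
  shows "Der (munit a b) (leading_minor k) = 0"
proof (rule pev_eqI)
  fix x
  have "a \<noteq> b" using assms by auto
  have "det (corner k (x + t *\<^sub>R (x ** munit a b))) = det (corner k x)" for t :: real
  proof (cases "k \<le> eta b")
    case True
    define A where "A = transpose (corner k x)"
    have "transpose (corner k (x + t *\<^sub>R (x ** munit a b))) =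
      (\<chi> j. if j = b then row b A + complex_of_real t *s row a A else row j A)"
      using True assms \<open>a \<noteq> b\<close>
      by (auto simp: vec_eq_iff transpose_def A_def corner_def row_def matrix_mult_munit scaleR_conv_of_real[where 'a=complex])
    then have "det (transpose (corner k (x + t *\<^sub>R (x ** munit a b)))) = det A"
      using det_row_operation[of b a A "complex_of_real t"] \<open>a \<noteq> b\<close> by simp
    then show ?thesis by (simp add: A_def)
  next
    case False
    then have "corner k (x + t *\<^sub>R (x ** munit a b)) = corner k x"
      by (auto simp: vec_eq_iff corner_def matrix_mult_munit)
    then show ?thesis by simp
  qed
  then show "pev (Der (munit a b) (leading_minor k)) x = pev 0 x"
    using Der_flow_eigen[of "leading_minor k" x "munit a b" 0] by (simp add: pev_leading_minor)
qed

lemma Der_leading_minor_diag: "Der (munit a a) (leading_minor k) = Const (of_bool (k \<le> eta a)) * leading_minor k"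
proof (rule pev_eqI)
  fix x
  have "det (corner k (x + t *\<^sub>R (x ** munit a a))) = (1 + complex_of_real t * of_bool (k \<le> eta a)) * det (corner k x)" for t :: real
  proof (cases "k \<le> eta a")
    case True
    define A where "A = transpose (corner k x)"
    have "transpose (corner k (x + t *\<^sub>R (x ** munit a a))) =
      (\<chi> j. if j = a then (1 + complex_of_real t) *s row a A else row j A)"
      using True
      by (auto simp: vec_eq_iff transpose_def A_def corner_def row_def matrix_mult_munit scaleR_conv_of_real[where 'a=complex] algebra_simps)
    also have "det \<dots> = (1 + complex_of_real t) * det (\<chi> j. if j = a then row a A else row j A)"
      by (rule det_row_mul)
    also have "(\<chi> j. if j = a then row a A else row j A) = A"
      by (auto simp: vec_eq_iff row_def)
    finally show ?thesis using True by (simp add: A_def)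
  next
    case False
    then have "corner k (x + t *\<^sub>R (x ** munit a a)) = corner k x"
      by (auto simp: vec_eq_iff corner_def matrix_mult_munit)
    then show ?thesis using False by simp
  qed
  then show "pev (Der (munit a a) (leading_minor k)) x = pev (Const (of_bool (k \<le> eta a)) * leading_minor k) x"
    using Der_flow_eigen[of "leading_minor k" x "munit a a" "of_bool (k \<le> eta a)"] by (simp add: pev_leading_minor)
qed

lemma sp_der_leading_minor_raise: "eta b < eta a \<Longrightarrow> sp_der a b (leading_minor k) = 0"
  unfolding sp_der_def by (simp add: Der_leading_minor_raise)

lemma sp_der_leading_minor_diag: "sp_der a a (leading_minor k) = Const (of_bool (k \<le> eta a) - of_bool (k \<le> - eta a)) * leading_minor k"
  unfolding sp_der_def by (simp add: Der_leading_minor_diag algebra_simps)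

text \<open>\<open>m k\<close> is the multiplicity of the k-th minor. The value 1 at the identity
  shows that the polynomial does not vanish on the group, which being nonzero as a polynomial would
  not ensure.\<close>

lemma exists_highest:
  assumes "\<And>a. \<omega> a = (\<Sum>k=1..int CARD('l). int (m k) * (of_bool (k \<le> eta a) - of_bool (k \<le> - eta a)))"
  shows "\<exists>v :: ('l + 'l) cpol. casimir v = Const (of_int (cas_val \<omega>)) * v \<and> pev v (mat 1) = 1"
proof -
  define v where "v = (\<Prod>k=1..int CARD('l). leading_minor k ^ m k)"
  have "sp_der a b v = 0" if "eta b < eta a" for a b
  proof -
    have "sp_der a b (leading_minor k ^ m k) = Const (of_nat (m k) * 0) * leading_minor k ^ m k" for k
      by (rule derivation_eigen_power[OF derivation_sp_der]) (simp add: sp_der_leading_minor_raise that)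
    from derivation_eigen_prod[OF derivation_sp_der this] show ?thesis unfolding v_def by simp
  qed
  then have "highest v" by (simp add: highest_def)
  moreover have "weight \<omega> v"
    unfolding weight_def
  proof
    fix a
    have "sp_der a a (leading_minor k ^ m k) = Const (of_nat (m k) * (of_bool (k \<le> eta a) - of_bool (k \<le> - eta a))) * leading_minor k ^ m k" for k
      by (rule derivation_eigen_power[OF derivation_sp_der sp_der_leading_minor_diag])
    from derivation_eigen_prod[OF derivation_sp_der this] show "sp_der a a v = Const (of_int (\<omega> a)) * v"
      unfolding v_def assms of_int_sum by simp
  qed
  moreover have "\<omega> (bar a) = - \<omega> a" for a
    unfolding assms sum_negf[symmetric] by (intro sum.cong refl) (simp add: algebra_simps)
  ultimately have "casimir v = Const (of_int (cas_val \<omega>)) * v" using casimir_highest by blast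
  moreover have "pev v (mat 1) = 1" unfolding v_def by (simp add: leading_minor_one)
  ultimately show ?thesis by blast
qed

section \<open>From dominant weights to the parameters nu\<close>

lemma bij_nat_h: "bij_betw (\<lambda>i. nat (h i)) UNIV {1..CARD('l)}"
proof -
  have "bij_betw nat {1..int CARD('l)} {1..CARD('l)}"
    by (rule bij_betw_byWitness[of _ int]) auto
  from bij_betw_trans[OF bij_h this] show ?thesis by (simp add: o_def)
qed

text \<open>Completing the square: \<omega>^2 + 2 h \<omega> = (\<omega> + h)^2 - h^2.
  \<open>W\<close> lists the coordinates of \<omega> + rho by height, and the factor 2 accounts for
  the barred indices.\<close>

lemma cas_val_eq:
  assumes "\<And>a. \<omega> (bar a) = - \<omega> a" "\<And>i. \<omega> (Inl i) + h i = W (nat (h i))"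
  shows "cas_val \<omega> = 2 * ((\<Sum>t=1..CARD('l). (W t)\<^sup>2) - (\<Sum>t=1..CARD('l). (int t)\<^sup>2))"
proof -
  have Inr: "\<omega> (Inr i) = - \<omega> (Inl i)" for i using assms(1)[of "Inl i"] by simp
  have "(\<Sum>t=1..CARD('l). (W t)\<^sup>2 - (int t)\<^sup>2) = (\<Sum>i\<in>UNIV. (W (nat (h i)))\<^sup>2 - (int (nat (h i)))\<^sup>2)"
    by (rule sum.reindex_bij_betw[OF bij_nat_h, symmetric])
  also have "\<dots> = (\<Sum>i\<in>UNIV. \<omega> (Inl i) ^ 2 + 2 * h i * \<omega> (Inl i))"
  proof (rule sum.cong[OF refl])
    fix i
    have "int (nat (h i)) = h i" using h_range[of i] by simp
    then show "(W (nat (h i)))\<^sup>2 - (int (nat (h i)))\<^sup>2 = \<omega> (Inl i) ^ 2 + 2 * h i * \<omega> (Inl i)"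
      unfolding assms(2)[symmetric] by (simp add: power2_eq_square algebra_simps)
  qed
  finally have *: "(\<Sum>t=1..CARD('l). (W t)\<^sup>2 - (int t)\<^sup>2) = (\<Sum>i\<in>UNIV. \<omega> (Inl i) ^ 2 + 2 * h i * \<omega> (Inl i))" .
  have "cas_val \<omega> = 2 * (\<Sum>i\<in>UNIV. \<omega> (Inl i) ^ 2 + 2 * h i * \<omega> (Inl i))"
    unfolding cas_val_def UNIV_sum by (subst sum.union_disjoint) (auto simp: sum.reindex Inr)
  then show ?thesis unfolding *[symmetric] sum_subtractf .
qed

end

text \<open>The substitution t = l + 1 - k sorts the inner sums by height, and the subtracted
  constant becomes the sum of squares |rho|^2.\<close>

lemma lambda_nu_eq:
  assumes "\<gamma> > 0"
  shows "lambda_nu l \<gamma> \<nu> = real_of_int (2 * ((\<Sum>t=1..l. (\<Sum>j=Suc l - t..l. int (\<nu> j))\<^sup>2) - (\<Sum>t=1..l. (int t)\<^sup>2))) / (8 * (real l + 1) * \<gamma>)"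
proof -
  have sq: "real_of_int (\<Sum>t=1..l. (int t)\<^sup>2) = real l * (real l + 1) * (2 * real l + 1) / 6"
    by (induction l) (simp_all add: field_simps power2_eq_square)
  have "(\<Sum>k=1..l. (\<Sum>j=k..l. real (\<nu> j))\<^sup>2) = (\<Sum>t=1..l. (\<Sum>j=Suc l - t..l. real (\<nu> j))\<^sup>2)"
    by (subst sum.atLeastAtMost_rev) (simp add: add.commute)
  then have "(\<Sum>k=1..l. (\<Sum>j=k..l. real (\<nu> j))\<^sup>2) = real_of_int (\<Sum>t=1..l. (\<Sum>j=Suc l - t..l. int (\<nu> j))\<^sup>2)"
    by simp
  moreover have "1 / (4 * c * \<gamma>) * (A - B) = 2 * (A - B) / (8 * c * \<gamma>)" for A B c :: real
    by (simp add: divide_simps)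
  ultimately show ?thesis
    unfolding lambda_nu_def sq[symmetric] by (simp only: of_int_mult of_int_diff of_int_numeral)
qed

context height
begin

lemma dominant_imp_lambda:
  assumes "dominant \<omega>" "\<gamma> > 0"
  shows "\<exists>\<nu>. (\<forall>j\<in>{1..CARD('l)}. \<nu> j \<ge> 1) \<and>
    real_of_int (cas_val \<omega>) / (8 * (real CARD('l) + 1) * \<gamma>) = lambda_nu CARD('l) \<gamma> \<nu>"
proof -
  let ?l = "CARD('l)"
  have bar: "\<omega> (bar a) = - \<omega> a" for a using assms(1) by (simp add: dominant_def)
  have mono: "eta b < eta a \<Longrightarrow> \<omega> b \<le> \<omega> a" for a b using assms(1) by (simp add: dominant_def)
  define g where "g = inv_into UNIV (\<lambda>i. nat (h i))"
  have hg: "nat (h (g t)) = t" if "t \<in> {1..?l}" for t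
    unfolding g_def using that bij_nat_h by (intro f_inv_into_f) (auto simp: bij_betw_def)
  have gh: "g (nat (h i)) = i" for i
    unfolding g_def using bij_nat_h by (intro inv_into_f_f) (auto simp: bij_betw_def)
  \<comment> \<open>Coordinates of \<omega> + rho by height, with the value 0 at height 0 so that
    the lowest coordinate is an increment too.\<close>
  define W where "W t = (if t = 0 then 0 else \<omega> (Inl (g t)) + int t)" for t
  have step: "W t + 1 \<le> W (Suc t)" if "t < ?l" for t
  proof (cases t)
    case 0
    \<comment> \<open>At the bottom no lower coordinate exists; there the long root gives
      nonnegativity of the coordinate of \<omega>.\<close>
    then have 1: "h (g (Suc t)) = 1" using hg[of "Suc t"] that h_range[of "g (Suc t)"] by auto
    have "\<omega> (Inr (g (Suc t))) \<le> \<omega> (Inl (g (Suc t)))" by (rule mono) (simp add: 1)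
    then show ?thesis using bar[of "Inl (g (Suc t))"] 0 by (simp add: W_def)
  next
    case (Suc s)
    have "h (g t) = int t" "h (g (Suc t)) = int (Suc t)"
      using hg[of t] hg[of "Suc t"] that Suc h_range[of "g t"] h_range[of "g (Suc t)"] by auto
    then have "\<omega> (Inl (g t)) \<le> \<omega> (Inl (g (Suc t)))" by (intro mono) simp
    then show ?thesis using Suc by (simp add: W_def)
  qed
  \<comment> \<open>Successive increments from the top down: dominance makes the coordinates of
    \<omega> weakly increasing, and adding rho makes every increment at least 1.\<close>
  define \<nu> where "\<nu> j = nat (W (Suc ?l - j) - W (?l - j))" for j
  have \<nu>: "int (\<nu> j) = W (Suc ?l - j) - W (?l - j)" "\<nu> j \<ge> 1" if "j \<in> {1..?l}" for j
    using step[of "?l - j"] that by (auto simp: \<nu>_def Suc_diff_le)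
  have sum: "(\<Sum>j=Suc ?l - t..?l. int (\<nu> j)) = W t" if "t \<le> ?l" for t
    using that
  proof (induction t)
    case 0
    then show ?case by (simp add: W_def)
  next
    case (Suc t)
    have "(\<Sum>j=Suc ?l - Suc t..?l. int (\<nu> j)) = int (\<nu> (?l - t)) + (\<Sum>j=Suc ?l - t..?l. int (\<nu> j))"
      using Suc.prems by (simp add: sum.atLeast_Suc_atMost Suc_diff_le)
    then show ?case using Suc \<nu>(1)[of "?l - t"] by (simp add: Suc_diff_le)
  qed
  have "\<omega> (Inl i) + h i = W (nat (h i))" for i
    using h_range[of i] by (simp add: W_def gh)
  from cas_val_eq[OF bar this]
  have "cas_val \<omega> = 2 * ((\<Sum>t=1..?l. (\<Sum>j=Suc ?l - t..?l. int (\<nu> j))\<^sup>2) - (\<Sum>t=1..?l. (int t)\<^sup>2))"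
    using sum by simp
  then have "real_of_int (cas_val \<omega>) / (8 * (real ?l + 1) * \<gamma>) = lambda_nu ?l \<gamma> \<nu>"
    unfolding lambda_nu_eq[OF assms(2), of ?l \<nu>] by (rule arg_cong)
  then show ?thesis using \<nu>(2) by blast
qed

lemma exists_eigenpoly:
  assumes "\<And>j. j \<in> {1..CARD('l)} \<Longrightarrow> \<nu> j \<ge> 1" "\<gamma> > 0"
  shows "\<exists>v :: ('l + 'l) cpol. casimir v = Const (of_real (8 * (real CARD('l) + 1) * \<gamma> * lambda_nu CARD('l) \<gamma> \<nu>)) * v \<and> pev v (mat 1) = 1"
proof -
  let ?l = "CARD('l)"
  \<comment> \<open>Adding rho adds 1 to each multiplicity, so the exponent is nu - 1. The reversed
    index fits inner sums over j \<ge> k; the natural subtraction is exact because nu is at least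
    1.\<close>
  define m where "m k = \<nu> (nat (int ?l + 1 - k)) - 1" for k :: int
  define \<omega> where "\<omega> a = (\<Sum>k=1..int ?l. int (m k) * (of_bool (k \<le> eta a) - of_bool (k \<le> - eta a)))" for a
  have bar: "\<omega> (bar a) = - \<omega> a" for a
    unfolding \<omega>_def sum_negf[symmetric] by (intro sum.cong refl) (simp add: algebra_simps)
  have "\<omega> (Inl i) + h i = (\<Sum>j=Suc ?l - nat (h i)..?l. int (\<nu> j))" for i
  proof -
    have "\<omega> (Inl i) = (\<Sum>k=1..int ?l. if k \<le> h i then int (m k) else 0)"
      unfolding \<omega>_def using h_range[of i] by (intro sum.cong refl) auto
    also have "\<dots> = (\<Sum>k=1..h i. int (m k))"
      using h_range[of i] by (intro sum.mono_neutral_cong_right) auto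
    finally have "\<omega> (Inl i) + h i = (\<Sum>k=1..h i. int (m k)) + (\<Sum>k=1..h i. 1)"
      using h_range[of i] by simp
    also have "\<dots> = (\<Sum>k=1..h i. int (\<nu> (nat (int ?l + 1 - k))))"
      unfolding sum.distrib[symmetric]
    proof (intro sum.cong refl)
      fix k assume "k \<in> {1..h i}"
      then have "nat (int ?l + 1 - k) \<in> {1..?l}" using h_range[of i] by auto
      then show "int (m k) + 1 = int (\<nu> (nat (int ?l + 1 - k)))" using assms(1) by (simp add: m_def of_nat_diff)
    qed
    also have "\<dots> = (\<Sum>j=Suc ?l - nat (h i)..?l. int (\<nu> j))"
      using h_range[of i]
      by (intro sum.reindex_bij_witness[of _ "\<lambda>j. int ?l + 1 - int j" "\<lambda>k. nat (int ?l + 1 - k)"]) auto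
    finally show ?thesis .
  qed
  from cas_val_eq[of \<omega> "\<lambda>t. \<Sum>j=Suc ?l - t..?l. int (\<nu> j)", OF bar this] lambda_nu_eq[OF assms(2), of ?l \<nu>]
  have "real_of_int (cas_val \<omega>) = 8 * (real ?l + 1) * \<gamma> * lambda_nu ?l \<gamma> \<nu>"
    using assms(2) by simp
  moreover obtain v :: "('l + 'l) cpol" where "casimir v = Const (of_int (cas_val \<omega>)) * v" "pev v (mat 1) = 1"
    using exists_highest[of \<omega> m] \<omega>_def by blast
  ultimately show ?thesis by (metis of_real_of_int_eq)
qed

end

section \<open>The matrix exponential\<close>

lemma has_vector_derivative_entries:
  fixes M :: "real \<Rightarrow> complex^'n^'m"
  assumes "\<And>i j. ((\<lambda>t. M t $ i $ j) has_vector_derivative D $ i $ j) (at t)"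
  shows "(M has_vector_derivative D) (at t)"
  unfolding has_vector_derivative_def has_derivative_componentwise_within[of M]
proof
  fix b :: "complex^'n^'m" assume "b \<in> Basis"
  then obtain i j u where b: "b = axis i (axis j u)" by (auto simp: Basis_vec_def)
  have "((\<lambda>x. M x $ i $ j \<bullet> u) has_derivative (\<lambda>x. (x *\<^sub>R D $ i $ j) \<bullet> u)) (at t)"
    by (rule has_derivative_inner_left) (use assms in \<open>simp add: has_vector_derivative_def\<close>)
  then show "((\<lambda>x. M x \<bullet> b) has_derivative (\<lambda>x. (x *\<^sub>R D) \<bullet> b)) (at t)"
    by (simp add: b inner_axis)
qed

definition mpow :: "complex^'n^'n \<Rightarrow> nat \<Rightarrow> complex^'n^'n" where
  "mpow A k = ((**) A ^^ k) (mat 1)"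

lemma mpow_simps: "mpow A 0 = mat 1" "mpow A (Suc k) = A ** mpow A k"
  by (simp_all add: mpow_def)

lemma mpow_commute: "A ** mpow A k = mpow A k ** A"
  by (induction k) (simp_all add: mpow_simps matrix_mul_assoc)

lemma matrix_mult_scaleR:
  fixes A :: "complex^'n^'m" and B :: "complex^'p^'n"
  shows "(t *\<^sub>R A) ** B = t *\<^sub>R (A ** B)" "A ** (t *\<^sub>R B) = t *\<^sub>R (A ** B)"
  by (simp_all add: vec_eq_iff matrix_matrix_mult_def scaleR_sum_right)

lemma mpow_scaleR: "mpow (t *\<^sub>R A) k = t ^ k *\<^sub>R mpow A k"
  by (induction k) (simp_all add: mpow_simps matrix_mult_scaleR)

lemma mpow_entry_bound: "norm (mpow A k $ i $ j) \<le> (\<Sum>a\<in>UNIV. \<Sum>b\<in>UNIV. norm (A $ a $ b)) ^ k"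
proof (induction k arbitrary: i)
  case 0
  then show ?case by (simp add: mpow_simps mat_def)
next
  case (Suc k)
  let ?S = "\<Sum>a\<in>UNIV. \<Sum>b\<in>UNIV. norm (A $ a $ b)"
  have "norm (mpow A (Suc k) $ i $ j) \<le> (\<Sum>l\<in>UNIV. norm (A $ i $ l) * norm (mpow A k $ l $ j))"
    by (simp add: mpow_simps matrix_matrix_mult_def norm_mult[symmetric] norm_sum)
  also have "\<dots> \<le> (\<Sum>l\<in>UNIV. norm (A $ i $ l) * ?S ^ k)"
    by (intro sum_mono mult_left_mono Suc) auto
  also have "\<dots> = (\<Sum>l\<in>UNIV. norm (A $ i $ l)) * ?S ^ k" by (simp add: sum_distrib_right)
  also have "\<dots> \<le> ?S * ?S ^ k"
    by (intro mult_right_mono member_le_sum[of i UNIV "\<lambda>i. \<Sum>l\<in>UNIV. norm (A $ i $ l)"] zero_le_power sum_nonneg) auto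
  finally show ?case by simp
qed

text \<open>Every entry of \<open>mexp (t *\<^sub>R A)\<close> is an everywhere convergent scalar
  power series in \<open>t\<close> with these coefficients, so the exponential is differentiated
  entry by entry.\<close>

definition mcoeff :: "complex^'n^'n \<Rightarrow> 'n \<Rightarrow> 'n \<Rightarrow> nat \<Rightarrow> complex" where
  "mcoeff A i j k = mpow A k $ i $ j / fact k"

lemma mexp_coeff_summable: "summable (\<lambda>k. mcoeff A i j k * z ^ k)"
proof -
  let ?S = "\<Sum>a\<in>UNIV. \<Sum>b\<in>UNIV. norm (A $ a $ b)"
  show ?thesis
  proof (rule summable_comparison_test)
    show "summable (\<lambda>k. (?S * norm z) ^ k / fact k)"
      using summable_exp_generic[of "?S * norm z"] by (simp add: divide_inverse mult.commute scaleR_conv_of_real)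
    have "norm (mpow A k $ i $ j) * norm z ^ k / fact k \<le> ?S ^ k * norm z ^ k / fact k" for k
      by (intro divide_right_mono mult_right_mono mpow_entry_bound) auto
    then show "\<exists>N. \<forall>n\<ge>N. norm (mcoeff A i j n * z ^ n) \<le> (?S * norm z) ^ n / fact n"
      by (simp add: mcoeff_def norm_mult norm_divide norm_power power_mult_distrib)
  qed
qed

lemma mexp_entry: "mexp (t *\<^sub>R A) $ i $ j = (\<Sum>k. mcoeff A i j k * complex_of_real t ^ k)"
proof -
  let ?f = "\<lambda>k. (1 / fact k) *\<^sub>R mpow (t *\<^sub>R A) k"
  let ?s = "\<chi> i j. \<Sum>k. mcoeff A i j k * complex_of_real t ^ k"
  have "?f sums ?s"
    unfolding sums_def
  proof (intro vec_tendstoI)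
    fix i j
    have "(\<lambda>k. mcoeff A i j k * complex_of_real t ^ k) sums (?s $ i $ j)"
      by (simp add: summable_sums mexp_coeff_summable)
    moreover have "(\<lambda>k. mcoeff A i j k * complex_of_real t ^ k) = (\<lambda>k. ?f k $ i $ j)"
      by (auto simp: mpow_scaleR fun_eq_iff mcoeff_def scaleR_conv_of_real[where 'a = complex])
    ultimately show "(\<lambda>n. (\<Sum>k<n. ?f k) $ i $ j) \<longlonglongrightarrow> ?s $ i $ j"
      by (simp add: sums_def sum_component)
  qed
  then have "mexp (t *\<^sub>R A) = ?s" unfolding mexp_def mpow_def[symmetric] by (rule sums_unique[symmetric])
  then show ?thesis by simp
qed

lemma mexp_zero [simp]: "mexp 0 = mat 1"
proof -
  have "mexp (0 *\<^sub>R 0 :: complex^'a^'a) $ i $ j = mat 1 $ i $ j" for i j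
    unfolding mexp_entry by (subst suminf_finite[of "{0}"]) (auto simp: mpow_simps mcoeff_def)
  then show ?thesis by (simp add: vec_eq_iff)
qed

lemma matrix_mult_suminf:
  assumes "\<And>l. summable (f l :: nat \<Rightarrow> complex)"
  shows "(\<Sum>l\<in>UNIV. c l * (\<Sum>k. f l k)) = (\<Sum>k. \<Sum>l\<in>UNIV. c l * f l k)"
  by (subst suminf_sum) (auto intro: summable_mult assms simp: suminf_mult assms)

text \<open>Termwise differentiation puts the generator on the left of the exponential;
  left-invariant fields need it on the right.\<close>

lemma mexp_commute: "A ** mexp (t *\<^sub>R A) = mexp (t *\<^sub>R A) ** A"
proof -
  have "(A ** mexp (t *\<^sub>R A)) $ i $ j = (mexp (t *\<^sub>R A) ** A) $ i $ j" for i j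
  proof -
    have "(A ** mexp (t *\<^sub>R A)) $ i $ j = (\<Sum>k. \<Sum>l\<in>UNIV. A $ i $ l * (mcoeff A l j k * complex_of_real t ^ k))"
      unfolding matrix_matrix_mult_def by (simp add: mexp_entry matrix_mult_suminf mexp_coeff_summable)
    also have "\<dots> = (\<Sum>k. (A ** mpow A k) $ i $ j / fact k * complex_of_real t ^ k)"
      unfolding mcoeff_def matrix_matrix_mult_def by (simp add: sum_distrib_right sum_divide_distrib mult.assoc)
    also have "\<dots> = (\<Sum>k. (mpow A k ** A) $ i $ j / fact k * complex_of_real t ^ k)"
      by (simp add: mpow_commute)
    also have "\<dots> = (\<Sum>k. \<Sum>l\<in>UNIV. A $ l $ j * (mcoeff A i l k * complex_of_real t ^ k))"
      unfolding matrix_matrix_mult_def mcoeff_def by (simp add: sum_distrib_left sum_distrib_right sum_divide_distrib mult_ac)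
    also have "\<dots> = (mexp (t *\<^sub>R A) ** A) $ i $ j"
      unfolding matrix_matrix_mult_def
      by (subst matrix_mult_suminf[symmetric]) (simp_all add: mexp_coeff_summable mexp_entry mult.commute[of "A $ _ $ j"])
    finally show ?thesis .
  qed
  then show ?thesis by (simp add: vec_eq_iff)
qed

lemma mexp_has_vector_derivative:
  "((\<lambda>t. mexp (t *\<^sub>R A)) has_vector_derivative A ** mexp (t *\<^sub>R A)) (at t)"
proof (rule has_vector_derivative_entries)
  fix i j
  let ?c = "mcoeff A i j"
  have d: "diffs ?c k = (\<Sum>l\<in>UNIV. A $ i $ l * mcoeff A l j k)" for k
  proof -
    have "diffs ?c k = mpow A (Suc k) $ i $ j / fact k"
      unfolding diffs_def mcoeff_def by (simp add: field_simps del: of_nat_Suc)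
    then show ?thesis by (simp add: mcoeff_def mpow_simps matrix_matrix_mult_def sum_divide_distrib)
  qed
  have "((\<lambda>z. \<Sum>k. ?c k * z ^ k) has_field_derivative (\<Sum>k. diffs ?c k * complex_of_real t ^ k)) (at (complex_of_real t))"
    by (rule termdiffs_strong_converges_everywhere) (rule mexp_coeff_summable)
  from has_vector_derivative_real_field[OF this]
  have "((\<lambda>t. \<Sum>k. ?c k * complex_of_real t ^ k) has_vector_derivative (\<Sum>k. diffs ?c k * complex_of_real t ^ k)) (at t)"
    by simp
  moreover have "(\<Sum>k. diffs ?c k * complex_of_real t ^ k) = (A ** mexp (t *\<^sub>R A)) $ i $ j"
    unfolding matrix_matrix_mult_def d
    by (simp add: mexp_entry matrix_mult_suminf mexp_coeff_summable sum_distrib_right mult.assoc)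
  ultimately show "((\<lambda>t. mexp (t *\<^sub>R A) $ i $ j) has_vector_derivative (A ** mexp (t *\<^sub>R A)) $ i $ j) (at t)"
    by (simp add: mexp_entry)
qed

section \<open>The symplectic group\<close>

lemma bounded_bilinear_matrix_mult:
  "bounded_bilinear ((**) :: complex^'n^'m \<Rightarrow> complex^'p^'n \<Rightarrow> complex^'p^'m)"
proof -
  have "bilinear ((**) :: complex^'n^'m \<Rightarrow> complex^'p^'n \<Rightarrow> complex^'p^'m)"
    unfolding bilinear_def
    by (auto intro!: linearI simp: vec_eq_iff matrix_matrix_mult_def scaleR_sum_right algebra_simps sum.distrib)
  then show ?thesis by (simp add: bilinear_conv_bounded_bilinear)
qed

lemmas matrix_mult_add = bounded_bilinear.add_left[OF bounded_bilinear_matrix_mult]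
  bounded_bilinear.add_right[OF bounded_bilinear_matrix_mult]

lemma linear_conj_transpose: "linear (conj_transpose :: complex^'n^'m \<Rightarrow> _)"
  by (rule linearI) (simp_all add: conj_transpose_def vec_eq_iff)

lemma linear_transpose: "linear (transpose :: complex^'n^'m \<Rightarrow> _)"
  by (rule linearI) (simp_all add: transpose_def vec_eq_iff)

lemma conj_transpose_mult: "conj_transpose (A ** B) = conj_transpose B ** conj_transpose A"
  by (simp add: conj_transpose_def matrix_matrix_mult_def vec_eq_iff mult.commute)

lemma conj_transpose_invol [simp]: "conj_transpose (conj_transpose A) = A"
  by (simp add: conj_transpose_def vec_eq_iff)

lemma conj_transpose_mat_1 [simp]: "conj_transpose (mat 1) = mat 1"
  by (simp add: conj_transpose_def vec_eq_iff mat_def)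

lemma inner_matrix: "x \<bullet> y = Re (\<Sum>i\<in>UNIV. (conj_transpose x ** y) $ i $ i)" for x y :: "complex^'n^'m"
proof -
  have "x \<bullet> y = (\<Sum>i\<in>UNIV. \<Sum>j\<in>UNIV. Re (cnj (x $ i $ j) * y $ i $ j))"
    by (simp add: inner_vec_def inner_complex_def)
  also have "\<dots> = (\<Sum>j\<in>UNIV. \<Sum>i\<in>UNIV. Re (cnj (x $ i $ j) * y $ i $ j))" by (rule sum.swap)
  finally show ?thesis by (simp add: matrix_matrix_mult_def conj_transpose_def)
qed

lemma inner_conj_transpose: "conj_transpose x \<bullet> conj_transpose y = x \<bullet> y"
  by (simp add: inner_vec_def inner_complex_def conj_transpose_def) (rule sum.swap)

lemma unitary_norm_left:
  fixes x :: "complex^'n^'m"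
  assumes "conj_transpose g ** g = mat 1"
  shows "norm (g ** x) = norm x"
proof -
  have "conj_transpose (g ** x) ** (g ** x) = conj_transpose x ** ((conj_transpose g ** g) ** x)"
    by (simp only: conj_transpose_mult matrix_mul_assoc)
  then show ?thesis unfolding norm_eq_sqrt_inner inner_matrix by (simp add: assms)
qed

lemma unitary_norm_right:
  fixes x g :: "complex^'n^'n"
  assumes "conj_transpose g ** g = mat 1"
  shows "norm (x ** g) = norm x"
proof -
  have "g ** conj_transpose g = mat 1" using assms matrix_left_right_inverse by blast
  then have "norm (conj_transpose g ** conj_transpose x) = norm (conj_transpose x)"
    by (intro unitary_norm_left) simp
  then show ?thesis
    unfolding conj_transpose_mult[symmetric] by (simp add: norm_eq_sqrt_inner inner_conj_transpose)
qed

lemma Sp_one: "mat 1 \<in> Sp"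
  by (simp add: Sp_def)

lemma Sp_mult: "g \<in> Sp \<Longrightarrow> h \<in> Sp \<Longrightarrow> g ** h \<in> Sp"
proof -
  assume g: "g \<in> Sp" and h: "h \<in> Sp"
  have "conj_transpose (g ** h) ** (g ** h) = conj_transpose h ** (conj_transpose g ** g) ** h"
    by (simp only: conj_transpose_mult matrix_mul_assoc)
  moreover have "transpose (g ** h) ** symp_J ** (g ** h) = transpose h ** (transpose g ** symp_J ** g) ** h"
    by (simp only: matrix_transpose_mul matrix_mul_assoc)
  ultimately show ?thesis using g h by (simp add: Sp_def)
qed

lemma Sp_unitary: "g \<in> Sp \<Longrightarrow> conj_transpose g ** g = mat 1" "g \<in> Sp \<Longrightarrow> g ** conj_transpose g = mat 1"
  using matrix_left_right_inverse by (auto simp: Sp_def)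

lemma Sp_inverse: assumes "g \<in> Sp" shows "conj_transpose g \<in> Sp"
proof -
  have g: "g ** conj_transpose g = mat 1" "transpose g ** symp_J ** g = symp_J"
    using assms Sp_unitary by (auto simp: Sp_def)
  have "transpose (conj_transpose g) ** symp_J ** conj_transpose g =
     transpose (conj_transpose g) ** (transpose g ** symp_J ** g) ** conj_transpose g"
    by (simp add: g)
  also have "\<dots> = transpose (g ** conj_transpose g) ** symp_J ** (g ** conj_transpose g)"
    by (simp add: matrix_transpose_mul matrix_mul_assoc)
  finally show ?thesis by (simp add: g Sp_def)
qed

lemma Sp_compact: "compact (Sp :: (complex^('l::finite + 'l)^('l + 'l)) set)"
proof -
  have "bounded (Sp :: (complex^('l + 'l)^('l + 'l)) set)"
  proof (rule boundedI)
    fix g :: "complex^('l + 'l)^('l + 'l)" assume "g \<in> Sp"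
    then show "norm g \<le> norm (mat 1 :: complex^('l + 'l)^('l + 'l))"
      using unitary_norm_left[of g "mat 1"] Sp_unitary(1)[of g] by (simp add: matrix_mul_rid)
  qed
  moreover have "closed (Sp :: (complex^('l + 'l)^('l + 'l)) set)"
  proof -
    have c: "continuous_on UNIV (conj_transpose :: complex^('l + 'l)^('l + 'l) \<Rightarrow> _)"
      "continuous_on UNIV (transpose :: complex^('l + 'l)^('l + 'l) \<Rightarrow> _)"
      by (auto intro!: linear_continuous_on simp: linear_conv_bounded_linear[symmetric] linear_conj_transpose linear_transpose)
    note mm = bounded_bilinear.continuous_on[OF bounded_bilinear_matrix_mult]
    show ?thesis unfolding Sp_def
      by (intro closed_Collect_conj closed_Collect_eq mm c continuous_on_const continuous_on_id)
  qed
  ultimately show ?thesis by (simp add: compact_eq_bounded_closed)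
qed

text \<open>\<open>L\<close> stands for the transpose or the conjugate transpose, and
  \<open>B\<close> for the symplectic form or the identity, so both equations of the group are
  handled together. With E the exponential, the derivative of L(E) B E is L(E) (L(X) B + B X) E,
  which is zero.\<close>

lemma mexp_form_const:
  fixes X :: "complex^'n^'n" and B :: "complex^'n^'n"
  assumes "bounded_linear L" "L X ** B + B ** X = 0"
    "\<And>P Q. L (P ** Q) = L Q ** L P" "L (mat 1) = mat 1"
  shows "L (mexp (t *\<^sub>R X)) ** B ** mexp (t *\<^sub>R X) = B"
proof -
  let ?E = "\<lambda>t. mexp (t *\<^sub>R X)"
  note mm = bounded_bilinear.has_vector_derivative[OF bounded_bilinear_matrix_mult]
  have "((\<lambda>t. L (?E t) ** B ** ?E t) has_vector_derivative 0) (at t)" for t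
  proof -
    have "((\<lambda>t. L (?E t)) has_vector_derivative L (X ** ?E t)) (at t)"
      by (rule bounded_linear.has_vector_derivative[OF assms(1) mexp_has_vector_derivative])
    from mm[OF mm[OF this has_vector_derivative_const[of B]] mexp_has_vector_derivative[of X t]]
    have *: "((\<lambda>t. L (?E t) ** B ** ?E t) has_vector_derivative
      (L (?E t) ** B ** (X ** ?E t) + (L (?E t) ** 0 + L (X ** ?E t) ** B) ** ?E t)) (at t)" .
    have "L (?E t) ** B ** (X ** ?E t) + (L (?E t) ** 0 + L (X ** ?E t) ** B) ** ?E t =
      L (?E t) ** (L X ** B + B ** X) ** ?E t"
      by (simp add: assms(3) matrix_mul_assoc matrix_mult_add add.commute)
    with * show ?thesis by (simp add: assms(2))
  qed
  then obtain c where c: "\<And>t. L (?E t) ** B ** ?E t = c"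
    using has_vector_derivative_zero_constant[of UNIV "\<lambda>t. L (?E t) ** B ** ?E t"] by auto
  from c[of 0] have "c = B" by (simp add: assms(4))
  with c show ?thesis by simp
qed

lemma mexp_form_deriv:
  fixes X :: "complex^'n^'n" and B :: "complex^'n^'n"
  assumes "bounded_linear L" "L (mat 1) = mat 1" "\<And>t::real. L (mexp (t *\<^sub>R X)) ** B ** mexp (t *\<^sub>R X) = B"
  shows "L X ** B + B ** X = 0"
proof -
  let ?E = "\<lambda>t. mexp (t *\<^sub>R X)"
  note mm = bounded_bilinear.has_vector_derivative[OF bounded_bilinear_matrix_mult]
  have "((\<lambda>t. L (?E t)) has_vector_derivative L (X ** ?E 0)) (at 0)"
    by (rule bounded_linear.has_vector_derivative[OF assms(1) mexp_has_vector_derivative])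
  from mm[OF mm[OF this has_vector_derivative_const[of B]] mexp_has_vector_derivative[of X 0]]
  have "((\<lambda>t. B) has_vector_derivative
      (L (?E 0) ** B ** (X ** ?E 0) + (L (?E 0) ** 0 + L (X ** ?E 0) ** B) ** ?E 0)) (at 0)"
    unfolding assms(3) .
  from vector_derivative_unique_at[OF this has_vector_derivative_const] show ?thesis
    by (simp add: assms(2) add.commute)
qed

lemma bounded_linear_conj_transpose: "bounded_linear (conj_transpose :: complex^'n^'m \<Rightarrow> _)"
  using linear_conj_transpose linear_conv_bounded_linear by blast

lemma bounded_linear_transpose: "bounded_linear (transpose :: complex^'n^'m \<Rightarrow> _)"
  using linear_transpose linear_conv_bounded_linear by blast

lemma lie_algebra_Sp:
  "lie_algebra Sp = {X. conj_transpose X = - X \<and> transpose X ** symp_J + symp_J ** X = 0}"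
proof (intro equalityI subsetI)
  fix X assume "X \<in> lie_algebra Sp"
  then have E: "mexp (t *\<^sub>R X) \<in> Sp" for t by (simp add: lie_algebra_def)
  have "conj_transpose X ** mat 1 + mat 1 ** X = 0"
    by (rule mexp_form_deriv[OF bounded_linear_conj_transpose]) (use E in \<open>simp_all add: Sp_def\<close>)
  moreover have "transpose X ** symp_J + symp_J ** X = 0"
    by (rule mexp_form_deriv[OF bounded_linear_transpose]) (use E in \<open>simp_all add: Sp_def\<close>)
  ultimately show "X \<in> {X. conj_transpose X = - X \<and> transpose X ** symp_J + symp_J ** X = 0}"
    by (simp add: eq_neg_iff_add_eq_0)
next
  fix X :: "complex^('a + 'a)^('a + 'a)"
  assume "X \<in> {X. conj_transpose X = - X \<and> transpose X ** symp_J + symp_J ** X = 0}"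
  then have X: "conj_transpose X ** mat 1 + mat 1 ** X = 0" "transpose X ** symp_J + symp_J ** X = 0" by auto
  have "conj_transpose (mexp (t *\<^sub>R X)) ** mat 1 ** mexp (t *\<^sub>R X) = mat 1" for t
    by (rule mexp_form_const[OF bounded_linear_conj_transpose X(1)]) (auto simp: conj_transpose_mult)
  moreover have "transpose (mexp (t *\<^sub>R X)) ** symp_J ** mexp (t *\<^sub>R X) = symp_J" for t
    by (rule mexp_form_const[OF bounded_linear_transpose X(2)]) (auto simp: matrix_transpose_mul)
  ultimately show "X \<in> lie_algebra Sp" by (simp add: lie_algebra_def Sp_def)
qed

section \<open>Smooth functions along flows\<close>

lemma frechet_derivative_eqI: "(F has_derivative D) (at x) \<Longrightarrow> frechet_derivative F (at x) v = D v"
  using frechet_derivative_at by metis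

lemma Ck_on_cong:
  assumes "open U" "\<And>x. x \<in> U \<Longrightarrow> F x = H x" "Ck_on k U F"
  shows "Ck_on k U H"
  using assms(2,3)
proof (induction k arbitrary: F H)
  case 0
  then show ?case using continuous_on_cong[of U U F H] by simp
next
  case (Suc k)
  have *: "frechet_derivative F (at x) = frechet_derivative H (at x)" if "x \<in> U" for x
    using Suc.prems assms(1) that by (intro frechet_derivative_transform_within_open[of F x U]) auto
  have "H differentiable at x" if "x \<in> U" for x
  proof -
    have "(F has_derivative frechet_derivative F (at x)) (at x)"
      using Suc.prems(2) that frechet_derivative_works by auto
    then have "(H has_derivative frechet_derivative F (at x)) (at x)"
      by (rule has_derivative_transform_within_open[OF _ assms(1) that]) (use Suc.prems(1) in auto)
    then show ?thesis by (auto simp: differentiable_def)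
  qed
  moreover have "Ck_on k U (\<lambda>x. frechet_derivative H (at x) v)" for v
    by (rule Suc.IH[of "\<lambda>x. frechet_derivative F (at x) v"]) (use * Suc.prems in auto)
  ultimately show ?case by simp
qed

lemma Ck_on_differentiable: "Ck_on (Suc k) U F \<Longrightarrow> x \<in> U \<Longrightarrow> F differentiable (at x)"
  by simp

lemma Ck_on_Suc_D: "Ck_on (Suc k) U F \<Longrightarrow> Ck_on k U F"
proof (induction k arbitrary: F)
  case 0
  then show ?case
    by (auto intro!: continuous_at_imp_continuous_on differentiable_imp_continuous_within)
next
  case (Suc k)
  from Suc.prems have "\<forall>x\<in>U. F differentiable (at x)"
    "\<And>v. Ck_on (Suc k) U (\<lambda>x. frechet_derivative F (at x) v)"
    unfolding Ck_on.simps(2)[of "Suc k" U F] by blast+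
  with Suc.IH show ?case unfolding Ck_on.simps(2)[of k U F] by blast
qed

lemma Ck_on_add:
  assumes "open U" "Ck_on k U F" "Ck_on k U H"
  shows "Ck_on k U (\<lambda>x. F x + H x)"
  using assms(2,3)
proof (induction k arbitrary: F H)
  case 0
  then show ?case by (auto intro: continuous_on_add)
next
  case (Suc k)
  have D: "((\<lambda>x. F x + H x) has_derivative (\<lambda>v. frechet_derivative F (at x) v + frechet_derivative H (at x) v)) (at x)"
    if "x \<in> U" for x
    using Suc.prems that by (auto intro!: has_derivative_add simp: frechet_derivative_works[symmetric])
  have "Ck_on k U (\<lambda>x. frechet_derivative (\<lambda>x. F x + H x) (at x) v)" for v
    by (rule Ck_on_cong[OF assms(1) _ Suc.IH[of "\<lambda>x. frechet_derivative F (at x) v" "\<lambda>x. frechet_derivative H (at x) v"]])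
      (use Suc.prems in \<open>auto simp: frechet_derivative_eqI[OF D]\<close>)
  then show ?case using Suc.prems by auto
qed

lemma Ck_on_zero: "Ck_on k U (\<lambda>x. 0)"
  by (induction k) (auto simp: frechet_derivative_const)

lemma Ck_on_sum:
  assumes "open U" "\<And>i. i \<in> I \<Longrightarrow> Ck_on k U (F i)"
  shows "Ck_on k U (\<lambda>x. \<Sum>i\<in>I. F i x)"
  using assms(2)
  by (induction I rule: infinite_finite_induct) (auto simp: Ck_on_zero intro: Ck_on_add[OF assms(1)])

lemma Ck_on_scaleR:
  assumes "open U" "Ck_on k U F"
  shows "Ck_on k U (\<lambda>x. c *\<^sub>R F x)"
  using assms(2)
proof (induction k arbitrary: F)
  case 0
  then show ?case by (auto intro: continuous_intros)
next
  case (Suc k)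
  have D: "((\<lambda>x. c *\<^sub>R F x) has_derivative (\<lambda>v. c *\<^sub>R frechet_derivative F (at x) v)) (at x)" if "x \<in> U" for x
    using Suc.prems that by (auto intro!: has_derivative_scaleR_right simp: frechet_derivative_works[symmetric])
  have "Ck_on k U (\<lambda>x. frechet_derivative (\<lambda>x. c *\<^sub>R F x) (at x) v)" for v
    by (rule Ck_on_cong[OF assms(1) _ Suc.IH[of "\<lambda>x. frechet_derivative F (at x) v"]])
      (use Suc.prems in \<open>auto simp: frechet_derivative_eqI[OF D]\<close>)
  then show ?case using D by (auto simp: differentiable_def)
qed

lemma Ck_on_linear_scaleR:
  assumes "open U" "bounded_linear l" "Ck_on k U F"
  shows "Ck_on k U (\<lambda>x. l x *\<^sub>R F x)"
  using assms(3)
proof (induction k arbitrary: F)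
  case 0
  then show ?case using assms(2) by (auto intro: continuous_intros linear_continuous_on)
next
  case (Suc k)
  have D: "((\<lambda>x. l x *\<^sub>R F x) has_derivative (\<lambda>v. l x *\<^sub>R frechet_derivative F (at x) v + l v *\<^sub>R F x)) (at x)" if "x \<in> U" for x
    using Suc.prems that bounded_linear_imp_has_derivative[OF assms(2)]
    by (auto intro!: has_derivative_scaleR simp: frechet_derivative_works[symmetric])
  have "Ck_on k U (\<lambda>x. frechet_derivative (\<lambda>x. l x *\<^sub>R F x) (at x) v)" for v
    by (rule Ck_on_cong[OF assms(1) _ Ck_on_add[OF assms(1) Suc.IH[of "\<lambda>x. frechet_derivative F (at x) v"]
          Ck_on_scaleR[OF assms(1) Ck_on_Suc_D[OF Suc.prems], of "l v"]]])
      (use Suc.prems in \<open>auto simp: frechet_derivative_eqI[OF D]\<close>)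
  then show ?case using D by (auto simp: differentiable_def)
qed

text \<open>\<open>Ck_on\<close> controls derivatives in constant directions only. A direction
  depending linearly on the point is expanded in the basis, with linear functions as
  coefficients.\<close>

lemma Ck_on_deriv_along:
  fixes F :: "'a::euclidean_space \<Rightarrow> 'b::real_normed_vector"
  assumes "open U" "bounded_linear l" "Ck_on (Suc k) U F"
  shows "Ck_on k U (\<lambda>x. frechet_derivative F (at x) (l x))"
proof (rule Ck_on_cong[OF assms(1)])
  show "Ck_on k U (\<lambda>x. \<Sum>b\<in>Basis. (l x \<bullet> b) *\<^sub>R frechet_derivative F (at x) b)"
    using assms by (intro Ck_on_sum Ck_on_linear_scaleR bounded_linear_inner_left_comp) auto
  fix x assume "x \<in> U"
  then have "linear (frechet_derivative F (at x))"
    using assms(3) by (auto intro: linear_frechet_derivative)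
  then show "(\<Sum>b\<in>Basis. (l x \<bullet> b) *\<^sub>R frechet_derivative F (at x) b) = frechet_derivative F (at x) (l x)"
    by (subst (2) euclidean_representation[symmetric]) (simp only: linear_sum linear_scale)
qed

lemma smooth_onE:
  assumes "smooth_on S f" "x \<in> S"
  obtains U F where "open U" "x \<in> U" "\<And>k. Ck_on k U F" "\<And>y. y \<in> U \<inter> S \<Longrightarrow> F y = f y"
proof -
  from assms have "\<exists>U F. open U \<and> x \<in> U \<and> (\<forall>k. Ck_on k U F) \<and> (\<forall>y\<in>U \<inter> S. F y = f y)"
    unfolding smooth_on_def by (rule bspec)
  then obtain U F where "open U \<and> x \<in> U \<and> (\<forall>k. Ck_on k U F) \<and> (\<forall>y\<in>U \<inter> S. F y = f y)"
    by (elim exE)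
  then show ?thesis by (intro that[of U F]) auto
qed

lemma smooth_on_continuous: "smooth_on S f \<Longrightarrow> continuous_on S f"
  unfolding continuous_on_eq_continuous_within
proof
  fix x assume "smooth_on S f" and x: "x \<in> S"
  then obtain U F where U: "open U" "x \<in> U" "\<And>k. Ck_on k U F" "\<And>y. y \<in> U \<inter> S \<Longrightarrow> F y = f y"
    by (rule smooth_onE) blast
  have "isCont F x"
    using U(3)[of 0] U(1,2) by (simp add: continuous_on_eq_continuous_at)
  then have "continuous (at x within S) F"
    by (rule continuous_at_imp_continuous_at_within)
  then show "continuous (at x within S) f"
    by (rule continuous_transform_within_openin[of _ _ _ "U \<inter> S"])
      (use U x in \<open>auto simp: openin_open\<close>)
qed

section \<open>Left-invariant derivatives on the group\<close>

lemma flow_has_vector_derivative: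
  "((\<lambda>t. x ** mexp (t *\<^sub>R X)) has_vector_derivative (x ** mexp (s *\<^sub>R X)) ** X) (at s)"
proof -
  have "bounded_linear ((**) x)"
    using bounded_bilinear.bounded_linear_right[OF bounded_bilinear_matrix_mult] by blast
  from bounded_linear.has_vector_derivative[OF this mexp_has_vector_derivative]
  show ?thesis by (simp add: mexp_commute matrix_mul_assoc)
qed

text \<open>\<open>f\<close> may behave arbitrarily off \<open>S\<close>. The curve stays in
  \<open>S\<close>, so near time \<open>s\<close> the values of \<open>f\<close> along it are those
  of the differentiable extension \<open>F\<close>.\<close>

lemma flow_deriv_local:
  assumes "\<And>t. x ** mexp (t *\<^sub>R X) \<in> S" and "open U" "x ** mexp (s *\<^sub>R X) \<in> U"
    and "F differentiable (at (x ** mexp (s *\<^sub>R X)))" "\<And>y. y \<in> U \<inter> S \<Longrightarrow> F y = f y"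
  shows "((\<lambda>t. f (x ** mexp (t *\<^sub>R X))) has_vector_derivative
    frechet_derivative F (at (x ** mexp (s *\<^sub>R X))) ((x ** mexp (s *\<^sub>R X)) ** X)) (at s)"
proof -
  let ?g = "\<lambda>t. x ** mexp (t *\<^sub>R X)" and ?D = "frechet_derivative F (at (x ** mexp (s *\<^sub>R X)))"
  have "(F has_derivative ?D) (at (?g s))" using assms(4) frechet_derivative_works by blast
  then have "((\<lambda>t. F (?g t)) has_derivative (\<lambda>t. ?D (t *\<^sub>R (?g s ** X)))) (at s)"
    by (rule has_derivative_compose[OF flow_has_vector_derivative[of x X s, unfolded has_vector_derivative_def]])
  moreover have "?D (t *\<^sub>R v) = t *\<^sub>R ?D v" for t v
    using linear_frechet_derivative[OF assms(4)] by (rule linear_scale)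
  ultimately have *: "((\<lambda>t. F (?g t)) has_vector_derivative ?D (?g s ** X)) (at s)"
    by (simp add: has_vector_derivative_def)
  have "continuous_on UNIV ?g"
    by (intro continuous_at_imp_continuous_on ballI has_vector_derivative_continuous[OF flow_has_vector_derivative])
  then have "open (?g -` U)" using assms(2) by (simp add: continuous_on_open_vimage)
  then show ?thesis
    by (rule has_vector_derivative_transform_within_open[OF *]) (use assms in auto)
qed

lemma left_inv_deriv_local:
  assumes "\<And>t. x ** mexp (t *\<^sub>R X) \<in> S" and "open U" "x \<in> U"
    and "F differentiable (at x)" "\<And>y. y \<in> U \<inter> S \<Longrightarrow> F y = f y"
  shows "left_inv_deriv X f x = frechet_derivative F (at x) (x ** X)"
  using flow_deriv_local[of x X S U 0 F f] assms
  unfolding left_inv_deriv_def by (auto intro!: vector_derivative_at)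

lemma Sp_flow: "x \<in> Sp \<Longrightarrow> X \<in> lie_algebra Sp \<Longrightarrow> x ** mexp (t *\<^sub>R X) \<in> Sp"
  by (intro Sp_mult) (simp_all add: lie_algebra_def)

lemma bounded_linear_mult_right: "bounded_linear (\<lambda>x :: complex^'n^'n. x ** X)"
  using bounded_bilinear.bounded_linear_left[OF bounded_bilinear_matrix_mult] by blast

lemma smooth_flow_deriv:
  assumes "smooth_on Sp f" "x \<in> Sp" "X \<in> lie_algebra Sp"
  shows "((\<lambda>t. f (x ** mexp (t *\<^sub>R X))) has_vector_derivative left_inv_deriv X f (x ** mexp (s *\<^sub>R X))) (at s)"
proof -
  let ?y = "x ** mexp (s *\<^sub>R X)"
  have y: "?y \<in> Sp" using Sp_flow assms by blast
  from assms(1) y obtain U F where U: "open U" "?y \<in> U" "\<And>k. Ck_on k U F" "\<And>z. z \<in> U \<inter> Sp \<Longrightarrow> F z = f z"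
    by (rule smooth_onE) blast
  from U(3,2) have d: "F differentiable (at ?y)" by (rule Ck_on_differentiable)
  from flow_deriv_local[OF Sp_flow[OF assms(2,3)] U(1,2) d U(4)]
    left_inv_deriv_local[OF Sp_flow[OF y assms(3)] U(1,2) d U(4)] show ?thesis by simp
qed

lemma smooth_left_inv_deriv:
  assumes "smooth_on Sp f" "X \<in> lie_algebra Sp"
  shows "smooth_on Sp (left_inv_deriv X f)"
  unfolding smooth_on_def
proof
  fix x :: "complex^('a + 'a)^('a + 'a)" assume "x \<in> Sp"
  with assms(1) obtain U F where U: "open U" "x \<in> U" "\<And>k. Ck_on k U F" "\<And>z. z \<in> U \<inter> Sp \<Longrightarrow> F z = f z"
    by (rule smooth_onE) blast
  have "Ck_on k U (\<lambda>x. frechet_derivative F (at x) (x ** X))" for k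
    by (rule Ck_on_deriv_along[OF U(1) bounded_linear_mult_right U(3)])
  moreover have "frechet_derivative F (at y) (y ** X) = left_inv_deriv X f y" if "y \<in> U \<inter> Sp" for y
  proof -
    have "F differentiable (at y)" using Ck_on_differentiable[OF U(3)] that by blast
    then show ?thesis
      using left_inv_deriv_local[OF Sp_flow[OF _ assms(2)] U(1) _ _ U(4), of y] that by auto
  qed
  ultimately show "\<exists>V H. open V \<and> x \<in> V \<and> (\<forall>k. Ck_on k V H) \<and> (\<forall>y\<in>V \<inter> Sp. H y = left_inv_deriv X f y)"
    using U(1,2) by blast
qed

lemma polyfun_Ck_on: "polyfun p \<Longrightarrow> Ck_on k U p"
proof (induction k arbitrary: p)
  case 0
  then show ?case
    by (auto intro!: continuous_at_imp_continuous_on differentiable_imp_continuous_within polyfun_differentiable)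
next
  case (Suc k)
  then show ?case
    by (auto intro!: Suc.IH polyfun_frechet polyfun_const simp: polyfun_differentiable)
qed

lemma pev_smooth: "smooth_on S (pev p)"
  unfolding smooth_on_def using polyfun_Ck_on[OF polyfun_pev] open_UNIV by blast

lemma left_inv_deriv_pev: "left_inv_deriv X (pev p) = pev (Der X p)"
proof
  fix x
  show "left_inv_deriv X (pev p) x = pev (Der X p) x"
    unfolding pev_Der
    by (rule left_inv_deriv_local[of x X UNIV UNIV]) (auto simp: polyfun_differentiable[OF polyfun_pev])
qed

section \<open>The Killing form and the Casimir tensor\<close>

text \<open>The basis chosen inside \<open>trace_on\<close> is arbitrary. Images are expanded in
  \<open>D\<close> by inner products and elements of \<open>D\<close> in the chosen basis by
  \<open>representation\<close>; summing over that basis first reassembles the elements of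
  \<open>D\<close>.\<close>

lemma trace_on_orthonormal:
  fixes V :: "'a::euclidean_space set"
  assumes D: "finite D" "span D = V" "\<And>x y. x \<in> D \<Longrightarrow> y \<in> D \<Longrightarrow> x \<bullet> y = (if x = y then 1 else 0)"
    and T: "linear T" "\<And>v. v \<in> V \<Longrightarrow> T v \<in> V"
  shows "trace_on V T = (\<Sum>c\<in>D. T c \<bullet> c)"
proof -
  define B where "B = (SOME B. basis_of V B)"
  have "\<exists>B. basis_of V B"
    using basis_exists[of V] D(2) span_subspace unfolding basis_of_def by (metis subspace_span)
  then have "basis_of V B" unfolding B_def by (rule someI_ex)
  then have B: "independent B" "span B = V" by (auto simp: basis_of_def)
  then have "finite B" using finiteI_independent by blast
  have expand: "v = (\<Sum>c\<in>D. (v \<bullet> c) *\<^sub>R c)" if "v \<in> V" for v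
  proof -
    have "pairwise orthogonal D" by (auto simp: pairwise_def orthogonal_def D(3))
    then show ?thesis
      using orthonormal_basis_expand[of D v] that D by (simp add: norm_eq_1)
  qed
  have DV: "c \<in> V" if "c \<in> D" for c using that D(2) span_base by blast
  have rep: "representation B (\<Sum>c\<in>D. r c *\<^sub>R f c) b = (\<Sum>c\<in>D. r c * representation B (f c) b)"
    if "\<And>c. c \<in> D \<Longrightarrow> f c \<in> V" for r f b
  proof -
    have f: "f c \<in> span B" if "c \<in> D" for c using B \<open>\<And>c. c \<in> D \<Longrightarrow> f c \<in> V\<close> that by blast
    then have "representation B (\<Sum>c\<in>D. r c *\<^sub>R f c) = (\<lambda>b. \<Sum>c\<in>D. representation B (r c *\<^sub>R f c) b)"
      by (intro representation_sum[OF B(1)] span_scale)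
    then show ?thesis by (simp add: representation_scale[OF B(1) f])
  qed
  have "trace_on V T = (\<Sum>b\<in>B. representation B (T b) b)"
    by (simp add: trace_on_def B_def Let_def)
  also have "\<dots> = (\<Sum>b\<in>B. \<Sum>c\<in>D. (b \<bullet> c) * (\<Sum>c'\<in>D. (T c \<bullet> c') * representation B c' b))"
  proof (rule sum.cong[OF refl])
    fix b assume "b \<in> B"
    then have "b \<in> V" using B span_base by blast
    have "T b = (\<Sum>c\<in>D. (b \<bullet> c) *\<^sub>R T c)"
      by (subst expand[OF \<open>b \<in> V\<close>]) (simp add: linear_sum[OF T(1)] linear_scale[OF T(1)])
    then have "representation B (T b) b = (\<Sum>c\<in>D. (b \<bullet> c) * representation B (T c) b)"
      using rep T(2) DV by simp
    also have "\<dots> = (\<Sum>c\<in>D. (b \<bullet> c) * (\<Sum>c'\<in>D. (T c \<bullet> c') * representation B c' b))"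
    proof (intro sum.cong refl arg_cong2[where f = "(*)"])
      fix c assume "c \<in> D"
      show "representation B (T c) b = (\<Sum>c'\<in>D. (T c \<bullet> c') * representation B c' b)"
        by (subst expand[OF T(2)[OF DV[OF \<open>c \<in> D\<close>]]]) (rule rep[OF DV])
    qed
    finally show "representation B (T b) b = (\<Sum>c\<in>D. (b \<bullet> c) * (\<Sum>c'\<in>D. (T c \<bullet> c') * representation B c' b))" .
  qed
  also have "\<dots> = (\<Sum>c\<in>D. \<Sum>c'\<in>D. (T c \<bullet> c') * (\<Sum>b\<in>B. representation B c' b * (b \<bullet> c)))"
    unfolding sum_distrib_left
    by (subst sum.swap, rule sum.cong[OF refl], subst sum.swap) (simp add: mult_ac)
  also have "\<dots> = (\<Sum>c\<in>D. \<Sum>c'\<in>D. (T c \<bullet> c') * (c' \<bullet> c))"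
  proof (intro sum.cong refl arg_cong2[where f = "(*)"])
    fix c c' assume "c' \<in> D"
    have "(\<Sum>b\<in>B. representation B c' b *\<^sub>R b) = c'"
      using B \<open>finite B\<close> DV[OF \<open>c' \<in> D\<close>] by (intro sum_representation_eq) auto
    then show "(\<Sum>b\<in>B. representation B c' b * (b \<bullet> c)) = c' \<bullet> c"
      by (metis (no_types, lifting) inner_sum_left inner_scaleR_left sum.cong)
  qed
  also have "\<dots> = (\<Sum>c\<in>D. T c \<bullet> c)"
  proof (rule sum.cong[OF refl])
    fix c assume "c \<in> D"
    have "(\<Sum>c'\<in>D. (T c \<bullet> c') * (c' \<bullet> c)) = (\<Sum>c'\<in>D. if c' = c then T c \<bullet> c else 0)"
      by (rule sum.cong[OF refl]) (auto simp: D(3) \<open>c \<in> D\<close>)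
    also have "\<dots> = T c \<bullet> c" using \<open>c \<in> D\<close> D(1) by simp
    finally show "(\<Sum>c'\<in>D. (T c \<bullet> c') * (c' \<bullet> c)) = T c \<bullet> c" .
  qed
  finally show ?thesis .
qed

lemma symp_J_mult_left: "(symp_J ** X) $ p $ q = sg p * X $ bar p $ q"
proof (cases p)
  case (Inl i)
  have "(\<Sum>k\<in>UNIV. symp_J $ p $ k * X $ k $ q) = (\<Sum>k\<in>UNIV. if k = bar p then X $ k $ q else 0)"
    by (rule sum.cong[OF refl]) (auto simp: symp_J_def Inl split: sum.split)
  then show ?thesis by (simp add: matrix_matrix_mult_def Inl)
next
  case (Inr i)
  have "(\<Sum>k\<in>UNIV. symp_J $ p $ k * X $ k $ q) = (\<Sum>k\<in>UNIV. if k = bar p then - X $ k $ q else 0)"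
    by (rule sum.cong[OF refl]) (auto simp: symp_J_def Inr split: sum.split)
  then show ?thesis by (simp add: matrix_matrix_mult_def Inr)
qed

lemma symp_J_mult_right: "(transpose X ** symp_J) $ p $ q = - (sg q * X $ bar q $ p)"
proof -
  have "symp_J $ k $ q = - symp_J $ q $ k" for k
    by (auto simp: symp_J_def split: sum.split)
  then have "(transpose X ** symp_J) $ p $ q = - ((symp_J ** X) $ q $ p)"
    by (simp add: transpose_def matrix_matrix_mult_def sum_negf mult.commute)
  then show ?thesis by (simp add: symp_J_mult_left)
qed

lemma lie_algebra_Sp_entries:
  "X \<in> lie_algebra Sp \<longleftrightarrow> (\<forall>i j. X $ j $ i = - cnj (X $ i $ j)) \<and>
    (\<forall>a b. X $ bar b $ bar a = - (sg a * sg b * X $ a $ b))"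
proof -
  have "conj_transpose X = - X \<longleftrightarrow> (\<forall>i j. X $ j $ i = - cnj (X $ i $ j))"
    by (auto simp: conj_transpose_def vec_eq_iff complex_eq_iff)
  moreover have "transpose X ** symp_J + symp_J ** X = 0 \<longleftrightarrow> (\<forall>p q. sg p * X $ bar p $ q = sg q * X $ bar q $ p)"
    by (simp add: vec_eq_iff symp_J_mult_left symp_J_mult_right add_eq_0_iff)
  moreover have "(\<forall>p q. sg p * X $ bar p $ q = sg q * X $ bar q $ p) \<longleftrightarrow> (\<forall>a b. X $ bar b $ bar a = - (sg a * sg b * X $ a $ b))"
  proof (intro iffI allI)
    fix a b assume "\<forall>p q. sg p * X $ bar p $ q = sg q * X $ bar q $ p"
    then have "sg b * (sg b * X $ bar b $ bar a) = sg b * (sg (bar a) * X $ bar (bar a) $ b)" by metis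
    then show "X $ bar b $ bar a = - (sg a * sg b * X $ a $ b)" by (simp add: mult_ac)
  next
    fix p q assume "\<forall>a b. X $ bar b $ bar a = - (sg a * sg b * X $ a $ b)"
    then have "X $ bar p $ bar (bar q) = - (sg (bar q) * sg p * X $ bar q $ p)" by blast
    then show "sg p * X $ bar p $ q = sg q * X $ bar q $ p" by (simp add: mult_ac)
  qed
  ultimately show ?thesis unfolding lie_algebra_Sp by simp
qed

lemma lie_algebra_SpD:
  assumes "X \<in> lie_algebra Sp"
  shows "X $ j $ i = - cnj (X $ i $ j)" "X $ bar b $ bar a = - (sg a * sg b * X $ a $ b)"
  using assms unfolding lie_algebra_Sp_entries by blast+

lemma subspace_lie_algebra_Sp: "subspace (lie_algebra Sp)"
proof (rule subspaceI)
  note [simp] = linear_0[OF linear_conj_transpose] linear_0[OF linear_transpose]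
    linear_add[OF linear_conj_transpose] linear_add[OF linear_transpose]
    linear_scale[OF linear_conj_transpose] linear_scale[OF linear_transpose]
    matrix_mult_add matrix_mult_scaleR
  show "0 \<in> lie_algebra Sp" by (simp add: lie_algebra_Sp)
  show "X + Y \<in> lie_algebra Sp" if "X \<in> lie_algebra Sp" "Y \<in> lie_algebra Sp" for X Y :: "complex^('a + 'a)^('a + 'a)"
  proof -
    have "transpose (X + Y) ** symp_J + symp_J ** (X + Y) =
      (transpose X ** symp_J + symp_J ** X) + (transpose Y ** symp_J + symp_J ** Y)"
      by (simp add: add_ac)
    then have "transpose (X + Y) ** symp_J + symp_J ** (X + Y) = 0"
      using that by (simp only: lie_algebra_Sp mem_Collect_eq add_0)
    moreover have "conj_transpose (X + Y) = - (X + Y)" using that by (simp add: lie_algebra_Sp)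
    ultimately show ?thesis by (simp only: lie_algebra_Sp mem_Collect_eq simp_thms)
  qed
  show "c *\<^sub>R X \<in> lie_algebra Sp" if "X \<in> lie_algebra Sp" for c and X :: "complex^('a + 'a)^('a + 'a)"
    using that by (simp add: lie_algebra_Sp scaleR_add_right[symmetric])
qed

lemma sum_bar: "(\<Sum>a\<in>UNIV. f (bar a)) = sum f UNIV"
  by (rule sum.reindex_bij_betw[OF bij_bar])

lemma sum_bar2: "(\<Sum>a\<in>UNIV. \<Sum>b\<in>UNIV. f (bar b) (bar a)) = (\<Sum>a\<in>UNIV. \<Sum>b\<in>UNIV. f a b)"
  by (subst sum_bar[of "\<lambda>x. \<Sum>b\<in>UNIV. f (bar b) x"], subst sum.swap, subst sum_bar[of "\<lambda>x. \<Sum>b\<in>UNIV. f x b"]) simp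

text \<open>The orthogonal projection onto the Lie algebra: the average of \<open>u\<close> over the group generated by
  the two commuting involutions whose common fixed points are the Lie algebra.\<close>

definition lie_proj :: "complex^('l + 'l)^('l + 'l) \<Rightarrow> complex^('l::finite + 'l)^('l + 'l)" where
  "lie_proj u = (\<chi> a b. (u $ a $ b - cnj (u $ b $ a) - sg a * sg b * u $ bar b $ bar a +
    sg a * sg b * cnj (u $ bar a $ bar b)) / 4)"

lemma cnj_sg [simp]: "cnj (sg a) = sg a"
  by (cases a) auto

lemma lie_proj_in: "lie_proj u \<in> lie_algebra Sp"
  unfolding lie_algebra_Sp_entries
proof (intro conjI allI)
  fix i j a b :: "'a + 'a"
  show "lie_proj u $ j $ i = - cnj (lie_proj u $ i $ j)"
    by (simp add: lie_proj_def field_simps)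
  have s: "sg a * sg b * (sg a * sg b * z) = z" for z by (cases a; cases b) auto
  show "lie_proj u $ bar b $ bar a = - (sg a * sg b * lie_proj u $ a $ b)"
    unfolding lie_proj_def by (simp add: distrib_left right_diff_distrib s mult.commute[of "sg b" "sg a"] diff_divide_distrib add_divide_distrib)
qed

lemma inner_entries: "x \<bullet> y = Re (\<Sum>a\<in>UNIV. \<Sum>b\<in>UNIV. cnj (x $ a $ b) * y $ a $ b)"
  by (simp add: inner_vec_def inner_complex_def)

text \<open>By the two symmetries of \<open>X\<close> and a reindexing, each of the four terms of
  the projection contributes a quarter of the inner product with \<open>u\<close>.\<close>

lemma inner_lie_proj:
  assumes "X \<in> lie_algebra Sp"
  shows "X \<bullet> lie_proj u = X \<bullet> u"
proof -
  note X = lie_algebra_SpD[OF assms]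
  let ?S = "\<lambda>f. \<Sum>a\<in>UNIV. \<Sum>b\<in>UNIV. f a b"
  let ?t = "?S (\<lambda>a b. cnj (X $ a $ b) * u $ a $ b)"
  have e2: "?S (\<lambda>a b. cnj (X $ a $ b) * cnj (u $ b $ a)) = - cnj ?t"
  proof -
    have "?S (\<lambda>a b. cnj (X $ a $ b) * cnj (u $ b $ a)) = ?S (\<lambda>a b. - (X $ b $ a * cnj (u $ b $ a)))"
    proof (intro sum.cong refl)
      fix a b
      have "X $ b $ a = - cnj (X $ a $ b)" by (rule X(1))
      then show "cnj (X $ a $ b) * cnj (u $ b $ a) = - (X $ b $ a * cnj (u $ b $ a))" by simp
    qed
    also have "\<dots> = ?S (\<lambda>a b. - (X $ a $ b * cnj (u $ a $ b)))" by (rule sum.swap)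
    finally show ?thesis by (simp add: sum_negf)
  qed
  have e3: "?S (\<lambda>a b. cnj (X $ a $ b) * (sg a * sg b * u $ bar b $ bar a)) = - ?t"
  proof -
    have "?S (\<lambda>a b. cnj (X $ a $ b) * (sg a * sg b * u $ bar b $ bar a)) = ?S (\<lambda>a b. - (cnj (X $ bar b $ bar a) * u $ bar b $ bar a))"
      by (intro sum.cong refl) (simp add: X(2) mult_ac)
    also have "\<dots> = ?S (\<lambda>a b. - (cnj (X $ a $ b) * u $ a $ b))" by (rule sum_bar2)
    finally show ?thesis by (simp add: sum_negf)
  qed
  have e4: "?S (\<lambda>a b. cnj (X $ a $ b) * (sg a * sg b * cnj (u $ bar a $ bar b))) = cnj ?t"
  proof -
    have "?S (\<lambda>a b. cnj (X $ a $ b) * (sg a * sg b * cnj (u $ bar a $ bar b))) = ?S (\<lambda>a b. X $ bar a $ bar b * cnj (u $ bar a $ bar b))"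
    proof (intro sum.cong refl)
      fix a b
      have "X $ bar a $ bar b = - cnj (X $ bar b $ bar a)" by (rule X(1))
      also have "\<dots> = cnj (X $ a $ b) * (sg a * sg b)" by (simp add: X(2) mult_ac)
      finally show "cnj (X $ a $ b) * (sg a * sg b * cnj (u $ bar a $ bar b)) = X $ bar a $ bar b * cnj (u $ bar a $ bar b)"
        by simp
    qed
    also have "\<dots> = ?S (\<lambda>b a. X $ bar a $ bar b * cnj (u $ bar a $ bar b))" by (rule sum.swap)
    also have "\<dots> = ?S (\<lambda>a b. X $ a $ b * cnj (u $ a $ b))" by (rule sum_bar2)
    finally show ?thesis by simp
  qed
  have "?S (\<lambda>a b. cnj (X $ a $ b) * lie_proj u $ a $ b) = (?t - ?S (\<lambda>a b. cnj (X $ a $ b) * cnj (u $ b $ a))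
     - ?S (\<lambda>a b. cnj (X $ a $ b) * (sg a * sg b * u $ bar b $ bar a))
     + ?S (\<lambda>a b. cnj (X $ a $ b) * (sg a * sg b * cnj (u $ bar a $ bar b)))) / 4"
    unfolding sum.distrib[symmetric] sum_subtractf[symmetric] sum_divide_distrib lie_proj_def
    by (intro sum.cong refl) (simp add: algebra_simps add_divide_distrib diff_divide_distrib)
  then have "?S (\<lambda>a b. cnj (X $ a $ b) * lie_proj u $ a $ b) = (?t - (- cnj ?t) - (- ?t) + cnj ?t) / 4"
    unfolding e2 e3 e4 .
  moreover have "Re w = Re z" if "w = (z - (- cnj z) - (- z) + cnj z) / 4" for z w
    by (subst that) simp
  ultimately have "Re (?S (\<lambda>a b. cnj (X $ a $ b) * lie_proj u $ a $ b)) = Re ?t" by blast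
  then show ?thesis unfolding inner_entries .
qed

text \<open>Expanding the projection of a matrix unit in the orthonormal basis gives one coefficient
  of the Casimir tensor. The projection is known explicitly, so the tensor is as well.\<close>

lemma lie_tensor:
  fixes B :: "(complex^('l::finite + 'l)^('l + 'l)) set"
  assumes B: "finite B" "span B = lie_algebra Sp" "K > 0"
    "\<And>X Y. X \<in> B \<Longrightarrow> Y \<in> B \<Longrightarrow> K * (X \<bullet> Y) = (if X = Y then 1 else 0)"
  shows "(\<Sum>X\<in>B. X $ p $ q * cnj (X $ c $ d)) =
    (of_bool (c = p \<and> d = q) - sg p * sg q * of_bool (c = bar q \<and> d = bar p)) / (2 * of_real K)"
proof -
  have expand: "(\<Sum>X\<in>B. (K * (X \<bullet> v)) *\<^sub>R X) = v" if "v \<in> lie_algebra Sp" for v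
  proof -
    have "linear (\<lambda>v. \<Sum>X\<in>B. (K * (X \<bullet> v)) *\<^sub>R X)"
      by (intro linearI) (simp_all add: inner_add_right distrib_left scaleR_add_left sum.distrib scaleR_sum_right mult_ac)
    then show ?thesis
    proof (rule linear_eq_on_span[where g = "\<lambda>v. v" and B = B])
      fix Y assume "Y \<in> B"
      have "(\<Sum>X\<in>B. (K * (X \<bullet> Y)) *\<^sub>R X) = (\<Sum>X\<in>B. if X = Y then Y else 0)"
        by (rule sum.cong[OF refl]) (use B(4) \<open>Y \<in> B\<close> in auto)
      then show "(\<Sum>X\<in>B. (K * (X \<bullet> Y)) *\<^sub>R X) = Y" using \<open>Y \<in> B\<close> B(1) by simp
    qed (use that B(2) in \<open>auto simp: linear_id[unfolded id_def]\<close>)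
  qed
  have BL: "X \<in> lie_algebra Sp" if "X \<in> B" for X using span_base[OF that] B(2) by simp
  define U where "U z = (\<chi> i j. if i = c \<and> j = d then z else 0)" for z :: complex
  have U: "X \<bullet> U z = Re (cnj (X $ c $ d) * z)" for X z
  proof -
    have "(\<Sum>a\<in>UNIV. \<Sum>b\<in>UNIV. cnj (X $ a $ b) * U z $ a $ b) = (\<Sum>a\<in>UNIV. \<Sum>b\<in>UNIV. if c = a then (if b = d then cnj (X $ a $ b) * z else 0) else 0)"
      by (intro sum.cong refl) (auto simp: U_def)
    also have "\<dots> = cnj (X $ c $ d) * z" unfolding sum_sum_delta by simp
    finally show ?thesis unfolding inner_entries by simp
  qed
  have proj: "(\<Sum>X\<in>B. of_real (K * Re (cnj (X $ c $ d) * z)) * X $ p $ q) = lie_proj (U z) $ p $ q" for z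
  proof -
    have "(\<Sum>X\<in>B. (K * (X \<bullet> U z)) *\<^sub>R X) = lie_proj (U z)"
      using expand[OF lie_proj_in[of "U z"]] inner_lie_proj[OF BL] by simp
    then have "(\<Sum>X\<in>B. (K * (X \<bullet> U z)) *\<^sub>R X) $ p $ q = lie_proj (U z) $ p $ q" by simp
    then show ?thesis by (simp add: U sum_component scaleR_conv_of_real[where 'a = complex])
  qed
  \<comment> \<open>The inner product sees real parts only; the units 1 and \<i> together recover
    the complex coefficient, as cnj w = Re (cnj w) - \<i> Re (cnj w \<i>). In the same combination
    the conjugate-linear terms of the projection cancel.\<close>
  have eq1: "of_real K * (\<Sum>X\<in>B. X $ p $ q * cnj (X $ c $ d)) = lie_proj (U 1) $ p $ q - \<i> * lie_proj (U \<i>) $ p $ q"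
    unfolding proj[symmetric] sum_distrib_left sum_subtractf[symmetric]
  proof (intro sum.cong refl)
    fix X :: "complex^('l + 'l)^('l + 'l)"
    have "cnj (X $ c $ d) = of_real (Re (cnj (X $ c $ d) * 1)) - \<i> * of_real (Re (cnj (X $ c $ d) * \<i>))"
      by (simp add: complex_eq_iff)
    then have "of_real K * (X $ p $ q * cnj (X $ c $ d)) = of_real K * (X $ p $ q * (of_real (Re (cnj (X $ c $ d) * 1)) - \<i> * of_real (Re (cnj (X $ c $ d) * \<i>))))"
      by (rule arg_cong)
    then show "of_real K * (X $ p $ q * cnj (X $ c $ d)) =
      of_real (K * Re (cnj (X $ c $ d) * 1)) * X $ p $ q - \<i> * (of_real (K * Re (cnj (X $ c $ d) * \<i>)) * X $ p $ q)"
      by (simp add: algebra_simps)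
  qed
  have eq2: "lie_proj (U 1) $ p $ q - \<i> * lie_proj (U \<i>) $ p $ q =
    (of_bool (c = p \<and> d = q) - sg p * sg q * of_bool (c = bar q \<and> d = bar p)) / 2"
  proof -
    have P: "lie_proj (U z) $ p $ q = (of_bool (c = p \<and> d = q) * z - of_bool (c = q \<and> d = p) * cnj z
      - sg p * sg q * of_bool (c = bar q \<and> d = bar p) * z + sg p * sg q * of_bool (c = bar p \<and> d = bar q) * cnj z) / 4" for z
    proof -
      have U1: "U z $ i $ j = of_bool (c = i \<and> d = j) * z" for i j
        by (auto simp: U_def)
      have U2: "cnj (of_bool Q * z) = of_bool Q * cnj z" for Q by (cases Q) auto
      show ?thesis unfolding lie_proj_def by (simp only: vec_lambda_beta U1 U2 mult.assoc)
    qed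
    have alg: "(A1 * 1 - A2 * cnj 1 - s * A3 * 1 + s * A4 * cnj 1) / 4 - \<i> * ((A1 * \<i> - A2 * cnj \<i> - s * A3 * \<i> + s * A4 * cnj \<i>) / 4) = (A1 - s * A3) / 2"
      for A1 A2 A3 A4 s :: complex
    proof -
      have 1: "A1 * \<i> - A2 * cnj \<i> - s * A3 * \<i> + s * A4 * cnj \<i> = \<i> * (A1 + A2 - s * A3 - s * A4)"
        by (simp add: algebra_simps)
      have 2: "\<i> * (\<i> * W / 4) = - W / 4" for W by simp
      show ?thesis unfolding 1 2 by (simp add: diff_divide_distrib add_divide_distrib)
    qed
    show ?thesis unfolding P by (rule alg)
  qed
  have "A = N / (2 * k)" if "k * A = N / 2" "k \<noteq> 0" for A N k :: complex
    using that by (simp add: field_simps)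
  from this[OF trans[OF eq1 eq2]] show ?thesis using B(3) by simp
qed

text \<open>The tensor gives the factor 1 / (2K). The sign arises because skew-Hermitian matrices
  satisfy X_cd = - cnj X_dc, and another 1/2 because \<open>casimir\<close> meets each term of the
  double sum \<open>?T\<close> twice.\<close>

lemma casimir_lie_basis:
  fixes B :: "(complex^('l::finite + 'l)^('l + 'l)) set"
  assumes B: "finite B" "span B = lie_algebra Sp" "K > 0"
    "\<And>X Y. X \<in> B \<Longrightarrow> Y \<in> B \<Longrightarrow> K * (X \<bullet> Y) = (if X = Y then 1 else 0)"
  shows "(\<Sum>X\<in>B. Der X (Der X p)) = Const (- 1 / (4 * of_real K)) * casimir p"
proof -
  let ?S = "\<lambda>f. \<Sum>a\<in>UNIV. \<Sum>b\<in>UNIV. f a b"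
  let ?e = "\<lambda>a b. Der (munit a b)"
  have BL: "X \<in> lie_algebra Sp" if "X \<in> B" for X using span_base[OF that] B(2) by simp
  let ?T = "?S (\<lambda>a b. ?e a b (?e b a p) - Const (sg a * sg b) * ?e a b (?e (bar a) (bar b) p))"
  have "Der X (Der X p) = ?S (\<lambda>a b. ?S (\<lambda>c d. Const (X $ a $ b * X $ c $ d) * ?e a b (?e c d p)))" for X
    by (subst (2) Der_expand[of X], subst Der_expand[of X])
      (simp add: derivation_sum_arg[OF derivation_Der] derivationD[OF derivation_Der] sum_distrib_left mult.assoc)
  then have "(\<Sum>X\<in>B. Der X (Der X p)) = (\<Sum>X\<in>B. ?S (\<lambda>a b. ?S (\<lambda>c d. Const (X $ a $ b * X $ c $ d) * ?e a b (?e c d p))))"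
    by simp
  also have "\<dots> = ?S (\<lambda>a b. ?S (\<lambda>c d. Const (\<Sum>X\<in>B. X $ a $ b * X $ c $ d) * ?e a b (?e c d p)))"
    unfolding Const_sum sum_distrib_right
    by (subst sum.swap, rule sum.cong[OF refl], subst sum.swap, rule sum.cong[OF refl], subst sum.swap, rule sum.cong[OF refl], subst sum.swap, rule refl)
  also have "\<dots> = ?S (\<lambda>a b. Const (- 1 / (2 * of_real K)) * (?e a b (?e b a p) - Const (sg a * sg b) * ?e a b (?e (bar a) (bar b) p)))"
  proof (intro sum.cong refl)
    fix a b
    let ?k = "- 1 / (2 * complex_of_real K)"
    have "Const (\<Sum>X\<in>B. X $ a $ b * X $ c $ d) * ?e a b (?e c d p) =
      (if b = c then (if d = a then Const ?k * ?e a b (?e c d p) else 0) else 0) -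
      (if bar a = c then (if d = bar b then Const (?k * (sg a * sg b)) * ?e a b (?e c d p) else 0) else 0)" for c d
    proof -
      have "(\<Sum>X\<in>B. X $ a $ b * X $ c $ d) = (\<Sum>X\<in>B. - (X $ a $ b * cnj (X $ d $ c)))"
      proof (rule sum.cong[OF refl])
        fix X assume "X \<in> B"
        have "X $ c $ d = - cnj (X $ d $ c)" by (rule lie_algebra_SpD(1)[OF BL[OF \<open>X \<in> B\<close>]])
        then show "X $ a $ b * X $ c $ d = - (X $ a $ b * cnj (X $ d $ c))" by simp
      qed
      also have "\<dots> = ?k * (of_bool (d = a \<and> c = b) - sg a * sg b * of_bool (d = bar b \<and> c = bar a))"
        by (simp add: sum_negf lie_tensor[OF B])
      finally have *: "(\<Sum>X\<in>B. X $ a $ b * X $ c $ d) = ?k * of_bool (d = a \<and> c = b) - ?k * (sg a * sg b) * of_bool (d = bar b \<and> c = bar a)"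
        by (simp only: right_diff_distrib mult.assoc)
      have Cb: "Const (x * of_bool P - y * of_bool Q) * q = (if P then Const x * q else 0) - (if Q then Const y * q else 0)"
        for x y P Q and q :: "('l + 'l) cpol"
        by (cases P; cases Q) (simp_all add: left_diff_distrib)
      have "(if d = a \<and> c = b then u else 0) = (if b = c then if d = a then u else 0 else 0)"
        "(if d = bar b \<and> c = bar a then u else 0) = (if bar a = c then if d = bar b then u else 0 else 0)" for u :: "('l + 'l) cpol"
        by auto
      then show ?thesis unfolding * Cb by simp
    qed
    then have "?S (\<lambda>c d. Const (\<Sum>X\<in>B. X $ a $ b * X $ c $ d) * ?e a b (?e c d p)) =
       Const ?k * ?e a b (?e b a p) - Const (?k * (sg a * sg b)) * ?e a b (?e (bar a) (bar b) p)"
      by (simp only: sum_subtractf sum_sum_delta sum.delta sum.delta' finite UNIV_I if_True)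
    then show "?S (\<lambda>c d. Const (\<Sum>X\<in>B. X $ a $ b * X $ c $ d) * ?e a b (?e c d p)) =
      Const ?k * (?e a b (?e b a p) - Const (sg a * sg b) * ?e a b (?e (bar a) (bar b) p))"
      by (simp only: Const_simps(4) right_diff_distrib mult.assoc)
  qed
  also have "\<dots> = Const (- 1 / (2 * of_real K)) * ?T"
    by (simp only: sum_distrib_left)
  finally have 1: "(\<Sum>X\<in>B. Der X (Der X p)) = Const (- 1 / (2 * of_real K)) * ?T" .
  \<comment> \<open>The four products in each summand form two pairs, exchanged by sending (a, b) to
    (bar b, bar a).\<close>
  have "casimir p = ?S (\<lambda>a b. (?e a b (?e b a p) - Const (sg a * sg b) * ?e a b (?e (bar a) (bar b) p)) +
     (?e (bar b) (bar a) (?e (bar a) (bar b) p) - Const (sg (bar b) * sg (bar a)) * ?e (bar b) (bar a) (?e (bar (bar b)) (bar (bar a)) p)))"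
    unfolding casimir_def
  proof (intro sum.cong refl)
    fix a b :: "'l + 'l"
    have s: "Const (sg a * sg b) * (Const (sg b * sg a) * z) = z" for z :: "('l + 'l) cpol"
      by (cases a; cases b) auto
    show "sp_der a b (sp_der b a p) = (?e a b (?e b a p) - Const (sg a * sg b) * ?e a b (?e (bar a) (bar b) p)) +
     (?e (bar b) (bar a) (?e (bar a) (bar b) p) - Const (sg (bar b) * sg (bar a)) * ?e (bar b) (bar a) (?e (bar (bar b)) (bar (bar a)) p))"
      unfolding sp_der_def derivationD(6,8)[OF derivation_Der] right_diff_distrib s
      by (simp add: mult.commute[of "sg b" "sg a"])
  qed
  also have "\<dots> = ?T + ?T"
    unfolding sum.distrib
    by (rule arg_cong2[where f = "(+)", OF refl]) (rule sum_bar2)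
  finally have 2: "casimir p = Const 2 * ?T" by simp
  have "Const (- 1 / (2 * of_real K)) * ?T = Const (- 1 / (4 * of_real K) * 2) * ?T" by simp
  also have "\<dots> = Const (- 1 / (4 * of_real K)) * casimir p"
    unfolding 2 by (simp only: Const_simps(4) mult.assoc)
  finally show ?thesis unfolding 1 .
qed


section \<open>The Killing form and orthonormal bases\<close>

lemma linear_ad_ad: "linear (ad X \<circ> ad Y)"
  unfolding ad_def o_def
  by (rule linearI) (simp_all add: matrix_mult_add matrix_mult_scaleR bounded_bilinear.diff_left[OF bounded_bilinear_matrix_mult]
      bounded_bilinear.diff_right[OF bounded_bilinear_matrix_mult] scaleR_diff_right)

lemma lie_algebra_Sp_ad:
  assumes "X \<in> lie_algebra Sp" "Y \<in> lie_algebra Sp"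
  shows "ad X Y \<in> lie_algebra Sp"
proof -
  note diff = bounded_bilinear.diff_left[OF bounded_bilinear_matrix_mult] bounded_bilinear.diff_right[OF bounded_bilinear_matrix_mult]
  note neg = bounded_bilinear.minus_left[OF bounded_bilinear_matrix_mult] bounded_bilinear.minus_right[OF bounded_bilinear_matrix_mult]
  have X: "conj_transpose X = - X" "transpose X ** symp_J = - (symp_J ** X)"
    and Y: "conj_transpose Y = - Y" "transpose Y ** symp_J = - (symp_J ** Y)"
    using assms by (simp_all add: lie_algebra_Sp eq_neg_iff_add_eq_0)
  have "conj_transpose (ad X Y) = - ad X Y"
    unfolding ad_def linear_diff[OF linear_conj_transpose] conj_transpose_mult X Y neg by simp
  moreover have "transpose (ad X Y) ** symp_J + symp_J ** ad X Y = 0"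
  proof -
    have t: "(transpose P ** transpose Q) ** symp_J = symp_J ** (P ** Q)"
      if "transpose P ** symp_J = - (symp_J ** P)" "transpose Q ** symp_J = - (symp_J ** Q)" for P Q :: "complex^('a + 'a)^('a + 'a)"
    proof -
      have "(transpose P ** transpose Q) ** symp_J = transpose P ** (transpose Q ** symp_J)"
        by (simp only: matrix_mul_assoc)
      also have "\<dots> = - ((transpose P ** symp_J) ** Q)" unfolding that(2) neg by (simp only: matrix_mul_assoc)
      also have "\<dots> = symp_J ** (P ** Q)" unfolding that(1) neg by (simp add: matrix_mul_assoc)
      finally show ?thesis .
    qed
    show ?thesis
      unfolding ad_def linear_diff[OF linear_transpose] matrix_transpose_mul diff t[OF Y(2) X(2)] t[OF X(2) Y(2)]
      by simp
  qed
  ultimately show ?thesis by (simp add: lie_algebra_Sp)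
qed

definition mtrace :: "complex^'n^'n \<Rightarrow> complex" where
  "mtrace A = (\<Sum>i\<in>UNIV. A $ i $ i)"

lemma mtrace_mult: "mtrace (X ** Y) = (\<Sum>p\<in>UNIV. \<Sum>q\<in>UNIV. X $ p $ q * Y $ q $ p)"
  by (simp add: mtrace_def matrix_matrix_mult_def)

lemma mtrace_mult_commute: "mtrace (X ** Y) = mtrace (Y ** X)"
  unfolding mtrace_mult by (subst sum.swap) (simp add: mult.commute)

lemma mtrace_lie:
  assumes "X \<in> lie_algebra Sp"
  shows "mtrace X = 0"
proof -
  have "X $ bar a $ bar a = - X $ a $ a" for a
    using lie_algebra_SpD(2)[OF assms, of a a] by simp
  then have "mtrace X = - mtrace X"
    unfolding mtrace_def using sum_bar[of "\<lambda>a. X $ a $ a"] by (simp add: sum_negf)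
  then show ?thesis by simp
qed

lemma mtrace_lie_mult:
  assumes "X \<in> lie_algebra Sp"
  shows "Re (mtrace (X ** Y)) = - (X \<bullet> Y)"
proof -
  have "mtrace (X ** Y) = (\<Sum>q\<in>UNIV. \<Sum>p\<in>UNIV. X $ p $ q * Y $ q $ p)"
    unfolding mtrace_mult by (rule sum.swap)
  also have "\<dots> = (\<Sum>q\<in>UNIV. \<Sum>p\<in>UNIV. - (cnj (X $ q $ p) * Y $ q $ p))"
  proof (intro sum.cong refl)
    fix p q
    have "X $ p $ q = - cnj (X $ q $ p)" by (rule lie_algebra_SpD(1)[OF assms])
    then show "X $ p $ q * Y $ q $ p = - (cnj (X $ q $ p) * Y $ q $ p)" by simp
  qed
  finally show ?thesis unfolding inner_entries sum_negf by simp
qed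

text \<open>The tensor turns the trace over the Lie algebra into half of a gl trace plus half of a
  trace twisted by the symplectic involution. They equal 4l tr(XY) and 4 tr(XY), which gives 2l +
  2.\<close>

lemma killing_form_Sp:
  fixes X Y :: "complex^('l::finite + 'l)^('l + 'l)"
  assumes X: "X \<in> lie_algebra Sp" and Y: "Y \<in> lie_algebra Sp"
  shows "killing_form Sp X Y = - (2 * real CARD('l) + 2) * (X \<bullet> Y)"
proof -
  let ?S = "\<lambda>f. \<Sum>a\<in>UNIV. \<Sum>b\<in>UNIV. f a b"
  obtain D where D: "D \<subseteq> lie_algebra Sp" "pairwise orthogonal D" "\<And>x. x \<in> D \<Longrightarrow> norm x = 1"
    "independent D" "span D = (lie_algebra Sp :: (complex^('l + 'l)^('l + 'l)) set)"
    using orthonormal_basis_subspace[OF subspace_lie_algebra_Sp] by metis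
  have fin: "finite D" using D(4) finiteI_independent by blast
  have on: "x \<bullet> y = (if x = y then 1 else 0)" if "x \<in> D" "y \<in> D" for x y
    using D(2,3) that by (auto simp: pairwise_def orthogonal_def norm_eq_1)
  have tensor: "(\<Sum>c\<in>D. c $ r $ s * cnj (c $ p $ q)) =
    (of_bool (p = r \<and> q = s) - sg r * sg s * of_bool (p = bar s \<and> q = bar r)) / 2" for p q r s
    using lie_tensor[OF fin D(5), of 1 r s p q] on by simp
  \<comment> \<open>Matrix of the double bracket c |-> [X, [Y, c]] in the coordinates of the full
    matrix space.\<close>
  define M where "M p q r s = (X ** Y) $ p $ r * of_bool (s = q) - X $ p $ r * Y $ s $ q - Y $ p $ r * X $ s $ q
    + of_bool (p = r) * (Y ** X) $ s $ q" for p q r s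
  have T: "(ad X (ad Y c)) $ p $ q = ?S (\<lambda>r s. M p q r s * c $ r $ s)" for c p q
  proof -
    have "(ad X (ad Y c)) = X ** Y ** c - X ** c ** Y - Y ** c ** X + c ** (Y ** X)"
      unfolding ad_def bounded_bilinear.diff_left[OF bounded_bilinear_matrix_mult] bounded_bilinear.diff_right[OF bounded_bilinear_matrix_mult]
      by (simp add: matrix_mul_assoc)
    moreover have "(X ** Y ** c) $ p $ q = ?S (\<lambda>r s. (X ** Y) $ p $ r * of_bool (s = q) * c $ r $ s)"
      by (simp add: matrix_matrix_mult_def[of "X ** Y" c] of_bool_def if_distrib[of "\<lambda>x. x * _"] if_distrib[of "\<lambda>x. _ * x"] cong: if_cong)
    moreover have "(c ** (Y ** X)) $ p $ q = ?S (\<lambda>r s. of_bool (p = r) * (Y ** X) $ s $ q * c $ r $ s)"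
    proof -
      have "?S (\<lambda>r s. of_bool (p = r) * (Y ** X) $ s $ q * c $ r $ s) = ?S (\<lambda>r s. if p = r then (Y ** X) $ s $ q * c $ r $ s else 0)"
        by (intro sum.cong refl) simp
      then show ?thesis unfolding sum_sum_delta by (simp add: matrix_matrix_mult_def[of c] mult.commute)
    qed
    moreover have "(A ** c ** B) $ p $ q = ?S (\<lambda>r s. A $ p $ r * B $ s $ q * c $ r $ s)" for A B :: "complex^('l + 'l)^('l + 'l)"
    proof -
      have "(A ** c ** B) $ p $ q = (\<Sum>s\<in>UNIV. \<Sum>r\<in>UNIV. A $ p $ r * B $ s $ q * c $ r $ s)"
        by (simp add: matrix_matrix_mult_def sum_distrib_left sum_distrib_right mult_ac)
      also have "\<dots> = ?S (\<lambda>r s. A $ p $ r * B $ s $ q * c $ r $ s)" by (rule sum.swap)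
      finally show ?thesis .
    qed
    ultimately show ?thesis
      unfolding M_def by (simp add: distrib_right left_diff_distrib sum.distrib sum_subtractf)
  qed
  have k1: "killing_form Sp X Y = (\<Sum>c\<in>D. ad X (ad Y c) \<bullet> c)"
    unfolding killing_form_def
    by (subst trace_on_orthonormal[OF fin D(5) on linear_ad_ad[of X Y]])
      (simp_all add: lie_algebra_Sp_ad[OF X lie_algebra_Sp_ad[OF Y]])
  have k2: "(\<Sum>c\<in>D. ad X (ad Y c) \<bullet> c) = Re (\<Sum>c\<in>D. ?S (\<lambda>p q. ?S (\<lambda>r s. M p q r s * (c $ r $ s * cnj (c $ p $ q)))))"
    unfolding Re_sum[of _ D]
    by (rule sum.cong[OF refl], subst inner_commute) (simp only: inner_entries T sum_distrib_left mult_ac)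
  have "(\<Sum>c\<in>D. ?S (\<lambda>p q. ?S (\<lambda>r s. M p q r s * (c $ r $ s * cnj (c $ p $ q))))) =
    ?S (\<lambda>p q. ?S (\<lambda>r s. M p q r s * (\<Sum>c\<in>D. c $ r $ s * cnj (c $ p $ q))))"
    unfolding sum_distrib_left
    by (subst sum.swap, rule sum.cong[OF refl], subst sum.swap, rule sum.cong[OF refl], subst sum.swap, rule sum.cong[OF refl], subst sum.swap, rule refl)
  also have "\<dots> = ?S (\<lambda>p q. (M p q p q - sg p * sg q * M p q (bar q) (bar p)) / 2)"
  proof (intro sum.cong refl)
    fix p q
    have "M p q r s * (\<Sum>c\<in>D. c $ r $ s * cnj (c $ p $ q)) =
      (if p = r then if q = s then M p q r s / 2 else 0 else 0) -
      (if bar q = r then if bar p = s then sg p * sg q * M p q r s / 2 else 0 else 0)" for r s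
      unfolding tensor by (auto simp: field_simps)
    then show "?S (\<lambda>r s. M p q r s * (\<Sum>c\<in>D. c $ r $ s * cnj (c $ p $ q))) =
      (M p q p q - sg p * sg q * M p q (bar q) (bar p)) / 2"
      by (simp only: sum_subtractf sum_sum_delta sum.delta sum.delta' finite UNIV_I if_True diff_divide_distrib)
  qed
  also have "\<dots> = (2 * of_nat CARD('l) + 2) * mtrace (X ** Y)"
  proof -
    have n: "(of_nat CARD('l + 'l) :: complex) = 2 * of_nat CARD('l)" by simp
    \<comment> \<open>The untwisted trace; its two mixed terms are products of tr X and tr Y, which
      vanish.\<close>
    have 1: "?S (\<lambda>p q. M p q p q) = 2 * (2 * of_nat CARD('l)) * mtrace (X ** Y)"
    proof -
      have "?S (\<lambda>p q. M p q p q) = (\<Sum>p\<in>UNIV. \<Sum>q\<in>(UNIV :: ('l + 'l) set). (X ** Y) $ p $ p) - ?S (\<lambda>p q. X $ p $ p * Y $ q $ q) - ?S (\<lambda>p q. Y $ p $ p * X $ q $ q)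
        + (\<Sum>p\<in>(UNIV :: ('l + 'l) set). \<Sum>q\<in>UNIV. (Y ** X) $ q $ q)"
        unfolding sum.distrib[symmetric] sum_subtractf[symmetric] by (simp add: M_def)
      also have "\<dots> = of_nat CARD('l + 'l) * mtrace (X ** Y) - mtrace X * mtrace Y - mtrace Y * mtrace X + of_nat CARD('l + 'l) * mtrace (Y ** X)"
        unfolding mtrace_def sum_product by (simp add: sum_distrib_left)
      finally show ?thesis unfolding n mtrace_lie[OF X] mtrace_mult_commute[of Y X] by simp
    qed
    \<comment> \<open>In the twisted trace the outer terms survive for \<open>q = bar p\<close>
      only, and the symmetry of \<open>X\<close> and \<open>Y\<close> turns the mixed terms into
      traces of products: four copies of tr(XY).\<close>
    have 2: "?S (\<lambda>p q. - (sg p * sg q * M p q (bar q) (bar p))) = 4 * mtrace (X ** Y)"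
    proof -
      have "- (sg p * sg q * M p q (bar q) (bar p)) =
         (if q = bar p then (X ** Y) $ p $ p + (Y ** X) $ bar p $ bar p else 0)
         + X $ p $ bar q * Y $ bar q $ p + Y $ p $ bar q * X $ bar q $ p" for p q
      proof -
        have XY: "Z $ bar p $ q = sg p * sg q * Z $ bar q $ p" if "Z \<in> lie_algebra Sp" for Z
          using lie_algebra_SpD(2)[OF that, where a = "bar q" and b = p] by (simp add: mult_ac)
        have s: "sg p * sg q * (sg p * sg q * z) = z" for z by (cases p; cases q) auto
        have e0: "- (sg p * sg q * M p q (bar q) (bar p)) = - (sg p * sg q * ((X ** Y) $ p $ bar q * of_bool (bar p = q) + of_bool (p = bar q) * (Y ** X) $ bar p $ q))
          + X $ p $ bar q * (sg p * sg q * Y $ bar p $ q) + Y $ p $ bar q * (sg p * sg q * X $ bar p $ q)"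
        proof -
          have "- (s * (A * o1 - B * D - B' * D' + o2 * A')) = - (s * (A * o1 + o2 * A')) + B * (s * D) + B' * (s * D')"
            for s A o1 B D B' D' o2 A' :: complex by (simp add: algebra_simps)
          then show ?thesis unfolding M_def by simp
        qed
        have e1: "sg p * sg q * Y $ bar p $ q = Y $ bar q $ p" unfolding XY[OF Y] s ..
        have e2: "sg p * sg q * X $ bar p $ q = X $ bar q $ p" unfolding XY[OF X] s ..
        have e3: "- (sg p * sg q * ((X ** Y) $ p $ bar q * of_bool (bar p = q) + of_bool (p = bar q) * (Y ** X) $ bar p $ q)) =
          (if q = bar p then (X ** Y) $ p $ p + (Y ** X) $ bar p $ bar p else 0)"
        proof (cases "q = bar p")
          case True
          then show ?thesis by simp
        next
          case False
          then have "bar p \<noteq> q" "p \<noteq> bar q" by auto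
          with False show ?thesis by simp
        qed
        show ?thesis unfolding e0 e1 e2 e3 ..
      qed
      then have e0: "?S (\<lambda>p q. - (sg p * sg q * M p q (bar q) (bar p))) =
        (\<Sum>p\<in>UNIV. (X ** Y) $ p $ p + (Y ** X) $ bar p $ bar p) + ?S (\<lambda>p q. X $ p $ bar q * Y $ bar q $ p) + ?S (\<lambda>p q. Y $ p $ bar q * X $ bar q $ p)"
        by (simp only: sum.distrib sum.delta sum.delta' finite UNIV_I if_True)
      have e1: "?S (\<lambda>p q. X $ p $ bar q * Y $ bar q $ p) = mtrace (X ** Y)"
        unfolding mtrace_mult by (rule sum.cong[OF refl], rule sum_bar)
      have e2: "?S (\<lambda>p q. Y $ p $ bar q * X $ bar q $ p) = mtrace (Y ** X)"
        unfolding mtrace_mult by (rule sum.cong[OF refl], rule sum_bar)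
      have e3: "(\<Sum>p\<in>UNIV. (X ** Y) $ p $ p + (Y ** X) $ bar p $ bar p) = mtrace (X ** Y) + mtrace (Y ** X)"
        unfolding sum.distrib mtrace_def sum_bar[of "\<lambda>p. (Y ** X) $ p $ p"] ..
      show ?thesis unfolding e0 e1 e2 e3 mtrace_mult_commute[of Y X] by simp
    qed
    have h: "?S (\<lambda>p q. (M p q p q - sg p * sg q * M p q (bar q) (bar p)) / 2) =
      (?S (\<lambda>p q. M p q p q) + ?S (\<lambda>p q. - (sg p * sg q * M p q (bar q) (bar p)))) / 2"
      unfolding sum.distrib[symmetric] sum_divide_distrib by simp
    show ?thesis unfolding h 1 2 by (simp add: field_simps)
  qed
  finally have "killing_form Sp X Y = Re ((2 * of_nat CARD('l) + 2) * mtrace (X ** Y))"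
    unfolding k1 k2 by (rule arg_cong)
  also have "\<dots> = (2 * real CARD('l) + 2) * Re (mtrace (X ** Y))"
    by simp
  finally show ?thesis unfolding mtrace_lie_mult[OF X] by (simp only: mult_minus_left mult_minus_right)
qed

text \<open>The choice in \<open>laplacian\<close> means something only if an orthonormal basis
  exists; a Euclidean one scaled by 1 / sqrt K is such a basis. Afterwards only orthonormality of
  the chosen basis matters.\<close>

lemma laplacian_basis:
  fixes \<gamma> K :: real
  assumes "\<gamma> > 0" and K_def: "K = \<gamma> * (2 * real CARD('l::finite) + 2)"
  shows "\<exists>B :: (complex^('l + 'l)^('l + 'l)) set. finite B \<and> span B = lie_algebra Sp \<and>
    (\<forall>X\<in>B. \<forall>Y\<in>B. K * (X \<bullet> Y) = (if X = Y then 1 else 0)) \<and>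
    (\<forall>f x. laplacian Sp (\<lambda>X Y. - \<gamma> * killing_form Sp X Y) f x =
      - (\<Sum>X\<in>B. left_inv_deriv X (left_inv_deriv X f) x))"
proof -
  let ?g = "\<lambda>X Y. - \<gamma> * killing_form (Sp :: (complex^('l + 'l)^('l + 'l)) set) X Y"
  have K: "K > 0" using assms by (simp add: K_def add_nonneg_pos)
  have g: "?g X Y = K * (X \<bullet> Y)" if "X \<in> lie_algebra Sp" "Y \<in> lie_algebra Sp" for X Y
    unfolding killing_form_Sp[OF that] K_def by (simp add: algebra_simps)
  obtain D where D: "D \<subseteq> lie_algebra Sp" "pairwise orthogonal D" "\<And>x. x \<in> D \<Longrightarrow> norm x = 1"
    "independent D" "span D = (lie_algebra Sp :: (complex^('l + 'l)^('l + 'l)) set)"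
    using orthonormal_basis_subspace[OF subspace_lie_algebra_Sp] by metis
  define r where "r = 1 / sqrt K"
  have r: "r \<noteq> 0" "K * (r * r) = 1" using K by (simp_all add: r_def)
  define B0 where "B0 = (\<lambda>x. r *\<^sub>R x) ` D"
  have sub: "B0 \<subseteq> lie_algebra Sp" unfolding B0_def using D(1) subspace_scale[OF subspace_lie_algebra_Sp] by blast
  have on: "K * (X \<bullet> Y) = (if X = Y then 1 else 0)" if XY: "X \<in> B0" "Y \<in> B0" for X Y
  proof -
    obtain x y where xy: "X = r *\<^sub>R x" "Y = r *\<^sub>R y" "x \<in> D" "y \<in> D" using XY by (auto simp: B0_def)
    have "x \<bullet> y = (if x = y then 1 else 0)"
      using D(2,3) xy by (auto simp: pairwise_def orthogonal_def norm_eq_1)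
    then show ?thesis using r by (simp add: xy mult.assoc[symmetric])
  qed
  have "span B0 = lie_algebra Sp"
  proof
    show "span B0 \<subseteq> lie_algebra Sp" using sub subspace_lie_algebra_Sp by (rule span_minimal)
    have "D \<subseteq> span B0"
    proof
      fix x assume "x \<in> D"
      then have "(1 / r) *\<^sub>R (r *\<^sub>R x) \<in> span B0" by (intro span_scale span_base) (auto simp: B0_def)
      then show "x \<in> span B0" using r by simp
    qed
    then show "lie_algebra Sp \<subseteq> span B0" using D(5) span_minimal[OF _ subspace_span] by blast
  qed
  moreover have "independent B0"
  proof (rule pairwise_orthogonal_independent)
    show "pairwise orthogonal B0"
      unfolding pairwise_def orthogonal_def
    proof (intro ballI impI)
      fix X Y assume "X \<in> B0" "Y \<in> B0" "X \<noteq> Y"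
      then have "K * (X \<bullet> Y) = 0" using on by simp
      then show "X \<bullet> Y = 0" using K by simp
    qed
    show "0 \<notin> B0"
    proof
      assume "0 \<in> B0"
      from on[OF this this] show False by simp
    qed
  qed
  moreover have "?g X Y = (if X = Y then 1 else 0)" if "X \<in> B0" "Y \<in> B0" for X Y
  proof -
    have "X \<in> lie_algebra Sp" "Y \<in> lie_algebra Sp" using sub that by blast+
    from g[OF this] on[OF that] show ?thesis by (simp only:)
  qed
  ultimately have "orthonormal_basis_of ?g (lie_algebra Sp) B0"
    unfolding orthonormal_basis_of_def basis_of_def by blast
  then have ex: "orthonormal_basis_of ?g (lie_algebra Sp) (SOME B. orthonormal_basis_of ?g (lie_algebra Sp) B)"
    by (rule someI)
  define B where "B = (SOME B. orthonormal_basis_of ?g (lie_algebra Sp) B)"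
  have "orthonormal_basis_of ?g (lie_algebra Sp) B" unfolding B_def by (rule ex)
  then have B: "independent B" "span B = lie_algebra Sp" "\<And>X Y. X \<in> B \<Longrightarrow> Y \<in> B \<Longrightarrow> ?g X Y = (if X = Y then 1 else 0)"
    unfolding orthonormal_basis_of_def basis_of_def by blast+
  show ?thesis
  proof (intro exI conjI ballI allI)
    show "finite B" using B(1) finiteI_independent by blast
    show "span B = lie_algebra Sp" by (rule B(2))
    show "K * (X \<bullet> Y) = (if X = Y then 1 else 0)" if "X \<in> B" "Y \<in> B" for X Y
    proof -
      have "X \<in> lie_algebra Sp" "Y \<in> lie_algebra Sp" using span_base that unfolding B(2)[symmetric] by blast+
      from g[OF this] B(3)[OF that] show ?thesis by (simp only:)
    qed
    show "laplacian Sp ?g f x = - (\<Sum>X\<in>B. left_inv_deriv X (left_inv_deriv X f) x)" for f x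
      by (simp add: laplacian_def Let_def B_def)
  qed
qed

section \<open>Averaging over the group\<close>

text \<open>Means of left translates commute with the right multiplications along which
  left-invariant fields flow. Closure under composition is a separate rule because coinciding
  products of elements of two finite sets would have to be counted with multiplicity.\<close>

inductive averaging :: "(complex^'n^'n) set \<Rightarrow> ((complex^'n^'n \<Rightarrow> real) \<Rightarrow> complex^'n^'n \<Rightarrow> real) \<Rightarrow> bool"
  for S :: "(complex^'n^'n) set" where
  averaging_finite: "finite F \<Longrightarrow> F \<noteq> {} \<Longrightarrow> F \<subseteq> S \<Longrightarrow>
    averaging S (\<lambda>u x. (\<Sum>g\<in>F. u (g ** x)) / real (card F))"
| averaging_comp: "averaging S A \<Longrightarrow> averaging S A' \<Longrightarrow> averaging S (\<lambda>u. A (A' u))"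

lemma averaging_add: "averaging S A \<Longrightarrow> A (\<lambda>x. u x + v x) = (\<lambda>x. A u x + A v x)"
  by (induction arbitrary: u v rule: averaging.induct) (simp_all add: sum.distrib add_divide_distrib)

lemma averaging_scale: "averaging S A \<Longrightarrow> A (\<lambda>x. c * u x) = (\<lambda>x. c * A u x)"
  by (induction arbitrary: u rule: averaging.induct) (simp_all flip: sum_distrib_left)

lemma averaging_const: "averaging S A \<Longrightarrow> A (\<lambda>x. c) = (\<lambda>x. c)"
  by (induction rule: averaging.induct) simp_all

lemma averaging_sum: "averaging S A \<Longrightarrow> A (\<lambda>x. \<Sum>i\<in>I. u i x) = (\<lambda>x. \<Sum>i\<in>I. A (u i) x)"
proof (induction I rule: infinite_finite_induct)
  case (insert i I)
  then show ?case using averaging_add[of S A "u i" "\<lambda>x. \<Sum>i\<in>I. u i x"] by simp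
qed (simp_all add: averaging_const)

lemma averaging_right: "averaging S A \<Longrightarrow> A (\<lambda>x. u (x ** h)) = (\<lambda>x. A u (x ** h))"
  by (induction arbitrary: u rule: averaging.induct) (simp_all add: matrix_mul_assoc)

lemma averaging_mono:
  assumes "averaging Sp A" "\<And>x. x \<in> Sp \<Longrightarrow> u x \<le> v x" "x \<in> Sp"
  shows "A u x \<le> A v x"
  using assms
proof (induction arbitrary: u v x rule: averaging.induct)
  case (averaging_finite F)
  then show ?case by (intro divide_right_mono sum_mono) (auto intro: Sp_mult)
qed blast

lemma averaging_continuous:
  assumes "averaging Sp A" "continuous_on Sp u"
  shows "continuous_on Sp (A u)"
  using assms
proof (induction arbitrary: u rule: averaging.induct)
  case (averaging_finite F)
  have "continuous_on Sp (\<lambda>x. u (g ** x))" if "g \<in> F" for g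
  proof (rule continuous_on_compose2[OF averaging_finite.prems])
    show "continuous_on Sp ((**) g)"
      by (intro linear_continuous_on bounded_bilinear.bounded_linear_right[OF bounded_bilinear_matrix_mult])
    show "(**) g ` Sp \<subseteq> Sp" using that averaging_finite by (auto intro: Sp_mult)
  qed
  then show ?case using averaging_finite by (intro continuous_on_divide continuous_on_sum continuous_on_const) auto
qed blast

text \<open>Left multiplication by a unitary matrix is an isometry, so a modulus of continuity of
  \<open>u\<close> survives averaging. Hence a single net serves all iterations of the averaging
  argument.\<close>

lemma averaging_modulus:
  assumes "averaging Sp A" "\<And>x y. x \<in> Sp \<Longrightarrow> y \<in> Sp \<Longrightarrow> norm (x - y) < d \<Longrightarrow> u x - u y \<le> e"
    "x \<in> Sp" "y \<in> Sp" "norm (x - y) < d"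
  shows "A u x - A u y \<le> e"
  using assms
proof (induction arbitrary: u x y rule: averaging.induct)
  case (averaging_finite F)
  have c: "real (card F) > 0" using averaging_finite by (simp add: card_gt_0_iff)
  have "(\<Sum>g\<in>F. u (g ** x)) - (\<Sum>g\<in>F. u (g ** y)) = (\<Sum>g\<in>F. u (g ** x) - u (g ** y))"
    by (simp add: sum_subtractf)
  also have "\<dots> \<le> (\<Sum>g\<in>F. e)"
  proof (rule sum_mono)
    fix g assume "g \<in> F"
    then have g: "g \<in> Sp" using averaging_finite by blast
    have "norm (g ** x - g ** y) = norm (g ** (x - y))"
      by (simp add: bounded_bilinear.diff_right[OF bounded_bilinear_matrix_mult])
    also have "\<dots> = norm (x - y)" by (rule unitary_norm_left[OF Sp_unitary(1)[OF g]])
    finally have "norm (g ** x - g ** y) < d" using averaging_finite.prems(4) by simp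
    then show "u (g ** x) - u (g ** y) \<le> e"
      using averaging_finite.prems(1)[OF Sp_mult[OF g averaging_finite.prems(2)] Sp_mult[OF g averaging_finite.prems(3)]]
      by blast
  qed
  finally show ?case using c by (simp add: field_simps)
qed blast

lemma averaging_near_const_mono:
  assumes "averaging Sp A" "\<And>x. x \<in> Sp \<Longrightarrow> \<bar>u x - c\<bar> \<le> e" "x \<in> Sp"
  shows "\<bar>A u x - c\<bar> \<le> e"
proof -
  have "A u x \<le> A (\<lambda>_. c + e) x"
    by (rule averaging_mono[OF assms(1) _ assms(3)]) (use assms(2) in \<open>force simp: abs_le_iff\<close>)
  moreover have "A (\<lambda>_. c - e) x \<le> A u x"
    by (rule averaging_mono[OF assms(1) _ assms(3)]) (use assms(2) in \<open>force simp: abs_le_iff\<close>)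
  ultimately show ?thesis by (simp add: averaging_const[OF assms(1)] abs_le_iff)
qed

lemma Sp_cover:
  fixes d :: real
  assumes "d > 0"
  obtains F :: "(complex^('l::finite + 'l)^('l + 'l)) set"
  where "finite F" "F \<noteq> {}" "F \<subseteq> Sp" "\<And>z. z \<in> Sp \<Longrightarrow> \<exists>g\<in>F. norm (g - z) < d"
proof -
  obtain F :: "(complex^('l + 'l)^('l + 'l)) set" where F: "finite F" "F \<subseteq> Sp" "Sp \<subseteq> (\<Union>x\<in>F. ball x d)"
    by (rule compactE_image[OF Sp_compact, of Sp "\<lambda>x. ball x d"]) (use assms in auto)
  then have "\<exists>g\<in>F. norm (g - z) < d" if "z \<in> Sp" for z using that by (fastforce simp: dist_norm)
  moreover from this have "F \<noteq> {}" using Sp_one by blast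
  ultimately show ?thesis using that F by blast
qed

text \<open>Von Neumann's construction of the mean: averaging over a net that meets a small ball around a
  minimum lowers the maximum by a fixed amount as long as the oscillation exceeds \<open>e\<close>.\<close>

lemma averaging_near_const:
  fixes u :: "complex^('l::finite + 'l)^('l + 'l) \<Rightarrow> real"
  assumes u: "continuous_on Sp u" and e: "e > 0"
  shows "\<exists>A. averaging Sp A \<and> (\<exists>c. \<forall>x\<in>Sp. \<bar>A u x - c\<bar> \<le> e)"
proof -
  have "uniformly_continuous_on Sp u" by (rule compact_uniformly_continuous[OF u Sp_compact])
  then obtain d where d: "d > 0" "\<And>x y. x \<in> Sp \<Longrightarrow> y \<in> Sp \<Longrightarrow> dist y x < d \<Longrightarrow> dist (u y) (u x) < e / 2"
    unfolding uniformly_continuous_on_def using half_gt_zero[OF e] by blast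
  have mod: "u x - u y \<le> e / 2" if "x \<in> Sp" "y \<in> Sp" "norm (x - y) < d" for x y
  proof -
    have "dist (u x) (u y) < e / 2" using d(2)[of y x] that by (simp add: dist_norm)
    then show ?thesis unfolding dist_real_def by linarith
  qed
  obtain F :: "(complex^('l + 'l)^('l + 'l)) set"
    where F: "finite F" "F \<noteq> {}" "F \<subseteq> Sp" "\<And>z. z \<in> Sp \<Longrightarrow> \<exists>g\<in>F. norm (g - z) < d"
    using Sp_cover[OF d(1)] by blast
  define N where "N = real (card F)"
  have N: "N > 0" using F by (simp add: N_def card_gt_0_iff)
  have "bounded (u ` Sp)" using compact_continuous_image[OF u Sp_compact] compact_imp_bounded by blast
  then obtain M where M: "\<And>x. x \<in> Sp \<Longrightarrow> \<bar>u x\<bar> \<le> M" unfolding bounded_iff by auto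
  \<comment> \<open>Either some average already oscillates by little, or \<open>n\<close> rounds
    have lowered the upper bound \<open>M\<close> by \<open>n\<close> fixed amounts. Averages never
    fall below -M, so the second alternative fails for large \<open>n\<close>.\<close>
  have step: "(\<exists>A. averaging Sp A \<and> (\<exists>c. \<forall>x\<in>Sp. \<bar>A u x - c\<bar> \<le> e)) \<or>
    (\<exists>A. averaging Sp A \<and> (\<forall>x\<in>Sp. A u x \<le> M - real n * (e / (2 * N))))" for n
  proof (induction n)
    case 0
    have "averaging Sp (\<lambda>u x. (\<Sum>g\<in>{mat 1 :: complex^('l + 'l)^('l + 'l)}. u (g ** x)) / real (card {mat 1 :: complex^('l + 'l)^('l + 'l)}))"
      by (rule averaging_finite) (auto simp: Sp_one)
    then have "averaging Sp (\<lambda>(u :: complex^('l + 'l)^('l + 'l) \<Rightarrow> real) x. u x)" by simp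
    moreover have "\<forall>x\<in>Sp. u x \<le> M - real 0 * (e / (2 * N))" using M by (auto simp: abs_le_iff)
    ultimately show ?case by blast
  next
    case (Suc n)
    show ?case
    proof (cases "\<exists>A. averaging Sp A \<and> (\<exists>c. \<forall>x\<in>Sp. \<bar>A u x - c\<bar> \<le> e)")
      case False
      then obtain A where A: "averaging Sp A" "\<And>x. x \<in> Sp \<Longrightarrow> A u x \<le> M - real n * (e / (2 * N))"
        using Suc by blast
      define T where "T = M - real n * (e / (2 * N))"
      have "\<not> (\<forall>x\<in>Sp. \<bar>A u x - A u (mat 1)\<bar> \<le> e)" using False A(1) by blast
      then obtain x2 where x2: "x2 \<in> Sp" "\<not> \<bar>A u x2 - A u (mat 1)\<bar> \<le> e" by blast
      obtain x1 y1 where "x1 \<in> Sp" "y1 \<in> Sp" "A u x1 - A u y1 > e"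
      proof (cases "A u x2 \<ge> A u (mat 1)")
        case True
        with x2 that[of x2 "mat 1"] Sp_one show thesis by simp
      next
        case False
        with x2 that[of "mat 1" x2] Sp_one show thesis by simp
      qed
      then have y1: "y1 \<in> Sp" "A u y1 < T - e" using A(2)[of x1] unfolding T_def by auto
      define A' where "A' = (\<lambda>u x. (\<Sum>g\<in>F. (A u) (g ** x)) / real (card F))"
      have "averaging Sp (\<lambda>u x. (\<Sum>g\<in>F. u (g ** x)) / real (card F))" by (rule averaging_finite[OF F(1-3)])
      from averaging_comp[OF this A(1)] have "averaging Sp A'" unfolding A'_def .
      moreover have "A' u x \<le> T - e / (2 * N)" if x: "x \<in> Sp" for x
      proof -
        \<comment> \<open>Some \<open>g\<close> in the net approximates the element that carries
          \<open>x\<close> to the low point \<open>y1\<close>. So one of the \<open>N\<close>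
          translates is at most T - e / 2 and the others at most \<open>T\<close>.\<close>
        have "y1 ** conj_transpose x \<in> Sp" using y1(1) x by (intro Sp_mult Sp_inverse)
        then obtain g where g: "g \<in> F" "norm (g - y1 ** conj_transpose x) < d" using F(4) by blast
        have "(g - y1 ** conj_transpose x) ** x = g ** x - y1"
          using Sp_unitary(1)[OF x]
          by (simp add: bounded_bilinear.diff_left[OF bounded_bilinear_matrix_mult] flip: matrix_mul_assoc)
        then have "norm (g ** x - y1) < d"
          using g(2) unitary_norm_right[OF Sp_unitary(1)[OF x], of "g - y1 ** conj_transpose x"] by simp
        moreover have "g ** x \<in> Sp" using g(1) F(3) x by (intro Sp_mult) auto
        ultimately have "A u (g ** x) - A u y1 \<le> e / 2"
          using y1(1) by (intro averaging_modulus[OF A(1) mod])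
        then have 1: "A u (g ** x) \<le> T - e / 2" using y1(2) by linarith
        have "(\<Sum>g\<in>F. A u (g ** x)) = A u (g ** x) + (\<Sum>g\<in>F - {g}. A u (g ** x))"
          by (rule sum.remove[OF F(1) g(1)])
        also have "\<dots> \<le> (T - e / 2) + (\<Sum>g\<in>F - {g}. T)"
          using 1 A(2) F(3) x unfolding T_def[symmetric] by (intro add_mono sum_mono) (auto intro: Sp_mult)
        also have "\<dots> = N * T - e / 2"
          using g(1) F(1) N by (simp add: N_def card_Diff_singleton of_nat_diff algebra_simps Suc_leI card_gt_0_iff)
        finally show ?thesis unfolding A'_def N_def[symmetric] using N by (simp add: field_simps)
      qed
      moreover have "T - e / (2 * N) = M - real (Suc n) * (e / (2 * N))" unfolding T_def by (simp add: algebra_simps add_divide_distrib)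
      ultimately have "averaging Sp A' \<and> (\<forall>x\<in>Sp. A' u x \<le> M - real (Suc n) * (e / (2 * N)))"
        by (simp only:) blast
      then show ?thesis by blast
    qed blast
  qed
  obtain n :: nat where n: "real n * (e / (2 * N)) > 2 * M"
    using reals_Archimedean3[of "e / (2 * N)"] e N by (auto simp: mult.commute)
  have "\<not> (\<exists>A. averaging Sp A \<and> (\<forall>x\<in>Sp. A u x \<le> M - real n * (e / (2 * N))))"
  proof
    assume "\<exists>A. averaging Sp A \<and> (\<forall>x\<in>Sp. A u x \<le> M - real n * (e / (2 * N)))"
    then obtain A where A: "averaging Sp A" "A u (mat 1) \<le> M - real n * (e / (2 * N))" using Sp_one by blast
    have "A (\<lambda>_. - M) (mat 1) \<le> A u (mat 1)"
      by (rule averaging_mono[OF A(1) _ Sp_one]) (use M in \<open>force simp: abs_le_iff\<close>)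
    then show False using A n averaging_const[OF A(1)] by simp
  qed
  then show ?thesis using step[of n] by blast
qed

text \<open>A further average keeps a function within the same distance of its constant, so the
  functions can be treated one after another by composition.\<close>

lemma averaging_common_near_const:
  fixes u :: "'i \<Rightarrow> complex^('l::finite + 'l)^('l + 'l) \<Rightarrow> real"
  assumes "finite I" "\<And>i. i \<in> I \<Longrightarrow> continuous_on Sp (u i)" "e > 0"
  shows "\<exists>A. averaging Sp A \<and> (\<forall>i\<in>I. \<exists>c. \<forall>x\<in>Sp. \<bar>A (u i) x - c\<bar> \<le> e)"
  using assms(1,2)
proof (induction I)
  case empty
  obtain A :: "(complex^('l + 'l)^('l + 'l) \<Rightarrow> real) \<Rightarrow> complex^('l + 'l)^('l + 'l) \<Rightarrow> real" where "averaging Sp A"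
    using averaging_near_const[OF continuous_on_const[of Sp 0] zero_less_one] by (elim exE conjE)
  then show ?case by (intro exI[of _ A]) simp
next
  case (insert i I)
  have "\<exists>A. averaging Sp A \<and> (\<forall>i\<in>I. \<exists>c. \<forall>x\<in>Sp. \<bar>A (u i) x - c\<bar> \<le> e)"
    by (rule insert.IH) (rule insert.prems, simp)
  then obtain A where A: "averaging Sp A" "\<forall>i\<in>I. \<exists>c. \<forall>x\<in>Sp. \<bar>A (u i) x - c\<bar> \<le> e" by (elim exE conjE)
  have "continuous_on Sp (A (u i))" by (rule averaging_continuous[OF A(1) insert.prems]) simp
  from averaging_near_const[OF this assms(3)]
  obtain A' c where A': "averaging Sp A'" "\<forall>x\<in>Sp. \<bar>A' (A (u i)) x - c\<bar> \<le> e" by (elim exE conjE)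
  have "\<exists>c. \<forall>x\<in>Sp. \<bar>A' (A (u j)) x - c\<bar> \<le> e" if j: "j \<in> I" for j
  proof -
    obtain c where c: "\<forall>x\<in>Sp. \<bar>A (u j) x - c\<bar> \<le> e" using bspec[OF A(2) j] by (elim exE)
    have "\<bar>A' (A (u j)) x - c\<bar> \<le> e" if "x \<in> Sp" for x
      by (rule averaging_near_const_mono[OF A'(1) _ that]) (rule c[rule_format])
    then show ?thesis by (intro exI[of _ c] ballI)
  qed
  moreover have "\<exists>c. \<forall>x\<in>Sp. \<bar>A' (A (u i)) x - c\<bar> \<le> e" by (rule exI[of _ c]) (rule A'(2))
  ultimately have "\<forall>j\<in>insert i I. \<exists>c. \<forall>x\<in>Sp. \<bar>A' (A (u j)) x - c\<bar> \<le> e" by (metis insertE)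
  with averaging_comp[OF A'(1) A(1)] show ?case by (intro exI[of _ "\<lambda>u. A' (A u)"] conjI)
qed

text \<open>Finitely many right translates of \<open>u\<close> have a sum of at least
  \<open>u x0 / 2\<close> everywhere. Averages commute with these translates, so the sum of
  \<open>A u g\<close> over the finite set \<open>F\<close> has the same lower bound, with
  \<open>b\<close> independent of \<open>A\<close>.\<close>

lemma averaging_lower_bound:
  fixes u :: "complex^('l::finite + 'l)^('l + 'l) \<Rightarrow> real"
  assumes u: "continuous_on Sp u" "\<And>x. x \<in> Sp \<Longrightarrow> u x \<ge> 0" and x0: "x0 \<in> Sp" "u x0 > 0"
  shows "\<exists>b>0. \<forall>A. averaging Sp A \<longrightarrow> (\<exists>x\<in>Sp. A u x \<ge> b)"
proof -
  obtain d where d: "d > 0" "\<And>x. x \<in> Sp \<Longrightarrow> dist x x0 < d \<Longrightarrow> dist (u x) (u x0) < u x0 / 2"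
    using u(1) x0 unfolding continuous_on_iff using half_gt_zero[OF x0(2)] by blast
  obtain F :: "(complex^('l + 'l)^('l + 'l)) set"
    where F: "finite F" "F \<noteq> {}" "F \<subseteq> Sp" "\<And>z. z \<in> Sp \<Longrightarrow> \<exists>g\<in>F. norm (g - z) < d"
    using Sp_cover[OF d(1)] by blast
  define b where "b = u x0 / 2 / real (card F)"
  have N: "real (card F) > 0" using F by (simp add: card_gt_0_iff)
  have lower: "u x0 / 2 \<le> (\<Sum>g\<in>F. u (x ** g))" if x: "x \<in> Sp" for x
  proof -
    have "conj_transpose x ** x0 \<in> Sp" using x x0 by (intro Sp_mult Sp_inverse)
    then obtain g where g: "g \<in> F" "norm (g - conj_transpose x ** x0) < d" using F(4) by blast
    have "x ** (g - conj_transpose x ** x0) = x ** g - x0"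
      using Sp_unitary(2)[OF x]
      by (simp add: bounded_bilinear.diff_right[OF bounded_bilinear_matrix_mult] matrix_mul_assoc)
    then have "dist (x ** g) x0 < d"
      using g(2) unitary_norm_left[OF Sp_unitary(1)[OF x], of "g - conj_transpose x ** x0"] by (simp add: dist_norm)
    moreover have "x ** g \<in> Sp" using x g(1) F(3) by (auto intro: Sp_mult)
    ultimately have "dist (u (x ** g)) (u x0) < u x0 / 2" using d(2) by blast
    then have "u x0 / 2 \<le> u (x ** g)" unfolding dist_real_def by linarith
    also have "\<dots> \<le> (\<Sum>g\<in>F. u (x ** g))"
      using u(2) x F(3) by (intro member_le_sum[OF g(1)] F(1)) (auto intro: Sp_mult)
    finally show ?thesis .
  qed
  have "\<exists>x\<in>Sp. A u x \<ge> b" if A: "averaging Sp A" for A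
  proof (rule ccontr)
    assume "\<not> (\<exists>x\<in>Sp. A u x \<ge> b)"
    then have *: "A u x < b" if "x \<in> Sp" for x using that \<open>\<not> (\<exists>x\<in>Sp. A u x \<ge> b)\<close> by (auto simp: not_le)
    have "u x0 / 2 = A (\<lambda>_. u x0 / 2) (mat 1)" by (simp add: averaging_const[OF A])
    also have "\<dots> \<le> A (\<lambda>x. \<Sum>g\<in>F. u (x ** g)) (mat 1)" by (rule averaging_mono[OF A lower Sp_one])
    also have "\<dots> = (\<Sum>g\<in>F. A u g)" by (simp add: averaging_sum[OF A] averaging_right[OF A])
    also have "\<dots> < (\<Sum>g\<in>F. b)" using F(1-3) * by (intro sum_strict_mono) auto
    also have "\<dots> = u x0 / 2" using N by (simp add: b_def)
    finally show False by simp
  qed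
  moreover have "b > 0" using N x0 by (simp add: b_def)
  ultimately show ?thesis by blast
qed

section \<open>The spectrum\<close>

text \<open>Preserving both forms means that conjugation of \<open>x\<close> is conjugation by
  \<open>symp_J\<close>. Hence conjugate entries are polynomials on the group, and holomorphic
  polynomials suffice for Stone-Weierstrass.\<close>

lemma Sp_cnj_entry:
  assumes "x \<in> Sp"
  shows "cnj (x $ i $ j) = sg i * sg j * x $ bar i $ bar j"
proof -
  have "transpose x ** symp_J = (transpose x ** symp_J ** x) ** conj_transpose x"
    using Sp_unitary(2)[OF assms] by (simp flip: matrix_mul_assoc)
  also have "\<dots> = symp_J ** conj_transpose x" using assms by (simp add: Sp_def)
  finally have "(transpose x ** symp_J) $ bar j $ i = (symp_J ** conj_transpose x) $ bar j $ i" by simp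
  then have "sg i * x $ bar i $ bar j = sg j * cnj (x $ i $ j)"
    by (simp add: symp_J_mult_left symp_J_mult_right conj_transpose_def)
  then have "sg j * (sg j * cnj (x $ i $ j)) = sg j * (sg i * x $ bar i $ bar j)" by simp
  then show ?thesis by (simp add: mult_ac)
qed

lemma real_polynomial_on_Sp:
  fixes r :: "complex^('l::finite + 'l)^('l + 'l) \<Rightarrow> real"
  assumes "real_polynomial_function r"
  shows "\<exists>p. \<forall>x\<in>Sp. pev p x = of_real (r x)"
  using assms
proof induction
  case (linear f)
  have inner: "\<exists>p. \<forall>x\<in>Sp. pev p x = of_real (x \<bullet> b)" if b: "b \<in> Basis" for b :: "complex^('l + 'l)^('l + 'l)"
  proof -
    obtain i j u where bu: "b = axis i (axis j u)" using b by (auto simp: Basis_vec_def)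
    let ?p = "Const (1 / 2) * (Const (cnj u) * Entry i j + Const (u * (sg i * sg j)) * Entry (bar i) (bar j))"
    have "pev ?p x = of_real (x \<bullet> b)" if x: "x \<in> Sp" for x
    proof -
      have "x \<bullet> b = Re (cnj u * x $ i $ j)" by (simp add: bu inner_axis inner_complex_def)
      then have "of_real (x \<bullet> b) = (cnj u * x $ i $ j + u * cnj (x $ i $ j)) / 2"
        by (simp add: complex_eq_iff)
      then show ?thesis by (simp add: Sp_cnj_entry[OF x])
    qed
    then show ?thesis by blast
  qed
  then have "\<forall>b\<in>Basis. \<exists>p. \<forall>x\<in>Sp. pev p x = of_real (x \<bullet> (b :: complex^('l + 'l)^('l + 'l)))" by blast
  from bchoice[OF this] obtain P where P: "\<And>b x :: complex^('l + 'l)^('l + 'l). b \<in> Basis \<Longrightarrow> x \<in> Sp \<Longrightarrow> pev (P b) x = of_real (x \<bullet> b)"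
    by blast
  have "pev (\<Sum>b\<in>Basis. Const (of_real (f b)) * P b) x = of_real (f x)" if x: "x \<in> Sp" for x
  proof -
    have "f x = f (\<Sum>b\<in>Basis. (x \<bullet> b) *\<^sub>R b)" by (simp add: euclidean_representation)
    also have "\<dots> = (\<Sum>b\<in>Basis. (x \<bullet> b) * f b)"
      using bounded_linear.linear[OF linear] by (simp add: linear_sum linear_scale)
    finally show ?thesis by (simp add: P x mult.commute)
  qed
  then show ?case by blast
next
  case (const c)
  show ?case by (rule exI[of _ "Const (of_real c)"]) simp
next
  case (add f g)
  then obtain p q where "\<forall>x\<in>Sp. pev p x = of_real (f x)" "\<forall>x\<in>Sp. pev q x = of_real (g x)" by blast
  then show ?case by (intro exI[of _ "p + q"]) simp
next
  case (mult f g)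
  then obtain p q where "\<forall>x\<in>Sp. pev p x = of_real (f x)" "\<forall>x\<in>Sp. pev q x = of_real (g x)" by blast
  then show ?case by (intro exI[of _ "p * q"]) simp
qed

lemma cpol_dense:
  fixes f :: "complex^('l::finite + 'l)^('l + 'l) \<Rightarrow> complex"
  assumes "continuous_on Sp f" "e > 0"
  shows "\<exists>p. \<forall>x\<in>Sp. norm (f x - pev p x) < e"
proof -
  obtain g where g: "polynomial_function g" "\<forall>x\<in>Sp. norm (f x - g x) < e"
    using Stone_Weierstrass_polynomial_function[OF Sp_compact assms] by blast
  have "real_polynomial_function (Re \<circ> g)" "real_polynomial_function (Im \<circ> g)"
    using g(1) bounded_linear_Re bounded_linear_Im unfolding polynomial_function_def by blast+
  then obtain p q where pq: "\<forall>x\<in>Sp. pev p x = of_real ((Re \<circ> g) x)" "\<forall>x\<in>Sp. pev q x = of_real ((Im \<circ> g) x)"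
    using real_polynomial_on_Sp by metis
  have "pev (p + Const \<i> * q) x = g x" if "x \<in> Sp" for x
    using pq that by (simp add: complex_eq_iff)
  then show ?thesis using g(2) by (intro exI[of _ "p + Const \<i> * q"]) simp
qed

text \<open>One \<open>t\<close> serves all \<open>x\<close>: left multiplication by
  \<open>x\<close> is an isometry, so the flow moves all points equally far, and \<open>d\<close> is
  uniformly continuous.\<close>

lemma flow_difference_quotient:
  fixes h d :: "complex^('l::finite + 'l)^('l + 'l) \<Rightarrow> complex"
  assumes X: "X \<in> lie_algebra Sp"
    and h: "\<And>x s. x \<in> Sp \<Longrightarrow> ((\<lambda>t. h (x ** mexp (t *\<^sub>R X))) has_vector_derivative d (x ** mexp (s *\<^sub>R X))) (at s)"
    and d: "continuous_on Sp d" and e: "e > 0"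
  shows "\<exists>t>0. \<forall>x\<in>Sp. norm (h (x ** mexp (t *\<^sub>R X)) - h x - t *\<^sub>R d x) \<le> t * e"
proof -
  have "uniformly_continuous_on Sp d" by (rule compact_uniformly_continuous[OF d Sp_compact])
  then obtain r where r: "r > 0" "\<And>x y. x \<in> Sp \<Longrightarrow> y \<in> Sp \<Longrightarrow> dist y x < r \<Longrightarrow> dist (d y) (d x) < e"
    unfolding uniformly_continuous_on_def using e by blast
  have "isCont (\<lambda>t. mexp (t *\<^sub>R X)) 0"
    by (rule has_vector_derivative_continuous[OF mexp_has_vector_derivative])
  then obtain t0 where t0: "t0 > 0" "\<And>t. norm t < t0 \<Longrightarrow> dist (mexp (t *\<^sub>R X)) (mat 1) < r"
    using r(1) unfolding continuous_at_eps_delta by (auto simp: dist_norm)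
  define t where "t = t0 / 2"
  have t: "t > 0" using t0 by (simp add: t_def)
  have "norm (h (x ** mexp (t *\<^sub>R X)) - h x - t *\<^sub>R d x) \<le> t * e" if x: "x \<in> Sp" for x
  proof -
    have "norm (h (x ** mexp (t *\<^sub>R X)) - h (x ** mexp (0 *\<^sub>R X)) - (t - 0) *\<^sub>R d (x ** mexp (0 *\<^sub>R X))) \<le> norm (t - 0) * e"
    proof (rule vector_differentiable_bound_linearization[where S = "{0..t}" and f' = "\<lambda>s. d (x ** mexp (s *\<^sub>R X))"])
      show "((\<lambda>s. h (x ** mexp (s *\<^sub>R X))) has_vector_derivative d (x ** mexp (s *\<^sub>R X))) (at s within {0..t})" for s
        by (rule has_vector_derivative_at_within[OF h[OF x]])
      show "closed_segment 0 t \<subseteq> {0..t}" using t by (simp add: closed_segment_eq_real_ivl)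
      show "0 \<in> {0..t}" using t by simp
      fix s assume s: "s \<in> {0..t}"
      have "x ** mexp (s *\<^sub>R X) - x = x ** (mexp (s *\<^sub>R X) - mat 1)"
        by (simp add: bounded_bilinear.diff_right[OF bounded_bilinear_matrix_mult])
      then have "dist (x ** mexp (s *\<^sub>R X)) x = dist (mexp (s *\<^sub>R X)) (mat 1)"
        unfolding dist_norm using unitary_norm_left[OF Sp_unitary(1)[OF x]] by simp
      also have "\<dots> < r" using s t0 by (intro t0(2)) (auto simp: t_def)
      finally have "dist (d (x ** mexp (s *\<^sub>R X))) (d x) < e" using r(2) x Sp_flow[OF x X] by blast
      then show "norm (d (x ** mexp (s *\<^sub>R X)) - d (x ** mexp (0 *\<^sub>R X))) \<le> e" by (simp add: dist_norm)
    qed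
    then show ?thesis using t by simp
  qed
  then show ?thesis using t by blast
qed

text \<open>A derivative is uniformly close to (h(x g) - h(x)) / t with g on the flow. An average
  commutes with right multiplication by g, so if it makes h / t almost constant, the average of the
  quotient is almost zero.\<close>

lemma divergence_average_small:
  fixes h d :: "'i \<Rightarrow> complex^('l::finite + 'l)^('l + 'l) \<Rightarrow> complex"
  assumes I: "finite I" and X: "\<And>i. i \<in> I \<Longrightarrow> X i \<in> lie_algebra Sp"
    and h: "\<And>i x s. i \<in> I \<Longrightarrow> x \<in> Sp \<Longrightarrow>
      ((\<lambda>t. h i (x ** mexp (t *\<^sub>R X i))) has_vector_derivative d i (x ** mexp (s *\<^sub>R X i))) (at s)"
    and hc: "\<And>i. i \<in> I \<Longrightarrow> continuous_on Sp (h i)"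
    and d: "\<And>i. i \<in> I \<Longrightarrow> continuous_on Sp (d i)" and e: "e > 0"
  shows "\<exists>A. averaging Sp A \<and> (\<forall>x\<in>Sp. A (\<lambda>x. Re (\<Sum>i\<in>I. d i x)) x \<le> e)"
proof -
  \<comment> \<open>Every index costs at most \<open>2 * e1\<close>: once for the difference
    quotient and once for the oscillation. The added 1 avoids division by zero for empty
    \<open>I\<close>.\<close>
  define e1 where "e1 = e / (2 * (real (card I) + 1))"
  have e1: "e1 > 0" using e by (simp add: e1_def add_nonneg_pos)
  have "\<exists>t>0. \<forall>x\<in>Sp. norm (h i (x ** mexp (t *\<^sub>R X i)) - h i x - t *\<^sub>R d i x) \<le> t * e1" if "i \<in> I" for i
    by (rule flow_difference_quotient[OF X[OF that] h[OF that] d[OF that] e1])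
  then obtain t where t: "\<And>i. i \<in> I \<Longrightarrow> t i > 0"
    "\<And>i x. i \<in> I \<Longrightarrow> x \<in> Sp \<Longrightarrow> norm (h i (x ** mexp (t i *\<^sub>R X i)) - h i x - t i *\<^sub>R d i x) \<le> t i * e1"
    by metis
  \<comment> \<open>The times are fixed before the average is chosen, so division by them does not
    harm near constancy.\<close>
  define u where "u i x = 1 / t i * Re (h i x)" for i x
  have "continuous_on Sp (u i)" if "i \<in> I" for i
    unfolding u_def by (intro continuous_on_mult continuous_on_const continuous_on_Re hc[OF that])
  then obtain A where A: "averaging Sp A" "\<forall>i\<in>I. \<exists>c. \<forall>x\<in>Sp. \<bar>A (u i) x - c\<bar> \<le> e1 / 2"
    using averaging_common_near_const[OF I, of u "e1 / 2"] e1 by auto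
  have main: "A (\<lambda>x. Re (d i x)) x \<le> 2 * e1" if i: "i \<in> I" and x: "x \<in> Sp" for i x
  proof -
    let ?g = "mexp (t i *\<^sub>R X i)"
    have "Re (d i y) \<le> u i (y ** ?g) + (- 1 * u i y + e1)" if y: "y \<in> Sp" for y
    proof -
      have "- Re (h i (y ** ?g) - h i y - t i *\<^sub>R d i y) \<le> t i * e1"
        using t(2)[OF i y] abs_Re_le_cmod[of "h i (y ** ?g) - h i y - t i *\<^sub>R d i y"] by linarith
      then have "t i * Re (d i y) \<le> Re (h i (y ** ?g)) - Re (h i y) + t i * e1" by simp
      then have "Re (d i y) \<le> (Re (h i (y ** ?g)) - Re (h i y) + t i * e1) / t i"
        using t(1)[OF i] by (simp add: pos_le_divide_eq mult.commute)
      then show ?thesis using t(1)[OF i] by (simp add: u_def add_divide_distrib diff_divide_distrib)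
    qed
    then have "A (\<lambda>x. Re (d i x)) x \<le> A (\<lambda>y. u i (y ** ?g) + (- 1 * u i y + e1)) x"
      by (intro averaging_mono[OF A(1) _ x])
    also have "\<dots> = A (u i) (x ** ?g) + (- 1 * A (u i) x + e1)"
      by (simp only: averaging_add[OF A(1)] averaging_scale[OF A(1)] averaging_const[OF A(1)] averaging_right[OF A(1)])
    also have "\<dots> \<le> 2 * e1"
    proof -
      obtain c where c: "\<forall>x\<in>Sp. \<bar>A (u i) x - c\<bar> \<le> e1 / 2" using bspec[OF A(2) i] by (elim exE)
      then show ?thesis using bspec[OF c x] bspec[OF c Sp_flow[OF x X[OF i], of "t i"]] by linarith
    qed
    finally show ?thesis .
  qed
  have "A (\<lambda>x. Re (\<Sum>i\<in>I. d i x)) x \<le> e" if x: "x \<in> Sp" for x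
  proof -
    have "A (\<lambda>x. Re (\<Sum>i\<in>I. d i x)) x = (\<Sum>i\<in>I. A (\<lambda>x. Re (d i x)) x)"
      by (simp add: averaging_sum[OF A(1)])
    also have "\<dots> \<le> (\<Sum>i\<in>I. 2 * e1)" by (rule sum_mono) (rule main[OF _ x])
    also have "\<dots> = 2 * e1 * real (card I)" by simp
    also have "\<dots> \<le> 2 * e1 * (real (card I) + 1)" using e1 by simp
    also have "\<dots> = e" unfolding e1_def by (simp add: field_simps)
    finally show ?thesis .
  qed
  then show ?thesis using A(1) by blast
qed

section \<open>Eigenvalues and eigenfunctions\<close>

lemma height_exists: "\<exists>h :: 'l::finite \<Rightarrow> int. height h"
  unfolding height_def by (rule finite_same_card_bij) auto

lemma laplacian_pev:
  fixes p :: "('l::finite + 'l) cpol"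
  assumes "\<gamma> > 0"
  shows "laplacian Sp (\<lambda>X Y. - \<gamma> * killing_form Sp X Y) (pev p) x =
    pev (casimir p) x / of_real (8 * (real CARD('l) + 1) * \<gamma>)"
proof -
  define K where "K = \<gamma> * (2 * real CARD('l) + 2)"
  have K: "K > 0" using assms by (simp add: K_def add_nonneg_pos)
  obtain B :: "(complex^('l + 'l)^('l + 'l)) set" where B: "finite B" "span B = lie_algebra Sp"
    "\<forall>X\<in>B. \<forall>Y\<in>B. K * (X \<bullet> Y) = (if X = Y then 1 else 0)"
    "\<forall>f x. laplacian Sp (\<lambda>X Y. - \<gamma> * killing_form Sp X Y) f x = - (\<Sum>X\<in>B. left_inv_deriv X (left_inv_deriv X f) x)"
    using laplacian_basis[OF assms K_def] by blast
  have "laplacian Sp (\<lambda>X Y. - \<gamma> * killing_form Sp X Y) (pev p) x = - pev (\<Sum>X\<in>B. Der X (Der X p)) x"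
    unfolding B(4)[rule_format] by (simp add: left_inv_deriv_pev)
  also have "\<dots> = - pev (Const (- 1 / (4 * of_real K)) * casimir p) x"
    using casimir_lie_basis[OF B(1,2) K B(3)[rule_format], of p] by (simp only:)
  also have "\<dots> = pev (casimir p) x / of_real (4 * K)" by simp
  finally have *: "laplacian Sp (\<lambda>X Y. - \<gamma> * killing_form Sp X Y) (pev p) x = pev (casimir p) x / of_real (4 * K)" .
  have "4 * K = 8 * (real CARD('l) + 1) * \<gamma>" by (simp add: K_def algebra_simps)
  with * show ?thesis by (simp only:)
qed

lemma eigenvalue_annihilates:
  fixes f :: "complex^('l::finite + 'l)^('l + 'l) \<Rightarrow> complex"
  assumes \<gamma>: "\<gamma> > 0" and f: "smooth_on Sp f"
    and eig: "\<And>x. x \<in> Sp \<Longrightarrow> laplacian Sp (\<lambda>X Y. - \<gamma> * killing_form Sp X Y) f x = \<mu> * f x"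
    and surj: "\<And>p :: ('l + 'l) cpol. \<exists>q. casimir q - Const (of_real (8 * (real CARD('l) + 1) * \<gamma>) * \<mu>) * q = p"
    and x0: "x0 \<in> Sp"
  shows "f x0 = 0"
proof (rule ccontr)
  assume "f x0 \<noteq> 0"
  define K where "K = \<gamma> * (2 * real CARD('l) + 2)"
  have K: "K > 0" using \<gamma> by (simp add: K_def add_nonneg_pos)
  have K8: "8 * (real CARD('l) + 1) * \<gamma> = 4 * K" by (simp add: K_def algebra_simps)
  obtain B :: "(complex^('l + 'l)^('l + 'l)) set" where B: "finite B" "span B = lie_algebra Sp"
    "\<forall>X\<in>B. \<forall>Y\<in>B. K * (X \<bullet> Y) = (if X = Y then 1 else 0)"
    "\<forall>f x. laplacian Sp (\<lambda>X Y. - \<gamma> * killing_form Sp X Y) f x = - (\<Sum>X\<in>B. left_inv_deriv X (left_inv_deriv X f) x)"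
    using laplacian_basis[OF \<gamma> K_def] by blast
  have BL: "X \<in> lie_algebra Sp" if "X \<in> B" for X using span_base[OF that] B(2) by simp
  have fc: "continuous_on Sp f" by (rule smooth_on_continuous[OF f])
  have f2: "continuous_on Sp (\<lambda>x. (norm (f x))\<^sup>2)" by (intro continuous_on_power continuous_on_norm fc)
  have "\<exists>b>0. \<forall>A. averaging Sp A \<longrightarrow> (\<exists>x\<in>Sp. A (\<lambda>x. (norm (f x))\<^sup>2) x \<ge> b)"
    by (rule averaging_lower_bound[OF f2 _ x0]) (use \<open>f x0 \<noteq> 0\<close> in simp_all)
  then obtain b where b: "b > 0" "\<forall>A. averaging Sp A \<longrightarrow> (\<exists>x\<in>Sp. A (\<lambda>x. (norm (f x))\<^sup>2) x \<ge> b)"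
    by (elim exE conjE)
  have "bounded (f ` Sp)" using compact_continuous_image[OF fc Sp_compact] compact_imp_bounded by blast
  then obtain M where M: "M > 0" "\<And>x. x \<in> Sp \<Longrightarrow> norm (f x) \<le> M" unfolding bounded_pos by auto
  \<comment> \<open>With this accuracy f p differs from |f|^2 by at most b / 4, since |f| \<le>
    M.\<close>
  have "b / (4 * M) > 0" using b M by simp
  moreover have "continuous_on Sp (\<lambda>x. cnj (f x))" by (intro continuous_on_cnj fc)
  ultimately obtain p where p: "\<And>x. x \<in> Sp \<Longrightarrow> norm (cnj (f x) - pev p x) < b / (4 * M)"
    using cpol_dense by blast
  obtain q where q: "casimir q - Const (of_real (4 * K) * \<mu>) * q = p" using surj unfolding K8 by blast
  define D where "D X = left_inv_deriv X" for X :: "complex^('l + 'l)^('l + 'l)"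
  define Q where "Q = pev q"
  have Qs: "smooth_on Sp Q" unfolding Q_def by (rule pev_smooth)
  have Ds: "smooth_on Sp (D X g)" if "smooth_on Sp g" "X \<in> B" for X g
    unfolding D_def by (rule smooth_left_inv_deriv[OF that(1) BL[OF that(2)]])
  have Dflow: "((\<lambda>t. g (x ** mexp (t *\<^sub>R X))) has_vector_derivative D X g (x ** mexp (s *\<^sub>R X))) (at s)"
    if "smooth_on Sp g" "X \<in> B" "x \<in> Sp" for g X x s
    unfolding D_def by (rule smooth_flow_deriv[OF that(1,3) BL[OF that(2)]])
  \<comment> \<open>The Green field of \<open>f\<close> and \<open>Q\<close> in direction
    \<open>X\<close>. In its derivative \<open>d\<close> the products of first derivatives
    cancel.\<close>
  define h where "h X x = D X f x * Q x - f x * D X Q x" for X x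
  define d where "d X x = D X (D X f) x * Q x - f x * D X (D X Q) x" for X x
  have hd: "((\<lambda>t. h X (x ** mexp (t *\<^sub>R X))) has_vector_derivative d X (x ** mexp (s *\<^sub>R X))) (at s)"
    if "X \<in> B" "x \<in> Sp" for X x s
  proof -
    let ?y = "x ** mexp (s *\<^sub>R X)"
    note F = Dflow[OF _ that, of _ s]
    have "((\<lambda>t. h X (x ** mexp (t *\<^sub>R X))) has_vector_derivative
      (D X f ?y * D X Q ?y + D X (D X f) ?y * Q ?y) - (f ?y * D X (D X Q) ?y + D X f ?y * D X Q ?y)) (at s)"
      unfolding h_def
      by (intro has_vector_derivative_diff has_vector_derivative_mult F f Qs Ds that(1))
    then show ?thesis by (simp add: d_def)
  qed
  have hc: "continuous_on Sp (h X)" if "X \<in> B" for X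
    unfolding h_def by (intro continuous_on_diff continuous_on_mult smooth_on_continuous f Qs Ds that)
  have dc: "continuous_on Sp (d X)" if "X \<in> B" for X
    unfolding d_def by (intro continuous_on_diff continuous_on_mult smooth_on_continuous f Qs Ds that)
  \<comment> \<open>The eigenvalue equation for \<open>f\<close> and p = (Casimir - 4 K \<mu>) q
    turn the product into a divergence.\<close>
  have fp: "f x * pev p x = of_real (4 * K) * (\<Sum>X\<in>B. d X x)" if x: "x \<in> Sp" for x
  proof -
    have "- (\<Sum>X\<in>B. D X (D X f) x) = \<mu> * f x"
      using eig[OF x] unfolding B(4)[rule_format] D_def .
    from arg_cong[OF this, of uminus] have 1: "(\<Sum>X\<in>B. D X (D X f) x) = - (\<mu> * f x)" by simp
    have "laplacian Sp (\<lambda>X Y. - \<gamma> * killing_form Sp X Y) Q x = pev (casimir q) x / of_real (4 * K)"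
      unfolding Q_def laplacian_pev[OF \<gamma>] K8 ..
    then have 2: "pev (casimir q) x = - (of_real (4 * K) * (\<Sum>X\<in>B. D X (D X Q) x))"
      unfolding B(4)[rule_format] D_def using K by (simp add: field_simps)
    have "pev p x = pev (casimir q) x - of_real (4 * K) * \<mu> * Q x"
      unfolding q[symmetric] Q_def by (simp only: pev_simps)
    moreover have "f x * (- (k * S) - k * \<mu> * w) = k * (- (\<mu> * f x) * w - f x * S)" for k S w :: complex
      by (simp add: algebra_simps)
    ultimately have "f x * pev p x = of_real (4 * K) * (- (\<mu> * f x) * Q x - f x * (\<Sum>X\<in>B. D X (D X Q) x))"
      unfolding 2 by (simp only:)
    then show ?thesis unfolding 1[symmetric] d_def sum_subtractf sum_distrib_left sum_distrib_right by simp
  qed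
  \<comment> \<open>After multiplication by 4K this is b / 4. With the approximation error, the
    average of |f|^2 is at most b / 2 everywhere, against the lower bound \<open>b\<close>.\<close>
  have "b / (16 * K) > 0" using b K by simp
  then have "\<exists>A. averaging Sp A \<and> (\<forall>x\<in>Sp. A (\<lambda>x. Re (\<Sum>X\<in>B. d X x)) x \<le> b / (16 * K))"
    using divergence_average_small[of B "\<lambda>X. X" h d, OF B(1) BL hd hc dc] by (simp only:)
  then obtain A where A: "averaging Sp A" "\<forall>x\<in>Sp. A (\<lambda>x. Re (\<Sum>X\<in>B. d X x)) x \<le> b / (16 * K)"
    by (elim exE conjE)
  have "A (\<lambda>x. (norm (f x))\<^sup>2) x \<le> b / 2" if x: "x \<in> Sp" for x
  proof -
    have "(norm (f y))\<^sup>2 \<le> 4 * K * Re (\<Sum>X\<in>B. d X y) + b / 4" if y: "y \<in> Sp" for y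
    proof -
      have "of_real ((norm (f y))\<^sup>2) = f y * (cnj (f y) - pev p y) + f y * pev p y"
        unfolding complex_norm_square by (simp add: right_diff_distrib)
      from arg_cong[OF this, of Re]
      have "(norm (f y))\<^sup>2 = Re (f y * (cnj (f y) - pev p y)) + Re (f y * pev p y)"
        by (simp only: Re_complex_of_real plus_complex.simps)
      moreover have "Re (f y * (cnj (f y) - pev p y)) \<le> norm (f y) * norm (cnj (f y) - pev p y)"
        using complex_Re_le_cmod[of "f y * (cnj (f y) - pev p y)"] by (simp only: norm_mult)
      moreover have "norm (f y) * norm (cnj (f y) - pev p y) \<le> M * (b / (4 * M))"
        using M(2)[OF y] less_imp_le[OF p[OF y]] M(1) by (intro mult_mono) auto
      moreover have "M * (b / (4 * M)) = b / 4" using M(1) by simp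
      moreover have "Re (f y * pev p y) = 4 * K * Re (\<Sum>X\<in>B. d X y)"
        unfolding fp[OF y] by simp
      ultimately show ?thesis by linarith
    qed
    then have "A (\<lambda>x. (norm (f x))\<^sup>2) x \<le> A (\<lambda>y. 4 * K * Re (\<Sum>X\<in>B. d X y) + b / 4) x"
      by (intro averaging_mono[OF A(1) _ x])
    also have "\<dots> = 4 * K * A (\<lambda>y. Re (\<Sum>X\<in>B. d X y)) x + b / 4"
      by (simp only: averaging_add[OF A(1)] averaging_scale[OF A(1)] averaging_const[OF A(1)])
    also have "\<dots> \<le> 4 * K * (b / (16 * K)) + b / 4"
      using bspec[OF A(2) x] K by (intro add_right_mono mult_left_mono) auto
    also have "\<dots> = b / 2" using K by (simp add: field_simps)
    finally show ?thesis .
  qed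
  moreover obtain x where "x \<in> Sp" "A (\<lambda>x. (norm (f x))\<^sup>2) x \<ge> b" using b(2)[rule_format, OF A(1)] by (elim bexE)
  ultimately have "b \<le> b / 2" using order_trans by fast
  then show False using b(1) by simp
qed

theorem theorem2p7:
  fixes \<gamma> :: real
  assumes "CARD('l::finite) \<ge> 3" and "\<gamma> > 0"
  shows "Spec (Sp :: (complex^('l + 'l)^('l + 'l)) set)
           (\<lambda>X Y. - \<gamma> * killing_form (Sp :: (complex^('l + 'l)^('l + 'l)) set) X Y)
         = {complex_of_real (lambda_nu CARD('l) \<gamma> \<nu>) | \<nu>. \<forall>j\<in>{1..CARD('l)}. \<nu> j \<ge> 1}"
proof (intro equalityI subsetI)
  \<comment> \<open>The index type carries no order, so some numbering is fixed; neither side of the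
    claim mentions it.\<close>
  obtain h :: "'l \<Rightarrow> int" where "height h" using height_exists by blast
  then interpret height h .
  let ?g = "\<lambda>X Y. - \<gamma> * killing_form (Sp :: (complex^('l + 'l)^('l + 'l)) set) X Y"
  let ?c = "8 * (real CARD('l) + 1) * \<gamma>"
  have c: "?c > 0" using assms(2) by (simp add: add_nonneg_pos)
  fix \<mu>
  {
    assume "\<mu> \<in> Spec (Sp :: (complex^('l + 'l)^('l + 'l)) set) ?g"
    then obtain f and x0 :: "complex^('l + 'l)^('l + 'l)" where f: "smooth_on Sp f" "x0 \<in> Sp" "f x0 \<noteq> 0"
      "\<forall>x\<in>Sp. laplacian Sp ?g f x = \<mu> * f x"
      unfolding Spec_def by blast
    \<comment> \<open>An eigenfunction prevents Casimir - c \<mu> from being onto, so c \<mu> is an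
      eigenvalue of a dominant weight. This also shows that the a priori complex \<mu> is
      real.\<close>
    have "\<not> (\<forall>p :: ('l + 'l) cpol. \<exists>q. casimir q - Const (of_real ?c * \<mu>) * q = p)"
      using eigenvalue_annihilates[OF assms(2) f(1) bspec[OF f(4)] _ f(2)] f(3) by blast
    then obtain \<omega> where \<omega>: "dominant \<omega>" "of_real ?c * \<mu> = of_int (cas_val \<omega>)"
      using casimir_surj by blast
    obtain \<nu> where \<nu>: "\<forall>j\<in>{1..CARD('l)}. \<nu> j \<ge> 1" "real_of_int (cas_val \<omega>) / ?c = lambda_nu CARD('l) \<gamma> \<nu>"
      using dominant_imp_lambda[OF \<omega>(1) assms(2)] by blast
    have "complex_of_real ?c \<noteq> 0" using c by (simp only: of_real_eq_0_iff)
    then have "\<mu> = of_int (cas_val \<omega>) / of_real ?c"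
      unfolding \<omega>(2)[symmetric] by (rule nonzero_mult_div_cancel_left[symmetric])
    also have "\<dots> = complex_of_real (real_of_int (cas_val \<omega>) / ?c)" by simp
    finally have "\<mu> = complex_of_real (lambda_nu CARD('l) \<gamma> \<nu>)" unfolding \<nu>(2) .
    then show "\<mu> \<in> {complex_of_real (lambda_nu CARD('l) \<gamma> \<nu>) | \<nu>. \<forall>j\<in>{1..CARD('l)}. \<nu> j \<ge> 1}"
      using \<nu>(1) by blast
  next
    assume "\<mu> \<in> {complex_of_real (lambda_nu CARD('l) \<gamma> \<nu>) | \<nu>. \<forall>j\<in>{1..CARD('l)}. \<nu> j \<ge> 1}"
    then obtain \<nu> where \<nu>: "\<mu> = complex_of_real (lambda_nu CARD('l) \<gamma> \<nu>)" "\<And>j. j \<in> {1..CARD('l)} \<Longrightarrow> \<nu> j \<ge> 1"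
      by blast
    obtain v :: "('l + 'l) cpol" where v: "casimir v = Const (of_real (?c * lambda_nu CARD('l) \<gamma> \<nu>)) * v" "pev v (mat 1) = 1"
      using exists_eigenpoly[of \<nu>, OF \<nu>(2) assms(2)] by blast
    have "complex_of_real ?c \<noteq> 0" using c by (simp only: of_real_eq_0_iff)
    moreover have "of_real (c * a) * w / of_real c = of_real a * w" if "complex_of_real c \<noteq> 0" for c a and w :: complex
      using that by simp
    ultimately have "laplacian Sp ?g (pev v) x = \<mu> * pev v x" for x
      unfolding laplacian_pev[OF assms(2)] v(1) \<nu>(1) by (simp only: pev_simps)
    moreover have "\<exists>x\<in>Sp. pev v x \<noteq> 0" using v(2) by (intro bexI[OF _ Sp_one]) simp
    ultimately show "\<mu> \<in> Spec (Sp :: (complex^('l + 'l)^('l + 'l)) set) ?g"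
      unfolding Spec_def using pev_smooth[of Sp v] by blast
  }
qed

end
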